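(* Let $\nu>0$. Let $\alpha,\beta,\delta\in\mathbb{R}$ and $s_-,s_+\in\mathbb{C}$ satisfy $\alpha+2<\Re(s_-)<0<\Re(s_+)<\beta-2$ and $\delta>0$. Let $f$ be a meromorphic function on $D=\{s\in\mathbb{C}\mid \Re(s)\in(\alpha-\delta,\beta+\delta)\}$ satisfying $f(s)=O(e^{r|s|})$ as $s\to\infty$, $s\in D$, for some $r<\frac{\pi}{2}$. Assume that $f$ has one or two poles in $D$, that every pole of $f$ in $D$ belongs to $\{s_-,s_+\}$, and that each pole is simple. Let $E(f)=\{t\in\mathbb{C}: |\Im(t)|<\min\{|\Re s_+|,|\Re s_-|\}\}$. Then for every $\rho\in E(f)$ with $f(i\rho)=0$ and for every sufficiently small $\varepsilon>0$, there exists $N\in\mathbb{N}$ such that for every $n\ge N$ there exists $\rho_n\in Z_n(f)$ with $|\rho_n-\rho|<\varepsilon$. In particular, if $i\rho$ is a simple zero of $f$, such a $\rho_n\in Z_n(f)$ is unique for each $n\ge N$.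
   Context: For $\nu>0$ and an integer $n\ge 0$, the Meixner-Pollaczek polynomial (with $\theta=0$) is $q_n^{(\nu,0)}(s)=\frac{(\nu)_n}{n!}\,{}_2F_1\left(-n,\,s+\frac{\nu}{2};\,\nu;\,2\right)$, where $(\nu)_n=\nu(\nu+1)\cdots(\nu+n-1)$. Put $M_\nu(dt)=\frac{1}{2\pi}\frac{2^\nu}{\Gamma(\nu)}\left|\Gamma\left(it+\frac{\nu}{2}\right)\right|^2dt$ on $\mathbb{R}$. The functions $t\mapsto q_n^{(\nu,0)}(it)$, $n\ge0$, form an orthogonal basis of $L^2(\mathbb{R},M_\nu(dt))$ with squared norms $\frac{(\nu)_n}{n!}$. The MP-coefficients of $f(it)\in L^2(\mathbb{R},M_\nu(dt))$ are $a_n=\frac{n!}{(\nu)_n}\int_{\mathbb{R}}f(it)\overline{q_n^{(\nu,0)}(it)}\,M_\nu(dt)$. The $n$-th partial sum is the polynomial $S_n(f;t)=\sum_{k=0}^n a_kq_k^{(\nu,0)}(it)$ in $t\in\mathbb{C}$, and $Z_n(f)=\{\rho\in\mathbb{C}\mid S_n(f;\rho)=0\}$ is its set of zeros. *)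

theory Defs
  imports "HOL-Complex_Analysis.Complex_Analysis" "HOL-Library.Landau_Symbols"
begin

text \<open>
  In \<open>mp_poly\<close> the argument \<open>2\<close> of the hypergeometric function lies outside the unit disc, but
  the series terminates because its first upper parameter is \<open>-n\<close>; see \<open>mp_poly_altdef\<close>.
\<close>

definition hyp2F1 :: "complex \<Rightarrow> complex \<Rightarrow> complex \<Rightarrow> complex \<Rightarrow> complex" where
  "hyp2F1 a b c z = eval_fps (fps_hypergeo [a, b] [c] 1) z"

definition mp_poly :: "real \<Rightarrow> nat \<Rightarrow> complex \<Rightarrow> complex" where
  "mp_poly \<nu> n s = of_real (pochhammer \<nu> n / fact n) *
     hyp2F1 (- of_nat n) (s + of_real (\<nu> / 2)) (of_real \<nu>) 2"

definition mp_measure :: "real \<Rightarrow> real measure" where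
  "mp_measure \<nu> = density lborel (\<lambda>t. ennreal
     (1 / (2 * pi) * (2 powr \<nu> / Gamma \<nu>) * (norm (Gamma (\<i> * of_real t + of_real (\<nu> / 2))))\<^sup>2))"

definition mp_coeff :: "real \<Rightarrow> (complex \<Rightarrow> complex) \<Rightarrow> nat \<Rightarrow> complex" where
  "mp_coeff \<nu> f n = of_real (fact n / pochhammer \<nu> n) *
     (LINT t|mp_measure \<nu>. f (\<i> * of_real t) * cnj (mp_poly \<nu> n (\<i> * of_real t)))"

definition mp_partial_sum :: "real \<Rightarrow> (complex \<Rightarrow> complex) \<Rightarrow> nat \<Rightarrow> complex \<Rightarrow> complex" where
  "mp_partial_sum \<nu> f n t = (\<Sum>k\<le>n. mp_coeff \<nu> f k * mp_poly \<nu> k (\<i> * t))"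

definition mp_zeros :: "real \<Rightarrow> (complex \<Rightarrow> complex) \<Rightarrow> nat \<Rightarrow> complex set" where
  "mp_zeros \<nu> f n = {\<rho>. mp_partial_sum \<nu> f n \<rho> = 0}"

lemma mp_poly_altdef:
  "mp_poly \<nu> n s = of_real (pochhammer \<nu> n / fact n) *
     (\<Sum>k\<le>n. pochhammer (- of_nat n) k * pochhammer (s + of_real (\<nu> / 2)) k /
        (pochhammer (of_real \<nu>) k * fact k) * 2 ^ k)"
proof -
  have "eval_fps (fps_hypergeo [- of_nat n, s + of_real (\<nu> / 2)] [of_real \<nu>] 1) (2 :: complex) =
    (\<Sum>k\<le>n. fps_hypergeo [- of_nat n, s + of_real (\<nu> / 2)] [of_real \<nu>] 1 $ k * 2 ^ k)"
    unfolding eval_fps_def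
    by (rule suminf_finite) (auto simp: pochhammer_of_nat_eq_0_lemma)
  then show ?thesis
    unfolding mp_poly_def hyp2F1_def by simp
qed

end

theory Submission
  imports Defs
begin

text \<open>
  Only the strip \<open>\<bar>Re s\<bar> < min \<bar>Re s\<^sub>+\<bar> \<bar>Re s\<^sub>-\<bar>\<close> matters: there \<open>f\<close> is holomorphic and
  \<open>O(exp(r \<bar>s\<bar>))\<close> with \<open>r < \<pi>/2\<close>, and the poles only guarantee that \<open>f\<close> is not identically zero.
  The heart of the matter is that the Meixner-Pollaczek expansion of such an \<open>f\<close> converges to \<open>f\<close>
  locally uniformly on the strip; the claim about zeros is then Hurwitz's theorem.

  A partition of unity reduces to functions with \<open>f(s) = exp(\<i> \<theta> s) h(s)\<close>, where
  \<open>\<bar>\<theta>\<bar> < \<pi>/2\<close> and \<open>h\<close> decays exponentially in the strip. By Cauchy's formula \<open>h\<close> is a two-sided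
  Laplace transform, so \<open>f\<close> is a superposition of exponentials \<open>exp(- \<tau> s)\<close> with \<open>Im \<tau> = - \<theta>\<close>.
  The generating function of the polynomials, taken at \<open>z = tanh(\<tau>/2)\<close> (a point of the unit disc),
  expands each of these exponentials:
  \<open>exp(- \<tau> s) = cosh(\<tau>/2)\<^sup>-\<^sup>\<nu> \<Sum> q\<^sub>n(s) tanh(\<tau>/2)\<^sup>n\<close>. Together with the bound
  \<open>q\<^sub>n(s) = O((a)\<^sub>n / n!)\<close> for \<open>a = \<nu>/2 + \<bar>Re s\<bar>\<close> this gives absolute convergence. The coefficients
  are the MP-coefficients because the Laplace transform of the weight is \<open>cos(s/2)\<^sup>-\<^sup>\<nu>\<close>.
\<close>

subsection \<open>Two-sided Laplace inversion in a strip\<close>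

text \<open>Mean-square convergence would control f on the imaginary axis only, so everything rests
  on absolutely convergent sums and integrals. The balance behind them: for a = \<nu>/2 + c0 the sum
  of (a)_n/n! |tanh(\<tau>/2)|^n is at most of order |cosh(\<tau>/2)|^(2a), and the factor
  cosh(\<tau>/2)^(-\<nu>) leaves |cosh(\<tau>/2)|^(2 c0), which is O(exp(c0 |Re \<tau>|)). The
  Laplace density of a function with exponential decay on |Re s| < c is O(exp(-x |t|)) for every x
  with 0 \<le> x < c, and this wins as soon as c0 < c. The obstacle is growth in both vertical
  directions. A factor exp(\<i> \<theta> s) trades growth at one end for decay at the other, and
  |\<theta>| < \<pi>/2 is what keeps tanh(\<tau>/2) in the unit disc, since 1 - |tanh(\<tau>/2)|^2
  has the sign of cos(Im \<tau>). One angle therefore serves only a function whose two growth rates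
  have negative sum, and f has to be cut into such pieces.\<close>

lemmas lebesgue_integral_cong = Bochner_Integration.integral_cong[OF refl]

lemma integrable_exp_minus_abs:
  assumes "\<epsilon> > 0" shows "integrable lborel (\<lambda>x::real. exp (- \<epsilon> * \<bar>x\<bar>))"
proof -
  have 1: "set_integrable lborel {0..} (\<lambda>x::real. exp (- \<epsilon> * x))"
  proof -
    have "(\<lambda>x::real. exp (- \<epsilon> * x)) absolutely_integrable_on {0..}"
      using integrable_on_exp_minus_to_infinity[OF assms, of 0]
      by (intro nonnegative_absolutely_integrable_1) auto
    thus ?thesis
      unfolding set_integrable_def by (subst (asm) integrable_completion) auto
  qed
  have i1: "integrable lborel (\<lambda>x::real. indicator {0..} x *\<^sub>R exp (- \<epsilon> * x))"
    using 1 unfolding set_integrable_def .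
  have i2: "integrable lborel (\<lambda>x::real. indicator {0..} (0 + (-1) * x) *\<^sub>R exp (- \<epsilon> * (0 + (-1) * x)))"
    using lborel_integrable_real_affine[OF i1, of "-1" 0] by simp
  show ?thesis
    by (rule Bochner_Integration.integrable_bound[OF Bochner_Integration.integrable_add[OF i1 i2]])
       (auto simp: indicator_def)
qed

text \<open>Turns the Cauchy kernel 1/(u - s) into an integral of exponentials over a half line, and
  thereby Cauchy's formula into Laplace inversion.\<close>

lemma integral_exp_half_line:
  fixes w :: complex assumes "Re w > 0"
  shows "set_integrable lborel {..0::real} (\<lambda>t. exp (of_real t * w))"
    and "(LINT t:{..0}|lborel. exp (of_real t * w)) = 1 / w"
proof -
  have 1: "integrable lborel (\<lambda>x::real. exp (- Re w * \<bar>x\<bar>))" by (rule integrable_exp_minus_abs) fact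
  show int: "set_integrable lborel {..0::real} (\<lambda>t. exp (of_real t * w))"
    unfolding set_integrable_def
    by (rule Bochner_Integration.integrable_bound[OF 1]) (auto simp: indicator_def norm_exp)
  have lim: "((\<lambda>y. LINT t:{y..0}|lborel. exp (of_real t * w)) \<longlongrightarrow>
    (LINT t:{..0}|lborel. exp (of_real t * w))) at_bot"
    by (rule tendsto_set_lebesgue_integral_at_bot) (auto intro: set_integrable_subset[OF int])
  have eq: "(LINT t:{y..0}|lborel. exp (of_real t * w)) = 1 / w - exp (of_real y * w) / w"
    if "y \<le> 0" for y :: real
  proof -
    have "((\<lambda>t. exp (of_real t * w)) has_integral (exp (of_real 0 * w) / w - exp (of_real y * w) / w)) {y..0}"
    proof (rule fundamental_theorem_of_calculus[OF that])
      fix x :: real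
      have "((\<lambda>z. exp (z * w) / w) has_field_derivative exp (of_real x * w)) (at (of_real x))"
        using assms by (auto intro!: derivative_eq_intros)
      thus "((\<lambda>t. exp (of_real t * w) / w) has_vector_derivative exp (of_real x * w)) (at x within {y..0})"
        by (rule has_vector_derivative_real_field)
    qed
    moreover have "(LINT t:{y..0}|lborel. exp (of_real t * w)) = integral {y..0} (\<lambda>t. exp (of_real t * w))"
      by (rule set_borel_integral_eq_integral(2)) (rule set_integrable_subset[OF int], auto)
    ultimately show ?thesis by (simp add: integral_unique)
  qed
  have "((\<lambda>y. exp (of_real y * w)) \<longlongrightarrow> 0) (at_bot :: real filter)"
  proof (rule Lim_null_comparison)
    show "\<forall>\<^sub>F y in at_bot. norm (exp (of_real y * w)) \<le> exp (y * Re w)"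
      by (simp add: norm_exp)
    have "filterlim (\<lambda>y. Re w * y) at_bot at_bot"
      by (rule filterlim_tendsto_pos_mult_at_bot[OF tendsto_const assms filterlim_ident])
    hence "filterlim (\<lambda>y. y * Re w) at_bot at_bot" by (simp only: mult.commute)
    thus "((\<lambda>y. exp (y * Re w)) \<longlongrightarrow> 0) at_bot"
      using exp_at_bot filterlim_compose by blast
  qed
  hence "((\<lambda>y. 1 / w - exp (of_real y * w) / w) \<longlongrightarrow> 1 / w - 0 / w) (at_bot :: real filter)"
    using assms by (intro tendsto_intros) auto
  moreover have "\<forall>\<^sub>F y in (at_bot :: real filter). (LINT t:{y..0}|lborel. exp (of_real t * w)) =
    1 / w - exp (of_real y * w) / w"
    using eventually_le_at_bot[of 0] by eventually_elim (rule eq)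
  ultimately have "((\<lambda>y. LINT t:{y..0}|lborel. exp (of_real t * w)) \<longlongrightarrow> 1 / w) at_bot"
    by (subst tendsto_cong) auto
  from tendsto_unique[OF _ lim this] show "(LINT t:{..0}|lborel. exp (of_real t * w)) = 1 / w"
    by simp
qed

text \<open>The horizontal sides contribute a multiple of exp(-\<epsilon> Y) and \<open>V\<close> is
  the same for all large heights, so only the two vertical lines survive. It serves with
  \<open>V\<close> = 0 to move a line of integration and with \<open>V\<close> = 2\<pi>\<i> h(s) for
  Cauchy's formula.\<close>

lemma rectpath_limit:
  fixes G :: "complex \<Rightarrow> complex"
  assumes ab: "a < b" and eps: "\<epsilon> > 0"
    and V: "\<And>Y. Y \<ge> Y0 \<Longrightarrow> (G has_contour_integral V) (rectpath (Complex a (-Y)) (Complex b Y))"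
    and bound: "\<And>z. a \<le> Re z \<Longrightarrow> Re z \<le> b \<Longrightarrow> \<bar>Im z\<bar> \<ge> Y0 \<Longrightarrow> norm (G z) \<le> K * exp (- \<epsilon> * \<bar>Im z\<bar>)"
    and int: "integrable lborel (\<lambda>y. G (Complex a y))" "integrable lborel (\<lambda>y. G (Complex b y))"
  shows "V = \<i> * ((LBINT y. G (Complex b y)) - (LBINT y. G (Complex a y)))"
proof -
  define I where "I c Y = (LINT y:{-Y..Y}|lborel. G (Complex c y))" for c Y
  have lim: "((\<lambda>n. I c (real n)) \<longlongrightarrow> (LBINT y. G (Complex c y))) sequentially"
    if "integrable lborel (\<lambda>y. G (Complex c y))" for c
    unfolding I_def set_lebesgue_integral_def
  proof (rule integral_dominated_convergence[where w = "\<lambda>y. norm (G (Complex c y))"])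
    show "AE x in lborel. (\<lambda>i. indicator {- real i..real i} x *\<^sub>R G (Complex c x)) \<longlonglongrightarrow> G (Complex c x)"
    proof (rule AE_I2)
      fix x :: real
      obtain N :: nat where N: "\<bar>x\<bar> \<le> real N" using real_arch_simple by blast
      have "\<forall>\<^sub>F n in sequentially. G (Complex c x) = indicator {- real n..real n} x *\<^sub>R G (Complex c x)"
        using eventually_ge_at_top[of N] by eventually_elim (use N in \<open>auto simp: indicator_def\<close>)
      thus "(\<lambda>i. indicator {- real i..real i} x *\<^sub>R G (Complex c x)) \<longlonglongrightarrow> G (Complex c x)"
        by (rule Lim_transform_eventually[OF tendsto_const])
    qed
  qed (use that in \<open>auto simp: indicator_def\<close>)
  have key: "norm (V - \<i> * (I b Y - I a Y)) \<le> 2 * (K * exp (- \<epsilon> * Y) * (b - a))" if "Y \<ge> Y0" "Y > 0" for Y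
  proof -
    define a1 a2 a3 a4 where "a1 = Complex a (-Y)" and "a2 = Complex b (-Y)" and "a3 =
      Complex b Y" and "a4 = Complex a Y"
    have rp: "rectpath a1 a3 = linepath a1 a2 +++ linepath a2 a3 +++ linepath a3 a4 +++ linepath a4 a1"
      by (simp add: rectpath_def Let_def a1_def a2_def a3_def a4_def)
    have ci: "G contour_integrable_on (rectpath a1 a3)" and ciV: "contour_integral (rectpath a1 a3) G = V"
      using V[OF that(1)] unfolding a1_def a3_def
        by (auto simp: contour_integrable_on_def intro: contour_integral_unique)
    have 1: "G contour_integrable_on (linepath a1 a2)" "G contour_integrable_on (linepath a2 a3)"
      "G contour_integrable_on (linepath a3 a4)" "G contour_integrable_on (linepath a4 a1)"
      using ci unfolding rp by auto
    have sum: "V = contour_integral (linepath a1 a2) G + (contour_integral (linepath a2 a3) G +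
       (contour_integral (linepath a3 a4) G + contour_integral (linepath a4 a1) G))"
      unfolding ciV[symmetric] rp using 1 by simp
    have si: "I c Y = integral {-Y..Y} (\<lambda>y. G (Complex c y))"
      if "integrable lborel (\<lambda>y. G (Complex c y))" for c
      unfolding I_def by (rule set_borel_integral_eq_integral(2))
        (use that in \<open>auto simp: set_integrable_def intro: integrable_mult_indicator\<close>)
    have r: "contour_integral (linepath a2 a3) G = \<i> * I b Y"
      unfolding si[OF int(2)] by (rule contour_integral_linepath_same_Re) (use that in \<open>auto simp: a2_def
        a3_def\<close>)
    have "contour_integral (linepath a1 a4) G = \<i> * I a Y"
      unfolding si[OF int(1)] by (rule contour_integral_linepath_same_Re) (use that in \<open>auto simp: a1_def
        a4_def\<close>)
    moreover have "contour_integral (linepath a4 a1) G = - contour_integral (linepath a1 a4) G"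
      using contour_integral_reversepath[of "linepath a1 a4" G] by simp
    ultimately have l: "contour_integral (linepath a4 a1) G = - (\<i> * I a Y)" by simp
    \<comment> \<open>The sign of \<open>K\<close> is not among the hypotheses; it follows from the
      bound at one corner.\<close>
    have K: "0 \<le> K * exp (- \<epsilon> * Y)"
    proof -
      have "norm (G a4) \<le> K * exp (- \<epsilon> * \<bar>Im a4\<bar>)"
        by (rule bound) (use ab that in \<open>auto simp: a4_def\<close>)
      from order_trans[OF norm_ge_zero this] show ?thesis using that by (simp add: a4_def)
    qed
    have "norm (contour_integral (linepath a1 a2) G) \<le> K * exp (- \<epsilon> * Y) * norm (a2 - a1)"
    proof (rule contour_integral_bound_linepath[OF 1(1) K])
      fix z assume "z \<in> closed_segment a1 a2"
      hence "Im z = -Y" "a \<le> Re z" "Re z \<le> b" using ab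
        by (auto simp: a1_def a2_def closed_segment_same_Im closed_segment_eq_real_ivl)
      thus "norm (G z) \<le> K * exp (- \<epsilon> * Y)" using bound[of z] that by simp
    qed
    moreover have "norm (contour_integral (linepath a3 a4) G) \<le> K * exp (- \<epsilon> * Y) * norm (a4 - a3)"
    proof (rule contour_integral_bound_linepath[OF 1(3) K])
      fix z assume "z \<in> closed_segment a3 a4"
      hence "Im z = Y" "a \<le> Re z" "Re z \<le> b" using ab
        by (auto simp: a3_def a4_def closed_segment_same_Im closed_segment_eq_real_ivl)
      thus "norm (G z) \<le> K * exp (- \<epsilon> * Y)" using bound[of z] that by simp
    qed
    moreover have "a2 - a1 = of_real (b - a)" "a4 - a3 = of_real (a - b)"
      by (auto simp: a1_def a2_def a3_def a4_def complex_eq_iff)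
    hence "norm (a2 - a1) = b - a" "norm (a4 - a3) = b - a" using ab by (simp_all del: of_real_diff)
    moreover have "V - \<i> * (I b Y - I a Y) = contour_integral (linepath a1 a2) G +
      contour_integral (linepath a3 a4) G"
      unfolding sum r l by (simp add: algebra_simps)
    ultimately show ?thesis
      using norm_triangle_ineq[of "contour_integral (linepath a1 a2) G"
        "contour_integral (linepath a3 a4) G"] by simp
  qed
  have "(\<lambda>n. 2 * (K * exp (- \<epsilon> * real n) * (b - a))) \<longlonglongrightarrow> 2 * (K * 0 * (b - a))"
  proof (intro tendsto_intros)
    have "filterlim (\<lambda>n. \<epsilon> * real n) at_top sequentially"
      by (rule filterlim_tendsto_pos_mult_at_top[OF tendsto_const eps filterlim_real_sequentially])
    thus "(\<lambda>n. exp (- \<epsilon> * real n)) \<longlonglongrightarrow> 0"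
      by (intro filterlim_compose[OF exp_at_bot]) (simp add: filterlim_uminus_at_bot)
  qed
  hence lim0: "(\<lambda>n. 2 * (K * exp (- \<epsilon> * real n) * (b - a))) \<longlonglongrightarrow> 0" by simp
  have "(\<lambda>n. V - \<i> * (I b (real n) - I a (real n))) \<longlonglongrightarrow> 0"
  proof (rule Lim_null_comparison[OF _ lim0])
    obtain N :: nat where N: "max Y0 1 \<le> real N" using real_arch_simple by blast
    show "\<forall>\<^sub>F n in sequentially. norm (V - \<i> * (I b (real n) - I a (real n))) \<le>
      2 * (K * exp (- \<epsilon> * real n) * (b - a))"
      using eventually_ge_at_top[of N]
    proof eventually_elim
      case (elim n)
      hence "real N \<le> real n" by simp
      with N show ?case by (intro key) auto
    qed
  qed
  moreover have "(\<lambda>n. V - \<i> * (I b (real n) - I a (real n))) \<longlonglongrightarrow> V - \<i> *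
    ((LBINT y. G (Complex b y)) - (LBINT y. G (Complex a y)))"
    by (intro tendsto_intros lim int)
  ultimately show ?thesis using LIMSEQ_unique by fastforce
qed

text \<open>A majorant with separated variables reduces the hypothesis of Fubini's theorem to two
  integrals over the line. Serves \<open>half_inversion\<close> and
  \<open>mp_expansion_base\<close>.\<close>

lemma integrable_lborel_pair_bound:
  fixes f :: "real \<Rightarrow> real \<Rightarrow> complex" and g k :: "real \<Rightarrow> real"
  assumes meas: "(\<lambda>(x, y). f x y) \<in> borel_measurable (lborel \<Otimes>\<^sub>M lborel)"
    and g: "integrable lborel g" and k: "integrable lborel k"
    and bound: "\<And>x y. norm (f x y) \<le> g x * k y"
  shows "integrable (lborel \<Otimes>\<^sub>M lborel) (\<lambda>(x, y). f x y)"
proof (rule Bochner_Integration.integrable_bound[OF _ meas])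
  show "integrable (lborel \<Otimes>\<^sub>M lborel) (\<lambda>(x, y). g x * k y)"
  proof (rule lborel_pair.Fubini_integrable)
    show "(\<lambda>(x, y). g x * k y) \<in> borel_measurable (lborel \<Otimes>\<^sub>M lborel)"
      using borel_measurable_integrable[OF g] borel_measurable_integrable[OF k] by measurable
    show "integrable lborel (\<lambda>x. LBINT y. norm (case (x, y) of (x, y) \<Rightarrow> g x * k y))"
      using g k by (simp add: abs_mult)
    show "AE x in lborel. integrable lborel (\<lambda>y. case (x, y) of (x, y) \<Rightarrow> g x * k y)"
      using k by simp
  qed
  show "AE x in lborel \<Otimes>\<^sub>M lborel. norm (case x of (x, y) \<Rightarrow> f x y) \<le> norm (case x of (x, y) \<Rightarrow> g x * k y)"
  proof (rule AE_I2)
    fix z :: "real \<times> real"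
    obtain x y where z: "z = (x, y)" by (cases z)
    show "norm (case z of (x, y) \<Rightarrow> f x y) \<le> norm (case z of (x, y) \<Rightarrow> g x * k y)"
      unfolding z using order_trans[OF bound[of x y] abs_ge_self] by simp
  qed
qed

text \<open>The inverse two-sided Laplace transform, normalised so that h(s) is the integral of its
  values times exp(-t s). The usual 1/(2\<pi>\<i>) has become 1/(2\<pi>) because ds = \<i> dy on the
  imaginary axis.\<close>

definition strip_transform :: "(complex \<Rightarrow> complex) \<Rightarrow> real \<Rightarrow> complex" where
  "strip_transform h t = (LBINT y. h (Complex 0 y) * exp (of_real t * Complex 0 y)) / (2 * of_real pi)"

text \<open>One pair of constants holds on the whole open strip, so that estimates on different
  vertical lines share the same \<open>decay_const\<close>.\<close>

locale strip_decay =
  fixes h :: "complex \<Rightarrow> complex" and c \<epsilon> K :: real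
  assumes holo: "h holomorphic_on {s. \<bar>Re s\<bar> < c}"
    and eps: "\<epsilon> > 0"
    and bound: "\<And>s. \<bar>Re s\<bar> < c \<Longrightarrow> norm (h s) \<le> K * exp (- \<epsilon> * \<bar>Im s\<bar>)"
begin

lemma continuous_line:
  assumes "\<bar>x\<bar> < c" shows "continuous_on UNIV (\<lambda>y. h (Complex x y))"
proof -
  have "continuous_on {s. \<bar>Re s\<bar> < c} h" using holo by (rule holomorphic_on_imp_continuous_on)
  moreover have "continuous_on UNIV (Complex x)"
    unfolding Complex_eq by (intro continuous_intros)
  ultimately have "continuous_on UNIV (h \<circ> Complex x)"
    using assms by (intro continuous_on_compose) (auto elim: continuous_on_subset)
  thus ?thesis by (simp add: o_def)
qed

lemma measurable_line:
  assumes "\<bar>x\<bar> < c" shows "(\<lambda>y. h (Complex x y)) \<in> borel_measurable borel"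
  using continuous_line[OF assms] by (rule borel_measurable_continuous_onI)

lemma integrable_line:
  assumes x: "\<bar>x\<bar> < c" and g: "g \<in> borel_measurable borel" and gb: "\<And>y. norm (g y) \<le> B"
  shows "integrable lborel (\<lambda>y. h (Complex x y) * g y)"
proof (rule Bochner_Integration.integrable_bound)
  show "integrable lborel (\<lambda>y. (K * B) * exp (- \<epsilon> * \<bar>y\<bar>))"
    using integrable_exp_minus_abs[OF eps] by simp
  show "(\<lambda>y. h (Complex x y) * g y) \<in> borel_measurable lborel"
    using measurable_line[OF x] g by simp
  show "AE y in lborel. norm (h (Complex x y) * g y) \<le> norm ((K * B) * exp (- \<epsilon> * \<bar>y\<bar>))"
  proof (rule AE_I2)
    fix y
    have "norm (h (Complex x y) * g y) \<le> (K * exp (- \<epsilon> * \<bar>y\<bar>)) * B"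
      unfolding norm_mult using bound[of "Complex x y"] x gb[of y]
      by (intro mult_mono) (auto intro: order_trans[OF norm_ge_zero])
    thus "norm (h (Complex x y) * g y) \<le> norm ((K * B) * exp (- \<epsilon> * \<bar>y\<bar>))"
      by (simp add: mult_ac)
  qed
qed

lemma norm_exp_Complex: "norm (exp (of_real t * (Complex x y - s))) = exp (t * (x - Re s))"
  by (simp add: norm_exp)

lemma exp_Complex_measurable: "(\<lambda>y. exp (of_real t * Complex x y)) \<in> borel_measurable borel"
  unfolding Complex_eq by measurable

lemma integrable_line_exp:
  assumes x: "\<bar>x\<bar> < c"
  shows "integrable lborel (\<lambda>y. h (Complex x y) * exp (of_real t * Complex x y))"
  using norm_exp_Complex[of t x _ 0] by (intro integrable_line[OF x exp_Complex_measurable, where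
    B = "exp (t * x)"]) simp

lemma convex_strip: "convex {s. \<bar>Re s\<bar> < c}"
proof -
  have "{s. \<bar>Re s\<bar> < c} = {s. Re s < c} \<inter> {s. Re s > - c}" by auto
  thus ?thesis by (simp add: convex_Int convex_halfspace_Re_lt convex_halfspace_Re_gt)
qed

lemma open_strip: "open {s. \<bar>Re s\<bar> < c}"
  by (intro open_Collect_less continuous_intros)

text \<open>Cauchy's theorem on tall rectangles. On the strip the factor exp(t u) is at most exp(|t|
  c), so the decay of \<open>h\<close> still removes the horizontal sides.\<close>

lemma line_shift_aux:
  assumes ab: "a < b" "\<bar>a\<bar> < c" "\<bar>b\<bar> < c"
  shows "(LBINT y. h (Complex a y) * exp (of_real t * Complex a y)) =
    (LBINT y. h (Complex b y) * exp (of_real t * Complex b y))"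
proof -
  have "0 = \<i> * ((LBINT y. h (Complex b y) * exp (of_real t * Complex b y)) - (LBINT y. h (Complex a y) *
    exp (of_real t * Complex a y)))"
  proof (rule rectpath_limit[OF ab(1) eps, where G = "\<lambda>u. h u * exp (of_real t * u)"])
    fix Y :: real assume "Y \<ge> 0"
    show "((\<lambda>u. h u * exp (of_real t * u)) has_contour_integral 0) (rectpath (Complex a (- Y)) (Complex b Y))"
    proof (rule Cauchy_theorem_convex_simple[OF _ convex_strip])
      show "(\<lambda>u. h u * exp (of_real t * u)) holomorphic_on {s. \<bar>Re s\<bar> < c}"
        by (intro holomorphic_intros holo)
      have "path_image (rectpath (Complex a (- Y)) (Complex b Y)) \<subseteq> cbox (Complex a (-Y)) (Complex b Y)"
        by (rule path_image_rectpath_subset_cbox) (use ab \<open>Y \<ge> 0\<close> in auto)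
      also have "\<dots> \<subseteq> {s. \<bar>Re s\<bar> < c}" using ab by (auto simp: in_cbox_complex_iff)
      finally show "path_image (rectpath (Complex a (- Y)) (Complex b Y)) \<subseteq> {s. \<bar>Re s\<bar> < c}" .
    qed auto
  next
    fix z assume z: "a \<le> Re z" "Re z \<le> b"
    hence zc: "\<bar>Re z\<bar> < c" using ab by auto
    have "t * Re z \<le> \<bar>t\<bar> * c"
      using abs_ge_self[of "t * Re z"] mult_left_mono[of "\<bar>Re z\<bar>" c "\<bar>t\<bar>"] zc by (simp add: abs_mult)
    hence "norm (h z * exp (of_real t * z)) \<le> (K * exp (- \<epsilon> * \<bar>Im z\<bar>)) * exp (\<bar>t\<bar> * c)"
      unfolding norm_mult norm_exp using bound[OF zc]
        by (intro mult_mono) (auto intro: order_trans[OF norm_ge_zero])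
    thus "norm (h z * exp (of_real t * z)) \<le> (K * exp (\<bar>t\<bar> * c)) * exp (- \<epsilon> * \<bar>Im z\<bar>)"
      by (simp add: mult_ac)
  qed (use integrable_line_exp ab in auto)
  thus ?thesis by simp
qed

lemma strip_transform_shift:
  assumes x: "\<bar>x\<bar> < c"
  shows "strip_transform h t = (LBINT y. h (Complex x y) * exp (of_real t * Complex x y)) / (2 * of_real pi)"
proof -
  consider "x = 0" | "x < 0" | "0 < x" by linarith
  thus ?thesis
  proof cases
    case 2
    thus ?thesis unfolding strip_transform_def using line_shift_aux[of x 0 t] x by simp
  next
    case 3
    thus ?thesis unfolding strip_transform_def using line_shift_aux[of 0 x t] x by simp
  qed (simp add: strip_transform_def)
qed

text \<open>This is K/(\<pi> \<epsilon>); what matters is that it does not depend on the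
  line.\<close>

definition "decay_const = K / (2 * pi) * (LBINT y. exp (- \<epsilon> * \<bar>y\<bar>))"

lemma norm_strip_transform:
  assumes x: "\<bar>x\<bar> < c"
  shows "norm (strip_transform h t) \<le> decay_const * exp (t * x)"
proof -
  have "norm (LBINT y. h (Complex x y) * exp (of_real t * Complex x y)) \<le>
    (LBINT y. (K * exp (t * x)) * exp (- \<epsilon> * \<bar>y\<bar>))"
  proof (rule Bochner_Integration.integral_norm_bound_integral[OF integrable_line_exp[OF x]])
    show "integrable lborel (\<lambda>y. (K * exp (t * x)) * exp (- \<epsilon> * \<bar>y\<bar>))"
      using integrable_exp_minus_abs[OF eps] by simp
    fix y
    show "norm (h (Complex x y) * exp (of_real t * Complex x y)) \<le> (K * exp (t * x)) * exp (- \<epsilon> * \<bar>y\<bar>)"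
      using bound[of "Complex x y"] x by (simp add: norm_mult norm_exp mult_ac)
  qed
  thus ?thesis unfolding strip_transform_shift[OF x] decay_const_def
    by (simp add: norm_divide norm_mult divide_simps mult_ac)
qed

text \<open>Integrate over Re s = -x if t \<ge> 0 and over Re s = x if t < 0; then exp(t Re s) is
  small in both cases. Width of the strip becomes decay of the transform.\<close>

lemma norm_strip_transform':
  assumes x: "0 \<le> x" "x < c"
  shows "norm (strip_transform h t) \<le> decay_const * exp (- x * \<bar>t\<bar>)"
proof (cases "t \<ge> 0")
  case True
  thus ?thesis using norm_strip_transform[of "- x" t] x by (simp add: mult.commute)
next
  case False
  thus ?thesis using norm_strip_transform[of x t] x by (simp add: mult.commute)
qed

lemma measurable_strip_transform:
  assumes "0 < c" shows "strip_transform h \<in> borel_measurable borel"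
proof -
  have [measurable]: "(\<lambda>y. h (Complex 0 y)) \<in> borel_measurable borel" using measurable_line[of 0] assms
    by simp
  show ?thesis unfolding strip_transform_def Complex_eq
    using \<open>(\<lambda>y. h (Complex 0 y)) \<in> _\<close>[unfolded Complex_eq] by measurable
qed

text \<open>For u to the right of s, 1/(u - s) is the integral of exp(t (u - s)) over t \<le> 0.
  After the interchange the inner integral over the line is the transform, whichever line it is
  taken on.\<close>

lemma half_inversion:
  assumes x: "\<bar>x\<bar> < c" and s: "Re s < x"
  shows "(LBINT y. h (Complex x y) / (Complex x y - s)) =
    2 * of_real pi * (LINT t:{..0}|lborel. strip_transform h t * exp (- of_real t * s))"
proof -
  define F where "F y t = indicator {..0::real} t *\<^sub>R (h (Complex x y) * exp (of_real t *
    (Complex x y - s)))" for y t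
  have [measurable]: "(\<lambda>y. h (Complex x y)) \<in> borel_measurable borel" using measurable_line[OF x] .
  have k: "integrable lborel (\<lambda>t. indicator {..0} t *\<^sub>R exp (t * (x - Re s)))"
  proof -
    have "set_integrable lborel {..0::real} (\<lambda>t. exp (of_real t * of_real (x - Re s) :: complex))"
      by (rule integral_exp_half_line(1)) (use s in simp)
    from integrable_norm[OF this[unfolded set_integrable_def]] show ?thesis by (simp add: norm_exp)
  qed
  have int: "integrable (lborel \<Otimes>\<^sub>M lborel) (\<lambda>(y, t). F y t)"
  proof (rule integrable_lborel_pair_bound)
    show "(\<lambda>(y, t). F y t) \<in> borel_measurable (lborel \<Otimes>\<^sub>M lborel)"
      unfolding F_def using measurable_line[OF x] unfolding Complex_eq by measurable
    show "integrable lborel (\<lambda>y. K * exp (- \<epsilon> * \<bar>y\<bar>))" using integrable_exp_minus_abs[OF eps] by simp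
    show "norm (F y t) \<le> (K * exp (- \<epsilon> * \<bar>y\<bar>)) * (indicator {..0} t *\<^sub>R exp (t * (x - Re s)))" for y t
      using bound[of "Complex x y"] x unfolding F_def
      by (auto simp: indicator_def norm_mult norm_exp_Complex)
  qed (rule k)
  have "(LBINT y. h (Complex x y) / (Complex x y - s)) = (LBINT y. LBINT t. F y t)"
  proof (rule lebesgue_integral_cong)
    fix y
    have "(LBINT t. F y t) = h (Complex x y) * (LINT t:{..0}|lborel. exp (of_real t * (Complex x y - s)))"
      unfolding F_def set_lebesgue_integral_def
      by (subst integral_mult_right_zero[symmetric]) (simp add: scaleR_conv_of_real mult_ac)
    also have "\<dots> = h (Complex x y) / (Complex x y - s)"
      using s by (subst integral_exp_half_line(2)) auto
    finally show "h (Complex x y) / (Complex x y - s) = (LBINT t. F y t)" ..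
  qed
  also have "\<dots> = (LBINT t. LBINT y. F y t)"
    by (rule lborel_pair.Fubini_integral[OF int, symmetric])
  also have "\<dots> = (LBINT t. indicator {..0} t *\<^sub>R (2 * of_real pi * (strip_transform h t *
    exp (- of_real t * s))))"
  proof (rule lebesgue_integral_cong)
    fix t :: real
    have "(LBINT y. F y t) = indicator {..0} t *\<^sub>R ((LBINT y. h (Complex x y) * exp (of_real t *
      Complex x y)) * exp (- of_real t * s))"
    proof -
      have "F y t = (indicator {..0} t *\<^sub>R (h (Complex x y) * exp (of_real t * Complex x y))) *
        exp (- of_real t * s)" for y
        unfolding F_def right_diff_distrib exp_diff by (simp add: exp_minus divide_inverse)
      hence "(LBINT y. F y t) = (LBINT y. indicator {..0} t *\<^sub>R (h (Complex x y) * exp (of_real t *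
        Complex x y))) * exp (- of_real t * s)"
        by (simp only: integral_mult_left_zero)
      also have "(LBINT y. indicator {..0} t *\<^sub>R (h (Complex x y) * exp (of_real t * Complex x y))) =
        indicator {..0} t *\<^sub>R (LBINT y. h (Complex x y) * exp (of_real t * Complex x y))"
        by (rule integral_scaleR_right)
      finally show ?thesis by simp
    qed
    thus "(LBINT y. F y t) = indicator {..0} t *\<^sub>R (2 * of_real pi * (strip_transform h t *
      exp (- of_real t * s)))"
      unfolding strip_transform_shift[OF x] by simp
  qed
  also have "\<dots> = 2 * of_real pi * (LINT t:{..0}|lborel. strip_transform h t * exp (- of_real t * s))"
    unfolding set_lebesgue_integral_def
    by (subst integral_mult_right_zero[symmetric]) (simp add: scaleR_conv_of_real mult_ac)
  finally show ?thesis .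
qed

lemma integrable_strip_transform:
  assumes s: "\<bar>Re s\<bar> < c"
  shows "integrable lborel (\<lambda>t. strip_transform h t * exp (- of_real t * s))"
proof -
  obtain x where x: "\<bar>Re s\<bar> < x" "x < c" using dense[OF s] by blast
  show ?thesis
  proof (rule Bochner_Integration.integrable_bound)
    show "integrable lborel (\<lambda>t. decay_const * exp (- (x - \<bar>Re s\<bar>) * \<bar>t\<bar>))"
      using integrable_exp_minus_abs[of "x - \<bar>Re s\<bar>"] x by simp
    show "(\<lambda>t. strip_transform h t * exp (- of_real t * s)) \<in> borel_measurable lborel"
      using measurable_strip_transform s by (intro borel_measurable_times) auto
    show "AE t in lborel. norm (strip_transform h t * exp (- of_real t * s)) \<le>
      norm (decay_const * exp (- (x - \<bar>Re s\<bar>) * \<bar>t\<bar>))"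
    proof (rule AE_I2)
      fix t :: real
      have nt: "norm (strip_transform h t) \<le> decay_const * exp (- x * \<bar>t\<bar>)"
        by (rule norm_strip_transform') (use x in linarith)+
      have "- t * Re s \<le> \<bar>t\<bar> * \<bar>Re s\<bar>" using abs_ge_self[of "- t * Re s"] by (simp add: abs_mult)
      hence "norm (strip_transform h t * exp (- of_real t * s)) \<le>
        (decay_const * exp (- x * \<bar>t\<bar>)) * exp (\<bar>t\<bar> * \<bar>Re s\<bar>)"
        unfolding norm_mult norm_exp using nt order_trans[OF norm_ge_zero nt]
        by (intro mult_mono) auto
      also have "\<dots> = decay_const * exp (- (x - \<bar>Re s\<bar>) * \<bar>t\<bar>)"
        by (simp add: algebra_simps flip: exp_add)
      finally show "norm (strip_transform h t * exp (- of_real t * s)) \<le>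
        norm (decay_const * exp (- (x - \<bar>Re s\<bar>) * \<bar>t\<bar>))"
        by (simp)
    qed
  qed
qed

end

text \<open>\<open>half_inversion\<close> needs the line to the right of s; the line to the left is
  brought there by s \<mapsto> -s.\<close>

lemma strip_decay_reflect:
  assumes "strip_decay h c \<epsilon> K" shows "strip_decay (\<lambda>s. h (- s)) c \<epsilon> K"
proof -
  interpret strip_decay h c \<epsilon> K by fact
  show ?thesis
  proof
    have "h \<circ> uminus holomorphic_on {s. \<bar>Re s\<bar> < c}"
      by (rule holomorphic_on_compose_gen[OF _ holo]) (auto intro: holomorphic_intros)
    thus "(\<lambda>s. h (- s)) holomorphic_on {s. \<bar>Re s\<bar> < c}" by (simp add: o_def)
    fix s assume "\<bar>Re s\<bar> < c"
    thus "norm (h (- s)) \<le> K * exp (- \<epsilon> * \<bar>Im s\<bar>)" using bound[of "- s"] by simp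
  qed (rule eps)
qed

lemma strip_transform_reflect: "strip_transform (\<lambda>s. h (- s)) t = strip_transform h (- t)"
proof -
  have "(LBINT y. h (- Complex 0 y) * exp (of_real t * Complex 0 y)) =
    (LBINT y. h (- Complex 0 (0 + (-1) * y)) * exp (of_real t * Complex 0 (0 + (-1) * y)))"
    using lborel_integral_real_affine[of "-1" "\<lambda>y. h (- Complex 0 y) * exp (of_real t * Complex 0 y)" 0]
      by simp
  also have "\<dots> = (LBINT y. h (Complex 0 y) * exp (of_real (- t) * Complex 0 y))"
  proof (rule lebesgue_integral_cong)
    fix y
    have "- Complex 0 (0 + (-1) * y) = Complex 0 y" "of_real t * Complex 0 (0 + (-1) * y) =
      of_real (- t) * Complex 0 y"
      by (simp_all add: complex_eq_iff)
    thus "h (- Complex 0 (0 + (-1) * y)) * exp (of_real t * Complex 0 (0 + (-1) * y)) =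
      h (Complex 0 y) * exp (of_real (- t) * Complex 0 y)" by (simp only:)
  qed
  finally show ?thesis by (simp add: strip_transform_def)
qed

text \<open>Cauchy's formula between the lines Re u = -x and Re u = x: the right line yields the
  integral over t \<le> 0, the left line the one over t \<ge> 0.\<close>

lemma (in strip_decay) strip_inversion:
  assumes s: "\<bar>Re s\<bar> < c"
  shows "(LBINT t. strip_transform h t * exp (- of_real t * s)) = h s"
proof -
  obtain x where x: "\<bar>Re s\<bar> < x" "x < c" using dense[OF s] by blast
  interpret R: strip_decay "\<lambda>s. h (- s)" c \<epsilon> K
    by (rule strip_decay_reflect) unfold_locales
  define S where "S t = strip_transform h t * exp (- of_real t * s)" for t
  have intS: "integrable lborel S" unfolding S_def by (rule integrable_strip_transform[OF s])
  have right: "(LBINT y. h (Complex x y) / (Complex x y - s)) = 2 * of_real pi * (LINT t:{..0}|lborel. S t)"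
    unfolding S_def by (rule half_inversion) (use x in auto)
  have "(LBINT y. h (- Complex x y) / (Complex x y - (- s))) =
    2 * of_real pi * (LINT t:{..0}|lborel. strip_transform h (- t) * exp (- of_real t * (- s)))"
    unfolding strip_transform_reflect[symmetric] by (rule R.half_inversion) (use x in auto)
  also have "(LINT t:{..0}|lborel. strip_transform h (- t) * exp (- of_real t * (- s))) =
    (LINT t:{0..}|lborel. S t)"
    using lborel_integral_real_affine[of "-1" "\<lambda>t. indicator {..0} t *\<^sub>R S (- t)" 0]
    unfolding set_lebesgue_integral_def S_def by (simp add: indicator_def)
  also have "(LBINT y. h (- Complex x y) / (Complex x y - (- s))) =
    - (LBINT y. h (Complex (-x) y) / (Complex (-x) y - s))"
  proof -
    have "(LBINT y. h (- Complex x y) / (Complex x y - (- s))) =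
      (LBINT y. h (- Complex x (0 + (-1) * y)) / (Complex x (0 + (-1) * y) - (- s)))"
      using lborel_integral_real_affine[of "-1" "\<lambda>y. h (- Complex x y) / (Complex x y - (- s))" 0] by simp
    also have "\<dots> = (LBINT y. - (h (Complex (-x) y) / (Complex (-x) y - s)))"
    proof (rule lebesgue_integral_cong)
      fix y
      have 1: "Complex x (0 + (-1) * y) = - Complex (-x) y" by (simp add: complex_eq_iff)
      show "h (- Complex x (0 + (-1) * y)) / (Complex x (0 + (-1) * y) - (- s)) =
        - (h (Complex (-x) y) / (Complex (-x) y - s))"
      proof -
        have 2: "- Complex (-x) y - (- s) = - (Complex (-x) y - s)" by simp
        show ?thesis unfolding 1 minus_minus 2 by (rule minus_divide_right [symmetric])
      qed
    qed
    also have "\<dots> = - (LBINT y. h (Complex (-x) y) / (Complex (-x) y - s))" by simp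
    finally show ?thesis .
  qed
  finally have left: "(LBINT y. h (Complex (-x) y) / (Complex (-x) y - s)) =
    - (2 * of_real pi * (LINT t:{0..}|lborel. S t))"
    by (simp only: minus_equation_iff)
  have "2 * of_real pi * \<i> * h s = \<i> * ((LBINT y. h (Complex x y) / (Complex x y - s)) - (LBINT y. h
    (Complex (-x) y) / (Complex (-x) y - s)))"
  proof (rule rectpath_limit[where G = "\<lambda>u. h u / (u - s)"])
    show "- x < x" using x by auto
    show "\<epsilon> > 0" by (rule eps)
    \<comment> \<open>This height encloses s and gives |u - s| \<ge> 1 on the horizontal sides, so
      that the kernel does not spoil the bound for \<open>h\<close>.\<close>
    fix Y :: real assume Y: "Y \<ge> \<bar>Im s\<bar> + 1"
    have "((\<lambda>u. h u / (u - s)) has_contour_integral 2 * pi * \<i> *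
      winding_number (rectpath (Complex (- x) (- Y)) (Complex x Y)) s * h s)
       (rectpath (Complex (- x) (- Y)) (Complex x Y))"
    proof (rule Cauchy_integral_formula_convex_simple[OF convex_strip holo])
      show "s \<in> interior {s. \<bar>Re s\<bar> < c}" using s by (simp add: interior_open open_strip)
      have "path_image (rectpath (Complex (-x) (- Y)) (Complex x Y)) =
        cbox (Complex (-x) (-Y)) (Complex x Y) - box (Complex (-x) (-Y)) (Complex x Y)"
        by (rule path_image_rectpath_cbox_minus_box) (use x Y in auto)
      also have "\<dots> \<subseteq> {s. \<bar>Re s\<bar> < c} - {s}" using x Y by (auto simp: in_cbox_complex_iff in_box_complex_iff)
      finally show "path_image (rectpath (Complex (-x) (- Y)) (Complex x Y)) \<subseteq> {s. \<bar>Re s\<bar> < c} - {s}" .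
    qed auto
    moreover have "winding_number (rectpath (Complex (- x) (- Y)) (Complex x Y)) s = 1"
      by (rule winding_number_rectpath) (use x Y in \<open>auto simp: in_box_complex_iff\<close>)
    ultimately show "((\<lambda>u. h u / (u - s)) has_contour_integral 2 * of_real pi * \<i> *
      h s) (rectpath (Complex (- x) (- Y)) (Complex x Y))"
      by simp
  next
    fix z assume z: "- x \<le> Re z" "Re z \<le> x" "\<bar>Im s\<bar> + 1 \<le> \<bar>Im z\<bar>"
    have "1 \<le> \<bar>Im (z - s)\<bar>" using z by auto
    also have "\<dots> \<le> norm (z - s)" by (rule abs_Im_le_cmod)
    finally have "norm (h z / (z - s)) \<le> norm (h z) / 1"
      unfolding norm_divide by (intro divide_left_mono) auto
    also have "\<dots> \<le> K * exp (- \<epsilon> * \<bar>Im z\<bar>)" using bound[of z] z x by auto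
    finally show "norm (h z / (z - s)) \<le> K * exp (- \<epsilon> * \<bar>Im z\<bar>)" .
  next
    have *: "integrable lborel (\<lambda>y. h (Complex x' y) / (Complex x' y - s))" if x': "\<bar>x'\<bar> = x" for x'
    proof -
      have "integrable lborel (\<lambda>y. h (Complex x' y) * (1 / (Complex x' y - s)))"
      proof (rule integrable_line)
        show "\<bar>x'\<bar> < c" using x' x by simp
        show "(\<lambda>y. 1 / (Complex x' y - s)) \<in> borel_measurable borel" unfolding Complex_eq by measurable
        fix y
        have "x - \<bar>Re s\<bar> \<le> \<bar>Re (Complex x' y - s)\<bar>" using x' x by auto
        also have "\<dots> \<le> norm (Complex x' y - s)" by (rule abs_Re_le_cmod)
        finally show "norm (1 / (Complex x' y - s)) \<le> 1 / (x - \<bar>Re s\<bar>)"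
          unfolding norm_divide norm_one using x by (intro divide_left_mono) (auto intro!: mult_pos_pos)
      qed
      thus ?thesis by simp
    qed
    show "integrable lborel (\<lambda>y. h (Complex (-x) y) / (Complex (-x) y - s))"
      "integrable lborel (\<lambda>y. h (Complex x y) / (Complex x y - s))"
      using x by (auto intro!: *)
  qed
  hence "2 * of_real pi * \<i> * h s = 2 * of_real pi * \<i> * ((LINT t:{..0}|lborel. S t) +
    (LINT t:{0..}|lborel. S t))"
    unfolding right left by (simp add: algebra_simps)
  hence "h s = (LINT t:{..0}|lborel. S t) + (LINT t:{0..}|lborel. S t)" by simp
  also have "\<dots> = (LBINT t. indicator {..0} t *\<^sub>R S t + indicator {0..} t *\<^sub>R S t)"
    unfolding set_lebesgue_integral_def by (rule Bochner_Integration.integral_add[symmetric]) (auto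
      intro!: integrable_mult_indicator intS)
  \<comment> \<open>The two half lines overlap in the point 0, a null set.\<close>
  also have "\<dots> = (LBINT t. S t)"
  proof (rule integral_cong_AE)
    show "AE t in lborel. indicator {..0} t *\<^sub>R S t + indicator {0..} t *\<^sub>R S t = S t"
      using AE_lborel_singleton[of "0::real"] by eventually_elim (auto simp: indicator_def)
  qed (use borel_measurable_integrable[OF intS] in measurable)
  finally show ?thesis unfolding S_def ..
qed

subsection \<open>Recurrence and generating function of the Meixner-Pollaczek polynomials\<close>

text \<open>(\<nu>)_n/(\<nu>)_k = (\<nu> + k)_(n-k) removes the division by (\<nu>)_k. The form with
  two indices k and m = n - k is the one in which the recurrence can be compared termwise.\<close>

lemma mp_poly_expand:
  fixes \<nu> :: real assumes "\<nu> > 0"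
  defines "T \<equiv> \<lambda>k m. (-2) ^ k / fact k * (pochhammer (of_real \<nu> + of_nat k) m / fact m) :: complex"
  shows "mp_poly \<nu> n s = (\<Sum>k\<le>n. T k (n - k) * pochhammer (s + of_real (\<nu>/2)) k)"
  unfolding mp_poly_altdef sum_distrib_left
proof (rule sum.cong[OF refl])
  fix k assume "k \<in> {..n}"
  hence kn: "k \<le> n" by simp
  have a: "pochhammer (- of_nat n :: complex) k = (-1)^k * fact n / fact (n - k)"
  proof -
    have "of_nat (n choose k) = (-1)^k * pochhammer (- of_nat n :: complex) k / fact k"
      by (simp add: binomial_gbinomial gbinomial_pochhammer)
    moreover have "of_nat (n choose k) = (fact n / (fact k * fact (n - k)) :: complex)"
      using kn by (rule binomial_fact)
    ultimately have "(-1)^k * pochhammer (- of_nat n :: complex) k = fact n / fact (n - k)"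
      by (simp add: field_simps)
    hence "(-1)^k * ((-1)^k * pochhammer (- of_nat n :: complex) k) = (-1)^k * (fact n / fact (n - k))"
      by simp
    thus ?thesis by (simp flip: mult.assoc power_mult_distrib)
  qed
  have b: "of_real (pochhammer \<nu> n) = (pochhammer (of_real \<nu>) k * pochhammer (of_real \<nu> +
    of_nat k) (n - k) :: complex)"
    using pochhammer_product[OF kn, of "of_real \<nu> :: complex"] by (simp add: pochhammer_of_real)
  have c: "pochhammer (of_real \<nu> :: complex) k \<noteq> 0"
    using assms pochhammer_pos[of \<nu> k] by (simp add: pochhammer_of_real)
  have d: "(-2 :: complex)^k = (-1)^k * 2^k" by (simp flip: power_mult_distrib)
  show "of_real (pochhammer \<nu> n / fact n) *
         (pochhammer (- of_nat n) k * pochhammer (s + of_real (\<nu> / 2)) k /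
          (pochhammer (of_real \<nu>) k * fact k) * 2 ^ k) =
         T k (n - k) * pochhammer (s + of_real (\<nu> / 2)) k"
    using c unfolding of_real_divide b a d T_def by (simp add: field_simps)
qed

lemma mp_poly_0: "mp_poly \<nu> 0 s = 1"
  by (simp add: mp_poly_altdef)

lemma mp_poly_1:
  assumes "\<nu> > 0" shows "mp_poly \<nu> (Suc 0) s = -2 * s"
  using assms by (simp add: mp_poly_altdef field_simps)

text \<open>
  Comparing coefficients in the basis of the Pochhammer symbols \<open>(s + \<nu>/2)\<^sub>k\<close>; the identity \<open>gen\<close> in
  the proof is the resulting relation between the coefficients.
\<close>

lemma mp_poly_rec:
  assumes nu: "\<nu> > 0"
  shows "of_nat (n + 2) * mp_poly \<nu> (n + 2) s =
    - 2 * s * mp_poly \<nu> (n + 1) s + (of_nat n + of_real \<nu>) * mp_poly \<nu> n s"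
proof -
  define v b where "v = (of_real \<nu> :: complex)" and "b = s + of_real (\<nu>/2)"
  define T where "T k m = (-2) ^ k / fact k * (pochhammer (v + of_nat k) m / fact m)" for k m
  define P where "P = pochhammer b"
  have q: "mp_poly \<nu> n s = (\<Sum>k\<le>n. T k (n - k) * P k)" for n
    unfolding mp_poly_expand[OF nu] T_def v_def P_def b_def by simp
  have s: "- 2 * s = v - 2 * b" by (simp add: v_def b_def)
  \<comment> \<open>Multiplication by s becomes an index shift in the Pochhammer basis.\<close>
  have P_Suc: "2 * b * P k = 2 * P (Suc k) - 2 * of_nat k * P k" for k
    unfolding P_def by (simp add: pochhammer_Suc algebra_simps)
  have gen: "of_nat (k + m + 2) * T k (m + 2) + (if k = 0 then 0 else 2 * T (k - 1) (m + 2)) -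
      (2 * of_nat k + v) * T k (m + 1) - (of_nat (k + m) + v) * T k m = 0" for k m
  proof -
    define x where "x = v + of_nat k"
    \<comment> \<open>The common factor of all terms: with (m + 2)! in the denominator each of them
      is \<open>A\<close> times a polynomial in x, k and m.\<close>
    define A where "A = (-2) ^ k / fact k * (pochhammer x m / fact (m + 2))"
    have f: "fact (m + 2) = (of_nat m + 2) * (of_nat m + 1) * (fact m :: complex)"
      by (simp add: algebra_simps)
    have m1: "(of_nat m + 1 :: complex) \<noteq> 0" "(of_nat m + 2 :: complex) \<noteq> 0"
      using of_nat_neq_0[of m, where 'a = complex] of_nat_neq_0[of "Suc m", where 'a = complex]
      by (simp_all add: add_ac)
    have 1: "T k m = A * ((of_nat m + 2) * (of_nat m + 1))"
      unfolding A_def T_def x_def[symmetric] f using m1 by simp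
    have 2: "T k (m + 1) = A * ((of_nat m + 2) * (x + of_nat m))"
      unfolding A_def T_def x_def[symmetric] f using m1 by (simp add: pochhammer_Suc add_ac)
    have 3: "T k (m + 2) = A * ((x + of_nat m) * (x + of_nat m + 1))"
      unfolding A_def T_def x_def[symmetric] f using m1 by (simp add: pochhammer_Suc add_ac numeral_2_eq_2)
    have 4: "(if k = 0 then 0 else 2 * T (k - 1) (m + 2)) = - A * (of_nat k * (x - 1) * (x + of_nat m))"
    proof (cases k)
      case (Suc j)
      have p: "pochhammer (x - 1) (m + 2) = (x - 1) * (pochhammer x m * (x + of_nat m))"
        by (simp add: pochhammer_rec numeral_2_eq_2) (simp add: pochhammer_Suc flip: pochhammer_rec)
      have x1: "v + of_nat j = x - 1" unfolding x_def Suc by simp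
      have "2 * T j (m + 2) = 2 * ((-2) ^ j / fact j * (pochhammer (x - 1) (m + 2) / fact (m + 2)))"
        unfolding T_def x1 ..
      also have "\<dots> = - A * (of_nat k * (x - 1) * (x + of_nat m))"
        unfolding p A_def Suc by (simp add: field_simps del: of_nat_Suc)
      finally show ?thesis using Suc by simp
    qed simp
    have v: "v = x - of_nat k" by (simp add: x_def)
    show ?thesis unfolding 1 2 3 4 v by (simp add: algebra_simps)
  qed
  \<comment> \<open>\<open>e1\<close> and \<open>e2\<close> are the relation \<open>gen\<close> at
    the two top indices k = n + 1 and k = n + 2, where m would be -1 and -2 and the terms with
    negative second index are absent.\<close>
  have e1: "of_nat (n + 2) * T (Suc n) 1 + 2 * T n 1 - (2 * of_nat (Suc n) + v) * T (Suc n) 0 = 0"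
    using of_nat_neq_0[of n, where 'a = complex] of_nat_neq_0[of "Suc n", where 'a = complex]
    by (simp add: T_def divide_simps) (simp add: algebra_simps)
  have e2: "of_nat (n + 2) * T (n + 2) 0 + 2 * T (n + 1) 0 = 0"
    using of_nat_neq_0[of n, where 'a = complex] of_nat_neq_0[of "Suc n", where 'a = complex]
    by (simp add: T_def divide_simps)
  have A: "2 * b * mp_poly \<nu> (n + 1) s = (\<Sum>k\<le>n+2. (if k = 0 then 0 else 2 * T (k - 1) (n + 2 - k)) * P k)
      - (\<Sum>k\<le>n+1. 2 * of_nat k * T k (n + 1 - k) * P k)"
  proof -
    have "(\<Sum>k\<le>n+2. (if k = 0 then 0 else 2 * T (k - 1) (n + 2 - k)) * P k) =
        (\<Sum>k\<le>n+1. 2 * T k (n + 1 - k) * P (Suc k))"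
      by (simp add: sum.atMost_Suc_shift del: sum.atMost_Suc)
    moreover have "2 * b * mp_poly \<nu> (n + 1) s = (\<Sum>k\<le>n+1. T k (n + 1 - k) * (2 * b * P k))"
      unfolding q sum_distrib_left by (simp add: algebra_simps)
    ultimately show ?thesis unfolding P_Suc by (simp add: algebra_simps sum_subtractf)
  qed
  have "of_nat (n + 2) * mp_poly \<nu> (n + 2) s + 2 * b * mp_poly \<nu> (n + 1) s - v * mp_poly \<nu> (n + 1) s
       - (of_nat n + v) * mp_poly \<nu> n s =
    (\<Sum>k\<le>n. (of_nat (n + 2) * T k (n + 2 - k) + (if k = 0 then 0 else 2 * T (k - 1) (n + 2 - k)) -
      (2 * of_nat k + v) * T k (n + 1 - k) - (of_nat n + v) * T k (n - k)) * P k) +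
     (of_nat (n + 2) * T (Suc n) 1 + 2 * T n 1 - (2 * of_nat (Suc n) + v) * T (Suc n) 0) * P (n + 1) +
     (of_nat (n + 2) * T (n + 2) 0 + 2 * T (n + 1) 0) * P (n + 2)"
    unfolding A unfolding q by (simp add: sum_distrib_left sum.distrib sum_subtractf algebra_simps)
  also have "(\<Sum>k\<le>n. (of_nat (n + 2) * T k (n + 2 - k) + (if k = 0 then 0 else 2 * T (k - 1) (n + 2 - k)) -
      (2 * of_nat k + v) * T k (n + 1 - k) - (of_nat n + v) * T k (n - k)) * P k) = 0"
  proof (rule sum.neutral, rule ballI)
    fix k assume "k \<in> {..n}"
    then obtain m where m: "n = k + m" using le_Suc_ex by auto
    show "(of_nat (n + 2) * T k (n + 2 - k) + (if k = 0 then 0 else 2 * T (k - 1) (n + 2 - k)) -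
      (2 * of_nat k + v) * T k (n + 1 - k) - (of_nat n + v) * T k (n - k)) * P k = 0"
    proof -
      have "k + m + 2 - k = m + 2" "k + m + 1 - k = m + 1" "k + m - k = m" by simp_all
      thus ?thesis unfolding m using gen[of k m] by (simp only: mult_zero_left)
    qed
  qed
  finally have "of_nat (n + 2) * mp_poly \<nu> (n + 2) s + 2 * b * mp_poly \<nu> (n + 1) s - v * mp_poly \<nu> (n + 1) s
       - (of_nat n + v) * mp_poly \<nu> n s = 0"
    unfolding e1 e2 by simp
  thus ?thesis unfolding s v_def by (simp add: algebra_simps)
qed

text \<open>Serves to recognise the polynomials in another guise: as Taylor coefficients of the
  generating function and as complex conjugates of their own values.\<close>

lemma mp_poly_unique:
  assumes nu: "\<nu> > 0" and "a 0 = 1" "a (Suc 0) = -2 * s"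
    and rec: "\<And>n. of_nat (n + 2) * a (n + 2) = - 2 * s * a (n + 1) + (of_nat n + of_real \<nu>) * a n"
  shows "a n = mp_poly \<nu> n s"
proof (induction n rule: less_induct)
  case (less n)
  consider "n = 0" | "n = Suc 0" | m where "n = m + 2"
    by (metis One_nat_def Suc_1 add.commute add_2_eq_Suc' not0_implies_Suc)
  thus ?case
  proof cases
    case (3 m)
    have "of_nat (m + 2) * a (m + 2) = of_nat (m + 2) * mp_poly \<nu> (m + 2) s"
      unfolding rec mp_poly_rec[OF nu] using less[of m] less[of "m+1"] 3 by simp
    moreover have "of_nat (m + 2) \<noteq> (0::complex)" by (metis add_2_eq_Suc' of_nat_neq_0)
    ultimately show ?thesis unfolding 3 by (metis mult_left_cancel)
  qed (use assms in \<open>simp_all add: mp_poly_0 mp_poly_1\<close>)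
qed

text \<open>Read coefficientwise, (1 - X^2) F' = (\<nu> X - 2 s) F is the three-term
  recurrence.\<close>

lemma mp_poly_fps_unique:
  fixes F :: "complex fps"
  assumes nu: "\<nu> > 0" and F0: "F $ 0 = 1"
    and ode: "fps_deriv F * (1 - fps_X ^ 2) = (fps_const (-2 * s) + fps_const (of_real \<nu>) * fps_X) * F"
  shows "F $ n = mp_poly \<nu> n s"
proof (rule mp_poly_unique[OF nu, of "fps_nth F"])
  have L: "fps_deriv F * (1 - fps_X ^ 2) = fps_deriv F - fps_X * (fps_X * fps_deriv F)"
    by (simp add: algebra_simps power2_eq_square)
  have R: "(fps_const (-2 * s) + fps_const (of_real \<nu>) * fps_X) * F =
    fps_const (-2 * s) * F + fps_const (of_real \<nu>) * (fps_X * F)"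
    by (simp add: algebra_simps)
  have C: "(fps_deriv F - fps_X * (fps_X * fps_deriv F)) $ n =
    (fps_const (-2 * s) * F + fps_const (of_real \<nu>) * (fps_X * F)) $ n" for n
    using ode unfolding L R by simp
  show "F $ Suc 0 = - 2 * s"
    using C[of 0] F0 by simp
  show "of_nat (n + 2) * F $ (n + 2) = - 2 * s * F $ (n + 1) + (of_nat n + of_real \<nu>) * F $ n" for n
  proof -
    have "of_nat (n + 2) * F $ (n + 2) - of_nat n * F $ n = - 2 * s * F $ (n + 1) + of_real \<nu> * F $ n"
      using C[of "n+1"] by (cases n) (simp_all add: ring_distribs)
    thus ?thesis by (simp only: diff_eq_eq) (simp add: algebra_simps)
  qed
qed (rule F0)

section \<open>The formal generating series and its closed form\<close>

definition mp_fps :: "real \<Rightarrow> complex \<Rightarrow> complex fps" where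
  "mp_fps \<nu> s = Abs_fps (\<lambda>n. mp_poly \<nu> n s)"

lemma mp_fps_ode:
  assumes nu: "\<nu> > 0"
  shows "fps_deriv (mp_fps \<nu> s) * (1 - fps_X ^ 2) =
    (fps_const (-2 * s) + fps_const (of_real \<nu>) * fps_X) * mp_fps \<nu> s"
proof (rule fps_ext)
  fix n
  let ?F = "mp_fps \<nu> s"
  have L: "fps_deriv ?F * (1 - fps_X ^ 2) = fps_deriv ?F - fps_X * (fps_X * fps_deriv ?F)"
    by (simp add: algebra_simps power2_eq_square)
  have R: "(fps_const (-2 * s) + fps_const (of_real \<nu>) * fps_X) * ?F =
    fps_const (-2 * s) * ?F + fps_const (of_real \<nu>) * (fps_X * ?F)"
    by (simp add: algebra_simps)
  show "(fps_deriv ?F * (1 - fps_X ^ 2)) $ n =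
    ((fps_const (-2 * s) + fps_const (of_real \<nu>) * fps_X) * ?F) $ n"
  proof (cases n)
    case 0
    thus ?thesis unfolding L R using mp_poly_1[OF nu] by (simp add: mp_fps_def mp_poly_0)
  next
    case (Suc m)
    thus ?thesis unfolding L R using mp_poly_rec[OF nu, of m s]
      by (cases m) (simp_all add: mp_fps_def algebra_simps)
  qed
qed

text \<open>The generating function is (1 - z^2)^(-\<nu>/2) times a factor free of \<nu>, so the
  series for \<nu> is 1 - X^2 times the series for \<nu> + 2. Formally this holds because that
  product solves the differential equation for \<nu>; inserting it and cancelling 1 - X^2 leaves the
  claim.\<close>

lemma mp_fps_deriv:
  assumes nu: "\<nu> > 0"
  shows "fps_deriv (mp_fps \<nu> s) = (fps_const (-2 * s) + fps_const (of_real \<nu>) * fps_X) * mp_fps (\<nu> + 2) s"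
proof -
  define Q where "Q = mp_fps (\<nu> + 2) s"
  define D :: "complex fps" where "D = 1 - fps_X ^ 2"
  have D': "fps_deriv D = - 2 * fps_X" by (simp add: D_def power2_eq_square)
  have "fps_deriv (D * Q) * D = D * (fps_deriv Q * D) - 2 * fps_X * (D * Q)"
    unfolding fps_deriv_mult D' by (simp add: algebra_simps)
  also have "fps_deriv Q * D = (fps_const (-2 * s) + fps_const (of_real (\<nu> + 2)) * fps_X) * Q"
    unfolding Q_def D_def by (rule mp_fps_ode) (use nu in simp)
  also have "fps_const (of_real (\<nu> + 2)) = fps_const (of_real \<nu>) + (2 :: complex fps)"
    by (simp flip: fps_const_add add: numeral_fps_const)
  finally have "fps_deriv (D * Q) * D = (fps_const (-2 * s) + fps_const (of_real \<nu>) * fps_X) * (D * Q)"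
    by (simp add: algebra_simps)
  hence "(D * Q) $ n = mp_fps \<nu> s $ n" for n
    using mp_poly_fps_unique[OF nu, of "D * Q" s n] by (simp add: D_def Q_def mp_fps_def mp_poly_0)
  hence eq: "D * Q = mp_fps \<nu> s" by (rule fps_ext)
  have "fps_deriv (mp_fps \<nu> s) * D = ((fps_const (-2 * s) + fps_const (of_real \<nu>) * fps_X) * Q) * D"
    unfolding D_def mp_fps_ode[OF nu] unfolding eq[symmetric] D_def by (simp only: mult_ac)
  moreover have "D \<noteq> 0"
  proof
    assume "D = 0"
    hence "D $ 0 = 0" by (simp only: fps_zero_nth)
    thus False by (simp add: D_def)
  qed
  ultimately show ?thesis unfolding Q_def by (metis mult_right_cancel)
qed

text \<open>The factor n + 1 on the left is the gain: passing from \<nu> + 2 down to \<nu> lowers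
  the order of growth in n by one.\<close>

lemma mp_poly_contiguous:
  assumes "\<nu> > 0"
  shows "of_nat (Suc n) * mp_poly \<nu> (Suc n) s = - 2 * s * mp_poly (\<nu> + 2) n s + of_real \<nu> * (if n =
    0 then 0 else mp_poly (\<nu> + 2) (n - 1) s)"
proof -
  have "(fps_const (-2 * s) + fps_const (of_real \<nu>) * fps_X) * mp_fps (\<nu> + 2) s =
    fps_const (-2 * s) * mp_fps (\<nu> + 2) s + fps_const (of_real \<nu>) * (fps_X * mp_fps (\<nu> + 2) s)"
    by (simp add: algebra_simps)
  from arg_cong[OF trans[OF mp_fps_deriv[OF assms, of s] this], of "\<lambda>F. F $ n"]
  show ?thesis by (simp add: mp_fps_def algebra_simps)
qed

text \<open>The closed form is holomorphic in the disc, where 1 - z and 1 + z have positive real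
  part, and it solves the differential equation of the formal series with constant term 1. Its
  Taylor series converges in the whole disc.\<close>

lemma mp_poly_generating_function:
  assumes nu: "\<nu> > 0" and z: "norm z < 1"
  shows "(\<lambda>n. mp_poly \<nu> n s * z ^ n) sums ((1 - z) powr (s - of_real (\<nu>/2)) * (1 +
    z) powr (- s - of_real (\<nu>/2)))"
proof -
  define g where "g = (\<lambda>z. (1 - z) powr (s - of_real (\<nu>/2)) * (1 + z) powr (- s - of_real (\<nu>/2)))"
  have ne: "1 - z \<notin> \<real>\<^sub>\<le>\<^sub>0 \<and> 1 + z \<notin> \<real>\<^sub>\<le>\<^sub>0" if "norm z < 1" for z :: complex
  proof -
    have "\<bar>Re z\<bar> < 1" using that abs_Re_le_cmod[of z] by linarith
    thus ?thesis by (auto simp: complex_nonpos_Reals_iff)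
  qed
  have holo: "g holomorphic_on ball 0 1"
    unfolding g_def by (intro holomorphic_intros) (use ne in auto)
  have der: "deriv g z * (1 - z^2) = (-2 * s + of_real \<nu> * z) * g z" if "norm z < 1" for z
  proof -
    have 0: "1 - z \<noteq> 0" "1 + z \<noteq> 0" using ne[OF that] by auto
    have "(g has_field_derivative (
        (s - of_real (\<nu>/2)) * (1 - z) powr (s - of_real (\<nu>/2) - 1) * (-1) * (1 +
          z) powr (- s - of_real (\<nu>/2)) +
        (- s - of_real (\<nu>/2)) * (1 + z) powr (- s - of_real (\<nu>/2) - 1) *
          (1 - z) powr (s - of_real (\<nu>/2)))) (at z)"
      unfolding g_def using ne[OF that]
      by (auto intro!: derivative_eq_intros has_field_derivative_powr_right simp: algebra_simps)
    hence d: "deriv g z = (s - of_real (\<nu>/2)) * (1 - z) powr (s - of_real (\<nu>/2) - 1) * (-1) * (1 +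
      z) powr (- s - of_real (\<nu>/2)) +
        (- s - of_real (\<nu>/2)) * (1 + z) powr (- s - of_real (\<nu>/2) - 1) * (1 - z) powr (s - of_real (\<nu>/2))"
      by (rule DERIV_imp_deriv)
    have p: "(1 - z) powr (s - of_real (\<nu>/2) - 1) = (1 - z) powr (s - of_real (\<nu>/2)) / (1 - z)"
      "(1 + z) powr (- s - of_real (\<nu>/2) - 1) = (1 + z) powr (- s - of_real (\<nu>/2)) / (1 + z)"
      using 0 by (simp_all add: powr_diff)
    have z2: "1 - z^2 = (1 - z) * (1 + z)" by (simp add: algebra_simps power2_eq_square)
    have alg: "((s - h) * (A / p) * (-1) * B + (- s - h) * (B / q) * A) * (p * q) =
      (- (s - h) * q + (- s - h) * p) * (A * B)"
      if "p \<noteq> 0" "q \<noteq> 0" for A B p q h :: complex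
      using that by (simp add: divide_simps) (simp add: algebra_simps)
    have "- (s - of_real (\<nu>/2)) * (1 + z) + (- s - of_real (\<nu>/2)) * (1 - z) = -2 * s + of_real \<nu> * z"
      by (simp add: field_simps)
    thus ?thesis unfolding d p z2 alg[OF 0] unfolding g_def by simp
  qed
  define F where "F = fps_expansion g 0"
  have F: "g has_fps_expansion F"
    unfolding F_def by (rule has_fps_expansion_fps_expansion[OF _ _ holo]) auto
  have "(\<lambda>z. deriv g z * (1 - z^2)) has_fps_expansion (fps_deriv F * (1 - fps_X ^ 2))"
    by (intro fps_expansion_intros F)
  moreover have "(\<lambda>z. (-2 * s + of_real \<nu> * z) * g z) has_fps_expansion (fps_const (-2 * s) +
    fps_const (of_real \<nu>) * fps_X) * F"
    by (intro fps_expansion_intros F)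
  moreover have "eventually (\<lambda>z. deriv g z * (1 - z^2) = (-2 * s + of_real \<nu> * z) * g z) (nhds 0)"
    by (rule eventually_mono[OF eventually_nhds_in_open[of "ball 0 1" "0::complex"]]) (use der in auto)
  ultimately have "(\<lambda>z. (-2 * s + of_real \<nu> * z) * g z) has_fps_expansion (fps_deriv F * (1 - fps_X ^ 2))"
    using has_fps_expansion_cong by fast
  hence "fps_deriv F * (1 - fps_X ^ 2) = (fps_const (-2 * s) + fps_const (of_real \<nu>) * fps_X) * F"
    using \<open>_ has_fps_expansion (_ + _) * F\<close> by (rule fps_expansion_unique_complex)
  moreover have "F $ 0 = 1" unfolding F_def by (simp add: fps_expansion_def g_def)
  ultimately have Fn: "F $ n = mp_poly \<nu> n s" for n using mp_poly_fps_unique[OF nu] by blast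
  have "(\<lambda>n. (deriv ^^ n) g 0 / fact n * (z - 0) ^ n) sums g z"
    by (rule holomorphic_power_series[OF holo]) (use z in auto)
  moreover have "(deriv ^^ n) g 0 / fact n = mp_poly \<nu> n s" for n
    using Fn[of n] by (simp add: F_def fps_expansion_def)
  ultimately have "(\<lambda>n. mp_poly \<nu> n s * z ^ n) sums g z" by (simp only: diff_0_right)
  thus ?thesis by (simp only: g_def)
qed

subsection \<open>Expansion of exponentials\<close>

lemma Re_cosh_half: "Re (cosh (\<tau> / 2)) = cosh (Re \<tau> / 2) * cos (Im \<tau> / 2)"
  and Im_cosh_half: "Im (cosh (\<tau> / 2)) = sinh (Re \<tau> / 2) * sin (Im \<tau> / 2)"
  by (simp_all add: cosh_conv_cos Re_cos Im_cos cosh_field_def sinh_field_def field_simps)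

lemma Re_sinh_half: "Re (sinh (\<tau> / 2)) = sinh (Re \<tau> / 2) * cos (Im \<tau> / 2)"
  and Im_sinh_half: "Im (sinh (\<tau> / 2)) = cosh (Re \<tau> / 2) * sin (Im \<tau> / 2)"
  by (simp_all add: sinh_conv_sin Re_sin Im_sin cosh_field_def sinh_field_def field_simps)

lemma Re_cosh_half_pos:
  assumes "\<bar>Im \<tau>\<bar> < pi" shows "Re (cosh (\<tau> / 2)) > 0"
proof -
  have "cos (Im \<tau> / 2) > 0" using assms by (intro cos_gt_zero_pi) auto
  thus ?thesis using cosh_real_pos[of "Re \<tau> / 2"] unfolding Re_cosh_half by simp
qed

text \<open>For \<tau>/2 = a + \<i> b, |cosh|^2 - |sinh|^2 factors as (cosh^2 a - sinh^2 a)(cos^2 b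
  - sin^2 b) = cos(2b). The identity decides when tanh(\<tau>/2) is in the disc and also how close
  to the circle it gets.\<close>

lemma norm_tanh_half:
  assumes "\<bar>Im \<tau>\<bar> < pi"
  shows "1 - (norm (tanh (\<tau> / 2)))\<^sup>2 = cos (Im \<tau>) / (norm (cosh (\<tau> / 2)))\<^sup>2"
proof -
  define a b where "a = Re \<tau> / 2" and "b = Im \<tau> / 2"
  have X: "(norm (cosh (\<tau> / 2)))\<^sup>2 = (cosh a * cos b)\<^sup>2 + (sinh a * sin b)\<^sup>2"
    unfolding cmod_power2 Re_cosh_half Im_cosh_half a_def b_def ..
  have S: "(norm (sinh (\<tau> / 2)))\<^sup>2 = (sinh a * cos b)\<^sup>2 + (cosh a * sin b)\<^sup>2"
    unfolding cmod_power2 Re_sinh_half Im_sinh_half a_def b_def ..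
  have "(norm (cosh (\<tau> / 2)))\<^sup>2 - (norm (sinh (\<tau> / 2)))\<^sup>2 =
    ((cosh a)\<^sup>2 - (sinh a)\<^sup>2) * ((cos b)\<^sup>2 - (sin b)\<^sup>2)"
    unfolding X S by (simp add: power_mult_distrib algebra_simps)
  also have "\<dots> = cos (2 * b)" by (simp add: cosh_square_eq cos_double)
  finally have eq: "(norm (cosh (\<tau> / 2)))\<^sup>2 - (norm (sinh (\<tau> / 2)))\<^sup>2 = cos (Im \<tau>)" by (simp add: b_def)
  have "cosh (\<tau> / 2) \<noteq> 0" using Re_cosh_half_pos[OF assms] by auto
  thus ?thesis unfolding eq[symmetric] tanh_def norm_divide power_divide
    by (simp add: diff_divide_distrib)
qed

lemma norm_tanh_half_less:
  assumes "\<bar>Im \<tau>\<bar> < pi / 2" shows "norm (tanh (\<tau> / 2)) < 1"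
proof -
  have p: "\<bar>Im \<tau>\<bar> < pi" using assms pi_gt_zero by linarith
  have "cosh (\<tau> / 2) \<noteq> 0" using Re_cosh_half_pos[OF p] by auto
  moreover have "0 < cos (Im \<tau>)" using assms by (intro cos_gt_zero_pi) auto
  ultimately have "0 < 1 - (norm (tanh (\<tau> / 2)))\<^sup>2" unfolding norm_tanh_half[OF p] by simp
  hence "(norm (tanh (\<tau> / 2)))\<^sup>2 < 1\<^sup>2" by simp
  thus ?thesis using power_less_imp_less_base by fastforce
qed

text \<open>At z = tanh(\<tau>/2) one has 1 - z = exp(-\<tau>/2)/cosh(\<tau>/2) and 1 + z =
  exp(\<tau>/2)/cosh(\<tau>/2), so the two powers combine to an exponential and a power of
  cosh.\<close>

lemma mp_poly_sums_tanh:
  assumes nu: "\<nu> > 0" and tau: "\<bar>Im \<tau>\<bar> < pi / 2"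
  shows "(\<lambda>n. mp_poly \<nu> n s * tanh (\<tau> / 2) ^ n) sums (exp (- \<tau> * s) * cosh (\<tau> / 2) powr of_real \<nu>)"
proof -
  define X L where "X = cosh (\<tau> / 2)" and "L = Ln X"
  have tau': "\<bar>Im \<tau>\<bar> < pi" using tau pi_gt_zero by linarith
  have X: "Re X > 0" "X \<noteq> 0" using Re_cosh_half_pos[OF tau'] unfolding X_def by auto
  have L: "exp L = X" "\<bar>Im L\<bar> < pi / 2" unfolding L_def using X Re_Ln_pos_lt by (auto simp: Re_Ln_pos_lt)
  have 1: "1 - tanh (\<tau> / 2) = exp (- \<tau> / 2 - L)" "1 + tanh (\<tau> / 2) = exp (\<tau> / 2 - L)"
  proof -
    define A B where "A = exp (\<tau> / 2)" and "B = exp (- \<tau> / 2)"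
    have SAB: "sinh (\<tau> / 2) = (A - B) / 2" and XAB: "X = (A + B) / 2"
      by (simp_all add: X_def A_def B_def sinh_field_def cosh_field_def)
    have t: "tanh (\<tau> / 2) = (A - B) / (A + B)"
    proof -
      have "(A - B) / 2 / ((A + B) / 2) = (1 / 2 * (A - B)) / (1 / 2 * (A + B))"
        by (simp only: mult_1_left times_divide_eq_left)
      also have "\<dots> = (A - B) / (A + B)" by (rule mult_divide_mult_cancel_left) simp
      finally show ?thesis unfolding tanh_def SAB X_def[symmetric] XAB .
    qed
    have "A + B \<noteq> 0" using X(2) XAB by auto
    thus "1 - tanh (\<tau> / 2) = exp (- \<tau> / 2 - L)" "1 + tanh (\<tau> / 2) = exp (\<tau> / 2 - L)"
      unfolding exp_diff L(1) t XAB A_def[symmetric] B_def[symmetric]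
      by (simp_all add: divide_simps)
  qed
  \<comment> \<open>The principal logarithms are the exponents themselves: |Im \<tau>|/2 < \<pi>/4
    and |Im L| < \<pi>/2 keep their imaginary parts inside (-\<pi>, \<pi>).\<close>
  have "(1 - tanh (\<tau> / 2)) powr (s - of_real (\<nu>/2)) * (1 + tanh (\<tau> / 2)) powr (- s - of_real (\<nu>/2)) =
     exp ((s - of_real (\<nu>/2)) * (- \<tau> / 2 - L)) * exp ((- s - of_real (\<nu>/2)) * (\<tau> / 2 - L))"
    unfolding 1 powr_def using L(2) tau by (subst (1 2) Ln_exp) auto
  also have "\<dots> = exp (- \<tau> * s) * exp (of_real \<nu> * L)"
    unfolding exp_add[symmetric] by (rule arg_cong[of _ _ exp]) (simp add: field_simps)
  also have "exp (of_real \<nu> * L) = X powr of_real \<nu>" unfolding powr_def L_def using X by simp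
  finally show ?thesis
    using mp_poly_generating_function[OF nu norm_tanh_half_less[OF tau], of s] by (simp add: X_def)
qed

text \<open>
  The coefficients of the three-term recurrence are nonnegative when \<open>s \<le> 0\<close>, so the values at
  \<open>- \<bar>s\<bar>\<close> majorise those at \<open>s\<close>.
\<close>

lemma norm_mp_poly_le:
  assumes nu: "\<nu> > 0"
  shows "norm (mp_poly \<nu> n s) \<le> Re (mp_poly \<nu> n (- of_real (norm s)))"
proof (induction n rule: less_induct)
  case (less n)
  consider "n = 0" | "n = Suc 0" | m where "n = m + 2"
    by (metis One_nat_def Suc_1 add.commute add_2_eq_Suc' not0_implies_Suc)
  thus ?case
  proof cases
    case (3 m)
    let ?q = "\<lambda>n. mp_poly \<nu> n s" and ?p = "\<lambda>n. Re (mp_poly \<nu> n (- of_real (norm s)))"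
    have IH: "norm (?q m) \<le> ?p m" "norm (?q (m+1)) \<le> ?p (m+1)" using less 3 by auto
    have "real (m + 2) * norm (?q (m + 2)) = norm (of_nat (m + 2) * ?q (m + 2))"
      by (simp only: norm_mult norm_of_nat)
    also have "\<dots> \<le> norm (- 2 * s * ?q (m + 1)) + norm ((of_nat m + of_real \<nu>) * ?q m)"
      unfolding mp_poly_rec[OF nu] by (rule norm_triangle_ineq)
    also have "\<dots> = 2 * norm s * norm (?q (m + 1)) + (real m + \<nu>) * norm (?q m)"
    proof -
      have "norm (of_nat m + of_real \<nu> :: complex) = real m + \<nu>"
        using nu by (metis abs_of_nonneg add_nonneg_nonneg less_imp_le norm_of_real of_nat_0_le_iff
          of_real_add of_real_of_nat_eq)
      thus ?thesis by (simp add: norm_mult)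
    qed
    also have "\<dots> \<le> 2 * norm s * ?p (m + 1) + (real m + \<nu>) * ?p m"
      using IH nu by (intro add_mono mult_left_mono) auto
    also have "\<dots> = Re (of_nat (m + 2) * mp_poly \<nu> (m + 2) (- of_real (norm s)))"
      unfolding mp_poly_rec[OF nu] by simp
    also have "\<dots> = real (m + 2) * ?p (m + 2)" by simp
    finally show ?thesis using 3 by simp
  qed (use assms in \<open>simp_all add: mp_poly_0 mp_poly_1 norm_mult\<close>)
qed

text \<open>At -|s| the generating function has nonnegative terms for z = tanh(|x|/2), so its value
  bounds the sum of norms at s. The bound is explicit in s and can be integrated along s = \<i>
  t.\<close>

lemma mp_poly_abs_sum_tanh:
  fixes x :: real
  assumes nu: "\<nu> > 0"
  shows "summable (\<lambda>n. norm (mp_poly \<nu> n s) * \<bar>tanh (x / 2)\<bar> ^ n)"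
    and "(\<Sum>n. norm (mp_poly \<nu> n s) * \<bar>tanh (x / 2)\<bar> ^ n) \<le> exp (\<bar>x\<bar> * norm s) * cosh (x / 2) powr \<nu>"
proof -
  define y where "y = \<bar>x\<bar>"
  have ty: "\<bar>tanh (x / 2)\<bar> = tanh (y / 2)" and cy: "cosh (x / 2) = cosh (y / 2)"
    by (auto simp: y_def abs_if)
  have tr: "tanh (complex_of_real y / 2) = of_real (tanh (y / 2))" "cosh (complex_of_real y / 2) =
    of_real (cosh (y / 2))"
    by (simp_all add: tanh_def sinh_field_def cosh_field_def flip: exp_of_real)
  have *: "(\<lambda>n. mp_poly \<nu> n (- of_real (norm s)) * tanh (of_real y / 2) ^ n) sums
     (exp (- of_real y * (- of_real (norm s))) * cosh (of_real y / 2) powr of_real \<nu>)"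
    by (rule mp_poly_sums_tanh[OF nu]) simp
  have S: "(\<lambda>n. Re (mp_poly \<nu> n (- of_real (norm s))) * tanh (y / 2) ^ n) sums
    (exp (y * norm s) * cosh (y / 2) powr \<nu>)"
  proof -
    have e: "exp (- of_real y * (- of_real (norm s))) = complex_of_real (exp (y * norm s))"
      by (simp flip: exp_of_real)
    show ?thesis using sums_Re[OF *] cosh_real_pos[of "y/2"] unfolding tr e
      by (simp add: powr_of_real flip: of_real_power of_real_mult)
  qed
  have t0: "0 \<le> tanh (y / 2)" by (simp add: y_def)
  have le: "norm (mp_poly \<nu> n s) * tanh (y / 2) ^ n \<le>
    Re (mp_poly \<nu> n (- of_real (norm s))) * tanh (y / 2) ^ n" for n
    using norm_mp_poly_le[OF nu] t0 by (intro mult_right_mono) auto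
  show sm: "summable (\<lambda>n. norm (mp_poly \<nu> n s) * \<bar>tanh (x / 2)\<bar> ^ n)"
    unfolding ty by (rule summable_comparison_test'[OF sums_summable[OF S], of 0]) (use le t0 in auto)
  show "(\<Sum>n. norm (mp_poly \<nu> n s) * \<bar>tanh (x / 2)\<bar> ^ n) \<le> exp (\<bar>x\<bar> * norm s) * cosh (x / 2) powr \<nu>"
    using suminf_le[OF le sm[unfolded ty] sums_summable[OF S]] sums_unique[OF S] unfolding ty cy
      by (simp add: y_def)
qed

subsection \<open>Growth of the polynomials\<close>

text \<open>On |u| = R the conjugate of u is R^2/u, which makes |1 - \<sigma> u|^2 rational in u;
  Cauchy's formula at \<sigma> R^2 evaluates the mean. Up to the factor 1 - R^2 it is the mean of
  the Poisson kernel.\<close>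

lemma circle_mean_inverse_square:
  fixes R \<sigma> :: real
  assumes R: "0 < R" "R < 1" and sg: "\<sigma> = 1 \<or> \<sigma> = -1"
  shows "((\<lambda>x. 1 / (norm (1 - of_real \<sigma> * circlepath 0 R x))\<^sup>2) has_integral 1 / (1 - R\<^sup>2)) {0..1}"
proof -
  have ss: "\<sigma> * \<sigma> = 1" using sg by auto
  define w where "w = complex_of_real (\<sigma> * R\<^sup>2)"
  define f where "f u = 1 / (1 - of_real \<sigma> * u)" for u :: complex
  have nz: "1 - of_real \<sigma> * u \<noteq> 0" if "norm u \<le> R" for u :: complex
  proof
    assume "1 - of_real \<sigma> * u = 0"
    hence "of_real \<sigma> * u = 1" by simp
    hence "norm (of_real \<sigma> * u) = 1" by simp
    thus False using sg that R by (auto simp: norm_mult)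
  qed
  have "R * R < R * 1" using R by (intro mult_strict_left_mono) auto
  hence "R\<^sup>2 < R" by (simp add: power2_eq_square)
  hence RR: "R\<^sup>2 < R" "R\<^sup>2 < 1" using R by simp_all
  have "((\<lambda>u. f u / (u - w)) has_contour_integral (2 * of_real pi * \<i> * f w)) (circlepath 0 R)"
  proof (rule Cauchy_integral_circlepath_simple)
    show "f holomorphic_on cball 0 R" unfolding f_def by (intro holomorphic_intros) (use nz in auto)
    show "norm (w - 0) < R" using RR sg R by (auto simp: w_def norm_mult norm_power)
  qed
  hence "((\<lambda>x. f (circlepath 0 R x) / (circlepath 0 R x - w) *
    vector_derivative (circlepath 0 R) (at x within {0..1})) has_integral
      (2 * of_real pi * \<i> * f w)) {0..1}"
    by (simp add: has_contour_integral_def)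
  moreover have "f w = of_real (1 / (1 - R\<^sup>2))"
    unfolding f_def w_def of_real_mult mult.assoc[symmetric] using ss by (simp flip: of_real_mult)
  moreover have "f (circlepath 0 R x) / (circlepath 0 R x - w) *
    vector_derivative (circlepath 0 R) (at x within {0..1}) =
     2 * of_real pi * \<i> * of_real (1 / (norm (1 - of_real \<sigma> * circlepath 0 R x))\<^sup>2)" if "x \<in> {0..1}" for x
  proof -
    define u where "u = circlepath 0 R x"
    have u: "u = of_real R * exp (2 * of_real pi * \<i> * of_real x)" by (simp add: u_def circlepath)
    have vd: "vector_derivative (circlepath 0 R) (at x within {0..1}) = 2 * of_real pi * \<i> * u"
      using that by (subst vector_derivative_circlepath01) (auto simp: u)
    have nu: "norm u = R" unfolding u using R by (simp add: norm_mult)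
    have u0: "u \<noteq> 0" using nu R by auto
    have uu: "u * cnj u = of_real (R\<^sup>2)" by (metis complex_norm_square nu)
    define p where "p = 1 - of_real \<sigma> * u"
    have uw: "u - w = u * cnj p"
      unfolding w_def of_real_mult uu[symmetric] p_def by (simp add: algebra_simps)
    have N: "of_real ((norm p)\<^sup>2) = p * cnj p" by (rule complex_norm_square)
    show ?thesis unfolding vd u_def[symmetric] f_def p_def[symmetric] of_real_divide of_real_1 N uw
      using u0 by simp
  qed
  ultimately have "((\<lambda>x. 2 * of_real pi * \<i> * of_real (1 / (norm (1 - of_real \<sigma> *
    circlepath 0 R x))\<^sup>2)) has_integral
      (2 * of_real pi * \<i> * of_real (1 / (1 - R\<^sup>2)))) {0..1}"
    using has_integral_eq by (metis (no_types, lifting))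
  from has_integral_mult_right[OF this, of "1 / (2 * of_real pi * \<i>)"]
  have "((\<lambda>x. of_real (1 / (norm (1 - of_real \<sigma> *
    circlepath 0 R x))\<^sup>2)) has_integral complex_of_real (1 / (1 - R\<^sup>2))) {0..1}"
    by simp
  from has_integral_Re[OF this] show ?thesis by simp
qed

text \<open>Cauchy's coefficient formula with the mean of the bound in place of its maximum: the
  inverse squares reach (1 - R)^(-2), but their means are only 1/(1 - R^2).\<close>

lemma power_series_coeff_circle_bound:
  fixes a :: "nat \<Rightarrow> complex" and R :: real
  assumes R: "0 < R" "R < 1"
    and S: "\<And>z. norm z < 1 \<Longrightarrow> (\<lambda>n. a n * z ^ n) sums g z"
    and bound: "\<And>z. norm z = R \<Longrightarrow> norm (g z) \<le> B * (1 / (norm (1 - z))\<^sup>2 + 1 / (norm (1 + z))\<^sup>2)"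
  shows "norm (a n) * R ^ n \<le> 2 * B / (1 - R\<^sup>2)"
proof -
  have holo: "g holomorphic_on ball 0 1"
    using power_series_holomorphic[of 0 1 a g] S by simp
  have an: "a n = (deriv ^^ n) g 0 / fact n"
  proof -
    have "g has_fps_expansion Abs_fps a"
    proof (rule has_fps_expansionI)
      show "\<forall>\<^sub>F u in nhds 0. (\<lambda>n. fps_nth (Abs_fps a) n * u ^ n) sums g u"
        by (rule eventually_mono[OF eventually_nhds_in_open[of "ball 0 1" "0::complex"]]) (use S in auto)
    qed
    from fps_nth_fps_expansion[OF this, of n] show ?thesis by simp
  qed
  have "((\<lambda>u. g u / (u - 0) ^ (Suc n)) has_contour_integral ((2 * pi * \<i>) / (fact n) *
    (deriv ^^ n) g 0)) (circlepath 0 R)"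
    by (rule Cauchy_has_contour_integral_higher_derivative_circlepath)
       (use R in \<open>auto intro!: holomorphic_on_imp_continuous_on holomorphic_on_subset[OF holo]\<close>)
  hence "((\<lambda>x. g (circlepath 0 R x) / (circlepath 0 R x) ^ Suc n *
    vector_derivative (circlepath 0 R) (at x within {0..1})) has_integral
      (2 * pi * \<i> * a n)) {0..1}"
    by (simp add: has_contour_integral_def an)
  moreover have "g (circlepath 0 R x) / (circlepath 0 R x) ^ Suc n *
    vector_derivative (circlepath 0 R) (at x within {0..1}) =
      2 * of_real pi * \<i> * (g (circlepath 0 R x) / (circlepath 0 R x) ^ n)" if "x \<in> {0..1}" for x
  proof -
    have "vector_derivative (circlepath 0 R) (at x within {0..1}) = 2 * of_real pi * \<i> * circlepath 0 R x"
      using that by (subst vector_derivative_circlepath01) (auto simp: circlepath)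
    moreover have "circlepath 0 R x \<noteq> 0" using R by (simp add: circlepath)
    ultimately show ?thesis by (simp add: field_simps)
  qed
  ultimately have "((\<lambda>x. 2 * of_real pi * \<i> *
    (g (circlepath 0 R x) / (circlepath 0 R x) ^ n)) has_integral (2 * of_real pi * \<i> * a n)) {0..1}"
    by (subst (asm) has_integral_cong) (auto simp del: power_Suc)
  from has_integral_mult_right[OF this, of "1 / (2 * of_real pi * \<i>)"]
  have I: "((\<lambda>x. g (circlepath 0 R x) / (circlepath 0 R x) ^ n) has_integral a n) {0..1}" by simp
  define P where "P \<sigma> x = 1 / (norm (1 - of_real \<sigma> * circlepath 0 R x))\<^sup>2" for \<sigma> x :: real
  have J: "((\<lambda>x. B / R ^ n * (P 1 x + P (-1) x)) has_integral B / R ^ n * (1 / (1 - R\<^sup>2) +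
    1 / (1 - R\<^sup>2))) {0..1}"
    unfolding P_def by (intro has_integral_mult_right has_integral_add circle_mean_inverse_square R) auto
  have "norm (integral {0..1} (\<lambda>x. g (circlepath 0 R x) / (circlepath 0 R x) ^ n)) \<le>
    integral {0..1} (\<lambda>x. B / R ^ n * (P 1 x + P (-1) x))"
  proof (rule Henstock_Kurzweil_Integration.integral_norm_bound_integral)
    fix x :: real assume "x \<in> {0..1}"
    have n: "norm (circlepath 0 R x) = R" using R by (simp add: circlepath norm_mult)
    have "norm (g (circlepath 0 R x)) \<le> B * (P 1 x + P (-1) x)"
      using bound[OF n] unfolding P_def by simp
    thus "norm (g (circlepath 0 R x) / (circlepath 0 R x) ^ n) \<le> B / R ^ n * (P 1 x + P (-1) x)"
      unfolding norm_divide norm_power n using R by (simp add: divide_right_mono)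
  qed (use I J in \<open>auto simp: has_integral_integrable_integral\<close>)
  hence "norm (a n) \<le> B / R ^ n * (1 / (1 - R\<^sup>2) + 1 / (1 - R\<^sup>2))"
    using integral_unique[OF I] integral_unique[OF J] by simp
  hence "norm (a n) * R ^ n \<le> (B / R ^ n * (1 / (1 - R\<^sup>2) + 1 / (1 - R\<^sup>2))) * R ^ n"
    using R by (intro mult_right_mono) auto
  thus ?thesis using R by (simp add: mult.commute)
qed

text \<open>Gauss's product n! n^a/(a)_(n+1) converges to \<Gamma>(a) and is therefore bounded. The
  shift to n + 2 fits the radius chosen in \<open>mp_poly_bound_large\<close> and includes n =
  0.\<close>

lemma pochhammer_lower_bound:
  fixes a :: real assumes a: "a \<ge> 1"
  obtains C where "C > 0" "\<And>n. real (n + 2) powr (a - 1) \<le> C * (pochhammer a n / fact n)"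
proof -
  have "Gamma_series a \<longlonglongrightarrow> Gamma a" by (rule Gamma_series_LIMSEQ)
  hence "Bseq (Gamma_series a)" by (intro convergent_imp_Bseq) (auto simp: convergent_def)
  then obtain B where B: "B > 0" "\<And>n. norm (Gamma_series a n) \<le> B" by (auto simp: Bseq_def)
  \<comment> \<open>From n + 2 \<le> 3n and a + n \<le> (1 + a) n for n \<ge> 1; the last summand
    takes care of n = 0.\<close>
  define C where "C = 3 powr (a - 1) * (B * (1 + a)) + 2 powr (a - 1)"
  have "C > 0" unfolding C_def using B a by (intro add_nonneg_pos mult_nonneg_nonneg) auto
  moreover have "real (n + 2) powr (a - 1) \<le> C * (pochhammer a n / fact n)" for n
  proof (cases "n = 0")
    case True
    thus ?thesis using a B by (simp add: C_def)
  next
    case False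
    hence n: "real n \<ge> 1" by simp
    have p: "pochhammer a n > 0" using a by (intro pochhammer_pos) auto
    have "fact n * exp (a * ln (real n)) / pochhammer a (n + 1) \<le> B"
      using B(2)[of n] abs_ge_self[of "Gamma_series a n"] unfolding Gamma_series_def by simp
    hence "fact n * (real n powr a) \<le> B * pochhammer a (n + 1)"
      using p a n by (simp add: pochhammer_Suc powr_def divide_le_eq zero_less_mult_iff)
    hence "real n powr a \<le> B * (a + real n) * (pochhammer a n / fact n)"
      by (simp add: pochhammer_Suc field_simps)
    moreover have "real n powr a = real n * real n powr (a - 1)"
      using n by (simp add: powr_diff)
    ultimately have "real n * real n powr (a - 1) \<le> B * (a + real n) * (pochhammer a n / fact n)" by simp
    also have "\<dots> \<le> B * ((1 + a) * real n) * (pochhammer a n / fact n)"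
    proof (intro mult_right_mono mult_left_mono)
      show "a + real n \<le> (1 + a) * real n" using n a mult_left_mono[of 1 "real n" a]
        by (simp add: algebra_simps)
    qed (use B p in auto)
    finally have "real n * real n powr (a - 1) \<le> real n * (B * (1 + a) * (pochhammer a n / fact n))"
      by (simp add: mult_ac)
    hence le: "real n powr (a - 1) \<le> B * (1 + a) * (pochhammer a n / fact n)"
      using n by (subst (asm) mult_le_cancel_left_pos) auto
    have "real (n + 2) powr (a - 1) \<le> (3 * real n) powr (a - 1)" using n a by (intro powr_mono2) auto
    also have "\<dots> = 3 powr (a - 1) * real n powr (a - 1)" using n by (simp add: powr_mult)
    also have "\<dots> \<le> 3 powr (a - 1) * (B * (1 + a) * (pochhammer a n / fact n))"
      by (intro mult_left_mono le) auto
    also have "\<dots> \<le> C * (pochhammer a n / fact n)"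
      unfolding C_def distrib_right using p by (simp add: mult.assoc zero_le_mult_iff)
    finally show ?thesis .
  qed
  ultimately show ?thesis using that by blast
qed

text \<open>Both exponents have real part between -a and 2 c0 - a, the bases have modulus at most 2
  and argument below \<pi>/2. One of |1 - z|, |1 + z| is at least 1, so the product of the two
  singular factors is at most their sum.\<close>

lemma norm_mp_generating_function_le:
  fixes z s :: complex
  assumes z: "norm z < 1" and c0: "c0 \<ge> 0" and nu: "\<nu> > 0"
    and s: "\<bar>Re s\<bar> \<le> c0" "\<bar>Im s\<bar> \<le> T"
  defines "a \<equiv> \<nu> / 2 + c0"
  shows "norm ((1 - z) powr (s - of_real (\<nu>/2)) * (1 + z) powr (- s - of_real (\<nu>/2)))
     \<le> exp (T * pi) * 2 powr (4 * c0) * (norm (1 - z) powr (- a) + norm (1 + z) powr (- a))"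
proof -
  have T: "T \<ge> 0" using s by linarith
  have a: "a > 0" using nu c0 by (simp add: a_def)
  have *: "norm (u powr w) \<le> exp (T * pi / 2) * 2 powr (2 * c0) * norm u powr (- a)"
    if "Re u > 0" "norm u \<le> 2" "- a \<le> Re w" "Re w \<le> 2 * c0 - a" "\<bar>Im w\<bar> \<le> T" for u w :: complex
  proof -
    have "\<bar>- Im w * Arg u\<bar> \<le> T * (pi / 2)"
      unfolding abs_mult abs_minus_cancel using that Arg_Re_pos[of u] T by (intro mult_mono) auto
    hence 1: "exp (- Im w * Arg u) \<le> exp (T * pi / 2)" by simp
    have u: "norm u > 0" using that by auto
    have "norm u powr Re w = norm u powr (Re w + a) * norm u powr (- a)"
      using u by (simp flip: powr_add)
    also have "norm u powr (Re w + a) \<le> 2 powr (Re w + a)"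
      using that u by (intro powr_mono2) auto
    also have "2 powr (Re w + a) \<le> 2 powr (2 * c0)" using that by (intro powr_mono) auto
    finally have 2: "norm u powr Re w \<le> 2 powr (2 * c0) * norm u powr (- a)" by (simp add: mult_right_mono)
    have "norm (u powr w) = exp (- Im w * Arg u) * norm u powr Re w" by (simp add: norm_powr_complex)
    also have "\<dots> \<le> exp (T * pi / 2) * (2 powr (2 * c0) * norm u powr (- a))"
      by (rule mult_mono[OF 1 2]) auto
    finally show ?thesis by (simp add: mult_ac)
  qed
  have re: "\<bar>Re z\<bar> < 1" using z abs_Re_le_cmod[of z] by linarith
  have n2: "norm (1 - z) \<le> 2" "norm (1 + z) \<le> 2"
    using norm_triangle_ineq4[of 1 z] norm_triangle_ineq[of 1 z] z by simp_all
  define x y where "x = norm (1 - z)" and "y = norm (1 + z)"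
  have "x powr (- a) * y powr (- a) \<le> x powr (- a) + y powr (- a)"
  proof (cases "Re z \<ge> 0")
    case True
    have "1 \<le> Re (1 + z)" using True by simp
    also have "\<dots> \<le> y" unfolding y_def by (rule complex_Re_le_cmod)
    finally have "y powr (- a) \<le> 1 powr (- a)" using a by (intro powr_mono2') auto
    hence "x powr (- a) * y powr (- a) \<le> x powr (- a) * 1" by (intro mult_left_mono) auto
    thus ?thesis using powr_ge_zero[of y "- a"] by linarith
  next
    case False
    have "1 \<le> Re (1 - z)" using False by simp
    also have "\<dots> \<le> x" unfolding x_def by (rule complex_Re_le_cmod)
    finally have "x powr (- a) \<le> 1 powr (- a)" using a by (intro powr_mono2') auto
    hence "x powr (- a) * y powr (- a) \<le> 1 * y powr (- a)" by (intro mult_right_mono) auto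
    thus ?thesis using powr_ge_zero[of x "- a"] by linarith
  qed
  note sum = this
  have "norm ((1 - z) powr (s - of_real (\<nu>/2)) * (1 + z) powr (- s - of_real (\<nu>/2))) \<le>
     (exp (T * pi / 2) * 2 powr (2 * c0) * x powr (- a)) * (exp (T * pi / 2) * 2 powr (2 * c0) *
       y powr (- a))"
    unfolding norm_mult x_def y_def
    by (intro mult_mono *) (use re n2 s nu in \<open>auto simp: a_def\<close>)
  also have "\<dots> = exp (T * pi) * 2 powr (4 * c0) * (x powr (- a) * y powr (- a))"
  proof -
    have "exp (T * pi) = exp (T * pi / 2) * exp (T * pi / 2)" "(2::real) powr (4 * c0) =
      2 powr (2 * c0) * 2 powr (2 * c0)"
      by (simp_all flip: exp_add powr_add)
    thus ?thesis by simp
  qed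
  also have "\<dots> \<le> exp (T * pi) * 2 powr (4 * c0) * (x powr (- a) + y powr (- a))"
    using sum by (intro mult_left_mono) auto
  finally show ?thesis unfolding x_def y_def .
qed

text \<open>
  On the circle of radius \<open>R\<close> the generating function is at most a constant times
  \<open>\<bar>1 - z\<bar>\<^sup>-\<^sup>a + \<bar>1 + z\<bar>\<^sup>-\<^sup>a\<close>. For \<open>a \<ge> 2\<close> all but the square of these factors can be estimated by
  \<open>1 - R\<close>, and the remaining mean is that of the Poisson kernel. Smaller \<open>a\<close> are reached from \<open>\<nu> + 4\<close>
  by means of \<open>mp_poly_contiguous\<close>.
\<close>

lemma mp_poly_bound_large:
  assumes nu: "\<nu> > 0" and c0: "c0 \<ge> 0" and a: "a = \<nu> / 2 + c0" "a \<ge> 2" and T: "T \<ge> 0"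
  obtains C where "C \<ge> 0" "\<And>n s. \<bar>Re s\<bar> \<le> c0 \<Longrightarrow> \<bar>Im s\<bar> \<le> T \<Longrightarrow>
    norm (mp_poly \<nu> n s) \<le> C * (pochhammer a n / fact n)"
proof -
  obtain C1 where C1: "C1 > 0" "\<And>n. real (n + 2) powr (a - 1) \<le> C1 * (pochhammer a n / fact n)"
    using pochhammer_lower_bound[of a] a by auto
  define K where "K = exp (T * pi) * 2 powr (4 * c0)"
  have K: "K > 0" by (simp add: K_def)
  have "norm (mp_poly \<nu> n s) \<le> (2 * K * exp 1 * C1) * (pochhammer a n / fact n)"
    if s: "\<bar>Re s\<bar> \<le> c0" "\<bar>Im s\<bar> \<le> T" for n s
  proof -
    \<comment> \<open>With 1 - R = 1/(n + 2) the loss R^(-n) is at most e, while (1 - R)^(1-a) = (n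
      + 2)^(a-1) has the order of (a)_n/n!.\<close>
    define R where "R = real (n + 1) / real (n + 2)"
    have R: "0 < R" "R < 1" and R1: "1 - R = 1 / real (n + 2)" by (simp_all add: R_def field_simps)
    have sq: "u powr (- a) \<le> (1 - R) powr (2 - a) * (1 / u\<^sup>2)" if "1 - R \<le> u" for u :: real
    proof -
      have u: "u > 0" using that R by linarith
      have "u powr (- a) = u powr (2 - a) * u powr (- 2)" using u by (simp flip: powr_add)
      also have "u powr (- 2) = 1 / u\<^sup>2" using u by (simp add: powr_minus powr_numeral divide_inverse)
      finally have e: "u powr (- a) = u powr (2 - a) * (1 / u\<^sup>2)" .
      have "u powr (2 - a) \<le> (1 - R) powr (2 - a)" using that R a by (intro powr_mono2') auto
      thus ?thesis unfolding e by (rule mult_right_mono) simp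
    qed
    have "norm (mp_poly \<nu> n s) * R ^ n \<le> 2 * (K * (1 - R) powr (2 - a)) / (1 - R\<^sup>2)"
    proof (rule power_series_coeff_circle_bound[OF R])
      show "(\<lambda>n. mp_poly \<nu> n s * z ^ n) sums ((1 - z) powr (s - of_real (\<nu>/2)) * (1 +
        z) powr (- s - of_real (\<nu>/2)))"
        if "norm z < 1" for z by (rule mp_poly_generating_function[OF nu that])
      fix z :: complex assume z: "norm z = R"
      have "norm ((1 - z) powr (s - of_real (\<nu>/2)) * (1 + z) powr (- s - of_real (\<nu>/2)))
         \<le> K * (norm (1 - z) powr (- a) + norm (1 + z) powr (- a))"
        unfolding K_def a(1) by (rule norm_mp_generating_function_le) (use z R c0 nu s in auto)
      also have "\<dots> \<le> K * ((1 - R) powr (2 - a) * (1 / (norm (1 - z))\<^sup>2) +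
        (1 - R) powr (2 - a) * (1 / (norm (1 + z))\<^sup>2))"
        using norm_triangle_ineq2[of 1 z] norm_triangle_ineq2[of 1 "- z"] z K
        by (intro mult_left_mono add_mono sq) auto
      finally show "norm ((1 - z) powr (s - of_real (\<nu>/2)) * (1 + z) powr (- s - of_real (\<nu>/2)))
         \<le> K * (1 - R) powr (2 - a) * (1 / (norm (1 - z))\<^sup>2 + 1 / (norm (1 + z))\<^sup>2)"
           by (simp add: algebra_simps)
    qed
    also have "\<dots> \<le> 2 * (K * (1 - R) powr (2 - a)) / (1 - R)"
    proof (intro divide_left_mono mult_pos_pos)
      have "R\<^sup>2 \<le> R" using R by (simp add: power2_eq_square)
      thus "1 - R \<le> 1 - R\<^sup>2" "0 < 1 - R\<^sup>2" using R by auto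
    qed (use R K in auto)
    also have "\<dots> = 2 * K * (1 - R) powr (1 - a)"
      using R by (simp add: powr_diff power2_eq_square powr_numeral field_simps)
    also have "(1 - R) powr (1 - a) = real (n + 2) powr (a - 1)"
      unfolding R1 by (simp add: powr_divide powr_minus_divide[symmetric])
    finally have 1: "norm (mp_poly \<nu> n s) * R ^ n \<le> 2 * K * real (n + 2) powr (a - 1)" .
    have "1 \<le> exp 1 * R ^ n"
    proof -
      have "(1 + 1 / real (n + 1)) ^ (n + 1) \<le> exp 1"
        using exp_ge_one_plus_x_over_n_power_n[of "n + 1" 1] by simp
      moreover have "1 + 1 / real (n + 1) = 1 / R" by (simp add: R_def field_simps)
      ultimately have "(1 / R) ^ (n + 1) \<le> exp 1" by simp
      hence "1 \<le> exp 1 * R ^ (n + 1)" using R by (simp add: power_one_over divide_simps del: power_Suc)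
      also have "\<dots> \<le> exp 1 * R ^ n" using R by (intro mult_left_mono power_decreasing) auto
      finally show ?thesis .
    qed
    hence "norm (mp_poly \<nu> n s) * 1 \<le> norm (mp_poly \<nu> n s) * (exp 1 * R ^ n)"
      by (intro mult_left_mono) auto
    also have "\<dots> = exp 1 * (norm (mp_poly \<nu> n s) * R ^ n)" by simp
    also have "\<dots> \<le> exp 1 * (2 * K * (C1 * (pochhammer a n / fact n)))"
      using 1 C1(2)[of n] K by (intro mult_left_mono order_trans[OF 1]) auto
    finally show ?thesis by (simp add: mult_ac)
  qed
  moreover have "0 \<le> 2 * K * exp 1 * C1" using K C1 by simp
  ultimately show ?thesis using that by blast
qed

text \<open>Since (a + 1)_m/m! = (m + 1)/a times (a)_(m+1)/(m + 1)!, dividing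
  \<open>mp_poly_contiguous\<close> by m + 1 gives the smaller weight. The 1 in the maximum is for n
  = 0, where the polynomial is 1.\<close>

lemma mp_poly_bound_step:
  assumes nu: "\<nu> > 0" and a: "a > 0"
    and C: "C \<ge> 0" and s: "norm s \<le> B"
    and bound: "\<And>n. norm (mp_poly (\<nu> + 2) n s) \<le> C * (pochhammer (a + 1) n / fact n)"
  shows "norm (mp_poly \<nu> n s) \<le> max 1 ((2 * B + \<nu>) * C / a) * (pochhammer a n / fact n)"
proof (cases n)
  case 0
  thus ?thesis by (simp add: mp_poly_0)
next
  case (Suc m)
  define p where "p n = pochhammer (a + 1) n / fact n" for n
  have p0: "p n \<ge> 0" for n unfolding p_def using a by (intro divide_nonneg_nonneg pochhammer_nonneg) auto
  have pm: "(if m = 0 then 0 else p (m - 1)) \<le> p m"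
  proof (cases m)
    case (Suc k)
    have "p (Suc k) = p k * ((a + 1 + real k) / real (Suc k))" unfolding p_def by (simp add: pochhammer_Suc)
    moreover have "1 \<le> (a + 1 + real k) / real (Suc k)" using a by simp
    ultimately have "p k * 1 \<le> p (Suc k)" using p0[of k] by (simp only: mult_left_mono)
    thus ?thesis using Suc by simp
  qed (use p0 in simp)
  have "real (Suc m) * norm (mp_poly \<nu> (Suc m) s) = norm (of_nat (Suc m) * mp_poly \<nu> (Suc m) s)"
    by (simp only: norm_mult norm_of_nat)
  also have "\<dots> \<le> norm (- 2 * s * mp_poly (\<nu> + 2) m s) + norm (of_real \<nu> * (if m =
    0 then 0 else mp_poly (\<nu> + 2) (m - 1) s))"
    unfolding mp_poly_contiguous[OF nu] by (rule norm_triangle_ineq)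
  also have "\<dots> = 2 * norm s * norm (mp_poly (\<nu> + 2) m s) + \<nu> * (if m =
    0 then 0 else norm (mp_poly (\<nu> + 2) (m - 1) s))"
    using nu by (simp add: norm_mult)
  also have "\<dots> \<le> 2 * B * (C * p m) + \<nu> * (C * p m)"
  proof (intro add_mono mult_mono mult_left_mono)
    show "norm (mp_poly (\<nu> + 2) m s) \<le> C * p m" using bound[of m] by (simp add: p_def)
    show "(if m = 0 then 0 else norm (mp_poly (\<nu> + 2) (m - 1) s)) \<le> C * p m"
    proof (cases "m = 0")
      case False
      have "norm (mp_poly (\<nu> + 2) (m - 1) s) \<le> C * p (m - 1)" using bound[of "m - 1"] by (simp add: p_def)
      also have "\<dots> \<le> C * p m" using pm False C by (intro mult_left_mono) auto
      finally show ?thesis using False by simp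
    qed (use C p0 in simp)
  qed (use s nu C p0 norm_ge_zero[of s] in \<open>auto intro: order_trans[OF norm_ge_zero s]\<close>)
  also have "\<dots> = real (Suc m) * (((2 * B + \<nu>) * C / a) * (pochhammer a (Suc m) / fact (Suc m)))"
  proof -
    have "pochhammer a (Suc m) = a * pochhammer (a + 1) m" by (rule pochhammer_rec)
    hence "p m = real (Suc m) / a * (pochhammer a (Suc m) / fact (Suc m))"
      unfolding p_def using a by (simp add: fact_Suc del: of_nat_Suc)
    thus ?thesis by (simp add: algebra_simps add_divide_distrib)
  qed
  finally have "norm (mp_poly \<nu> (Suc m) s) \<le> ((2 * B + \<nu>) * C / a) * (pochhammer a (Suc m) / fact (Suc m))"
    by (subst (asm) mult_le_cancel_left_pos) auto
  also have "\<dots> \<le> max 1 ((2 * B + \<nu>) * C / a) * (pochhammer a (Suc m) / fact (Suc m))"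
    using a by (intro mult_right_mono divide_nonneg_nonneg pochhammer_nonneg) auto
  finally show ?thesis using Suc by simp
qed

lemma mp_poly_bound:
  assumes nu: "\<nu> > 0" and c0: "c0 \<ge> 0"
  obtains C where "C \<ge> 0" "\<And>n s. \<bar>Re s\<bar> \<le> c0 \<Longrightarrow> \<bar>Im s\<bar> \<le> T \<Longrightarrow>
    norm (mp_poly \<nu> n s) \<le> C * (pochhammer (\<nu> / 2 + c0) n / fact n)"
proof (cases "T \<ge> 0")
  case True
  define a where "a = \<nu> / 2 + c0"
  have a: "a > 0" using nu c0 by (simp add: a_def)
  \<comment> \<open>The parameter \<nu> + 4 has the exponent a + 2 > 2; each of the two steps down
    lowers the parameter by 2 and the exponent by 1.\<close>
  obtain C2 where C2: "C2 \<ge> 0" "\<And>n s. \<bar>Re s\<bar> \<le> c0 \<Longrightarrow> \<bar>Im s\<bar> \<le> T \<Longrightarrow>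
    norm (mp_poly (\<nu> + 4) n s) \<le> C2 * (pochhammer (a + 2) n / fact n)"
    using mp_poly_bound_large[of "\<nu> + 4" c0 "a + 2" T] nu c0 True a by (auto simp: a_def)
  have ns: "norm s \<le> c0 + T" if "\<bar>Re s\<bar> \<le> c0" "\<bar>Im s\<bar> \<le> T" for s
    using cmod_le[of s] that by linarith
  define C1 where "C1 = max 1 ((2 * (c0 + T) + (\<nu> + 2)) * C2 / (a + 1))"
  define C where "C = max 1 ((2 * (c0 + T) + \<nu>) * C1 / a)"
  have "norm (mp_poly \<nu> n s) \<le> C * (pochhammer a n / fact n)" if s: "\<bar>Re s\<bar> \<le> c0" "\<bar>Im s\<bar> \<le> T" for n s
    unfolding C_def
  proof (rule mp_poly_bound_step[OF nu a _ ns[OF s]])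
    show "C1 \<ge> 0" by (simp add: C1_def)
    show "norm (mp_poly (\<nu> + 2) n s) \<le> C1 * (pochhammer (a + 1) n / fact n)" for n
      unfolding C1_def
    proof (rule mp_poly_bound_step[OF _ _ C2(1) ns[OF s]])
      show "norm (mp_poly (\<nu> + 2 + 2) n s) \<le> C2 * (pochhammer (a + 1 + 1) n / fact n)" for n
        using C2(2)[OF s, of n] by (simp add: add.assoc)
    qed (use nu a in auto)
  qed
  moreover have "C \<ge> 0" by (simp add: C_def)
  ultimately show ?thesis using that unfolding a_def by blast
next
  case False
  show ?thesis by (rule that[of 0]) (use False in auto)
qed

section \<open>Binomial series and the weighted sums at tanh(\<tau>/2)\<close>

lemma pochhammer_sums_powr:
  fixes z :: complex assumes "norm z < 1"
  shows "(\<lambda>n. pochhammer a n / fact n * z ^ n) sums ((1 - z) powr (- a))"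
proof -
  have "(\<lambda>n. ((- a) gchoose n) * (- z) ^ n) sums (1 + (- z)) powr (- a)"
    by (rule gen_binomial_complex) (use assms in simp)
  moreover have "((- a) gchoose n) * (- z) ^ n = pochhammer a n / fact n * z ^ n" for n
  proof -
    have "((- a) gchoose n) * (- z) ^ n = ((-1) ^ n * (-1) ^ n) * (pochhammer a n / fact n * z ^ n)"
      unfolding gbinomial_pochhammer by (subst power_minus[of z]) simp
    also have "(-1) ^ n * (-1) ^ n = (1::complex)" by (simp flip: power_mult_distrib)
    finally show ?thesis by simp
  qed
  ultimately show ?thesis by simp
qed

lemma pochhammer_sums_powr_real:
  fixes x a :: real assumes "0 \<le> x" "x < 1"
  shows "(\<lambda>n. pochhammer a n / fact n * x ^ n) sums ((1 - x) powr (- a))"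
proof -
  have "(\<lambda>n. pochhammer (of_real a) n / fact n * (of_real x) ^ n) sums
    ((1 - of_real x) powr (- of_real a) :: complex)"
    by (rule pochhammer_sums_powr) (use assms in simp)
  hence "(\<lambda>n. complex_of_real (pochhammer a n / fact n * x ^ n)) sums
    (complex_of_real (1 - x) powr (complex_of_real (- a)))"
    by (simp add: pochhammer_of_real)
  hence "(\<lambda>n. complex_of_real (pochhammer a n / fact n * x ^ n)) sums of_real ((1 - x) powr (- a))"
    using assms by (subst (asm) powr_of_real) auto
  thus ?thesis unfolding sums_of_real_iff .
qed

text \<open>Binomial summation gives (1 - |z|)^(-a), and \<open>norm_tanh_half\<close> bounds 1 -
  |z| from below. Apart from the exponential the bound depends on Im \<tau> only, which is constant
  along the line of \<tau> used in \<open>mp_expansion_base\<close>.\<close>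

lemma tanh_weight_sum:
  assumes nu: "\<nu> > 0" and c0: "c0 \<ge> 0" and tau: "\<bar>Im \<tau>\<bar> < pi / 2"
  defines "a \<equiv> \<nu> / 2 + c0"
  shows "summable (\<lambda>n. pochhammer a n / fact n * norm (tanh (\<tau> / 2)) ^ n)"
    and "(\<Sum>n. pochhammer a n / fact n * norm (tanh (\<tau> / 2)) ^ n) * norm (cosh (\<tau> / 2) powr (- of_real \<nu>))
      \<le> (2 / cos (Im \<tau>)) powr a * exp (c0 * \<bar>Re \<tau>\<bar>)"
proof -
  define x X where "x = norm (tanh (\<tau> / 2))" and "X = norm (cosh (\<tau> / 2))"
  have tau': "\<bar>Im \<tau>\<bar> < pi" using tau pi_gt_zero by linarith
  have x: "0 \<le> x" "x < 1" using norm_tanh_half_less[OF tau] by (simp_all add: x_def)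
  have S: "(\<lambda>n. pochhammer a n / fact n * x ^ n) sums ((1 - x) powr (- a))"
    by (rule pochhammer_sums_powr_real[OF x])
  show "summable (\<lambda>n. pochhammer a n / fact n * norm (tanh (\<tau> / 2)) ^ n)"
    using sums_summable[OF S] by (simp add: x_def)
  have X: "X > 0" using Re_cosh_half_pos[OF tau'] by (auto simp: X_def)
  have co: "cos (Im \<tau>) > 0" using tau by (intro cos_gt_zero_pi) auto
  have a: "a > 0" using nu c0 by (simp add: a_def)
  have "1 - x\<^sup>2 = cos (Im \<tau>) / X\<^sup>2" unfolding x_def X_def by (rule norm_tanh_half[OF tau'])
  moreover have "1 - x\<^sup>2 \<le> 2 * (1 - x)" using x mult_left_mono[of x 1 x] zero_le_power2[of "1 - x"]
    by (simp add: power2_eq_square algebra_simps)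
  ultimately have "cos (Im \<tau>) / (2 * X\<^sup>2) \<le> 1 - x" by simp
  hence "(1 - x) powr (- a) \<le> (cos (Im \<tau>) / (2 * X\<^sup>2)) powr (- a)"
    using co X a by (intro powr_mono2') auto
  also have "\<dots> = (2 / cos (Im \<tau>)) powr a * (X\<^sup>2) powr a"
  proof -
    have "(cos (Im \<tau>) / (2 * X\<^sup>2)) powr (- a) = ((2 / cos (Im \<tau>)) * X\<^sup>2) powr a"
      using co X by (simp add: powr_minus inverse_powr[symmetric])
    also have "\<dots> = (2 / cos (Im \<tau>)) powr a * (X\<^sup>2) powr a"
      by (rule powr_mult)
    finally show ?thesis .
  qed
  also have "(X\<^sup>2) powr a = X powr (2 * a)" using X by (simp add: powr_powr flip: powr_numeral)
  finally have 1: "(1 - x) powr (- a) \<le> (2 / cos (Im \<tau>)) powr a * X powr (2 * a)" .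
  have XX: "X \<le> exp (\<bar>Re \<tau>\<bar> / 2)"
  proof -
    have "X \<le> (norm (exp (\<tau> / 2)) + norm (exp (- (\<tau> / 2)))) / 2"
    proof -
      have "X = norm (exp (\<tau> / 2) + exp (- (\<tau> / 2))) / 2" by (simp add: X_def cosh_field_def norm_divide)
      also have "\<dots> \<le> (norm (exp (\<tau> / 2)) + norm (exp (- (\<tau> / 2)))) / 2"
        by (intro divide_right_mono norm_triangle_ineq) simp
      finally show ?thesis .
    qed
    also have "\<dots> = cosh (\<bar>Re \<tau>\<bar> / 2)" by (simp add: norm_exp cosh_field_def abs_if)
    also have "\<dots> \<le> exp (\<bar>Re \<tau>\<bar> / 2)" by (simp add: cosh_field_def)
    finally show ?thesis .
  qed
  have n: "norm (cosh (\<tau> / 2) powr (- of_real \<nu>)) = X powr (- \<nu>)"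
    by (simp add: norm_powr_real_powr' X_def)
  have "(1 - x) powr (- a) * X powr (- \<nu>) \<le> (2 / cos (Im \<tau>)) powr a * X powr (2 * a) * X powr (- \<nu>)"
    by (rule mult_right_mono[OF 1]) simp
  also have "\<dots> = (2 / cos (Im \<tau>)) powr a * X powr (2 * c0)"
    unfolding mult.assoc powr_add[symmetric] by (simp add: a_def)
  also have "X powr (2 * c0) \<le> exp (\<bar>Re \<tau>\<bar> / 2) powr (2 * c0)" using X XX c0 by (intro powr_mono2) auto
  also have "\<dots> = exp (c0 * \<bar>Re \<tau>\<bar>)" by (simp add: exp_powr_real mult.commute)
  finally show "(\<Sum>n. pochhammer a n / fact n * norm (tanh (\<tau> / 2)) ^ n) *
    norm (cosh (\<tau> / 2) powr (- of_real \<nu>))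
      \<le> (2 / cos (Im \<tau>)) powr a * exp (c0 * \<bar>Re \<tau>\<bar>)"
    unfolding n x_def[symmetric] sums_unique[OF S, symmetric] by (simp add: mult_left_mono)
qed

subsection \<open>The weight function and its Laplace transform\<close>

text \<open>The left side is the tangent of exp at ln k. It shows that exp(-exp v) absorbs any
  exponential exp(k v).\<close>

lemma exp_lower_tangent:
  fixes v k :: real assumes "k > 0" shows "k * v - (k * ln k - k) \<le> exp v"
proof -
  have "1 + (v - ln k) \<le> exp (v - ln k)" by (rule exp_ge_add_one_self)
  hence "k * (1 + (v - ln k)) \<le> k * exp (v - ln k)" using assms by (intro mult_left_mono) auto
  also have "\<dots> = exp v" using assms by (simp add: exp_diff)
  finally show ?thesis by (simp add: algebra_simps)
qed

text \<open>Euler's integral after t = exp v: scalings of t become translations of v, under which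
  Lebesgue measure is invariant.\<close>

lemma Gamma_exp_integral:
  assumes z: "Re z > 0"
  shows "integrable lborel (\<lambda>v. exp (z * of_real v - of_real (exp v)))"
    and "(LBINT v. exp (z * of_real v - of_real (exp v))) = Gamma z"
proof -
  define f where "f t = of_real t powr (z - 1) / of_real (exp t)" for t :: real
  have eq: "\<bar>exp v\<bar> *\<^sub>R f (exp v) = exp (z * of_real v - of_real (exp v))" for v :: real
  proof -
    have "of_real (exp v) powr (z - 1) = exp ((z - 1) * of_real v)"
      by (simp add: powr_def Ln_of_real)
    thus ?thesis unfolding f_def
      by (simp add: scaleR_conv_of_real exp_diff algebra_simps exp_of_real flip: exp_of_real)
  qed
  have a: "integrable lborel (\<lambda>v. exp (z * of_real v - of_real (exp v)))"
  proof (rule Bochner_Integration.integrable_bound)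
    \<comment> \<open>Twice the needed slope: one half cancels exp(Re z v), the other supplies the
      decay for v \<ge> 0. For v < 0 the integrand decays already.\<close>
    define k where "k = 2 * Re z"
    define C where "C = max 1 (exp (k * ln k - k))"
    show "integrable lborel (\<lambda>v. C * exp (- Re z * \<bar>v\<bar>))"
      using integrable_exp_minus_abs[OF z] by simp
    show "AE v in lborel. norm (exp (z * of_real v - of_real (exp v))) \<le> norm (C * exp (- Re z * \<bar>v\<bar>))"
    proof (rule AE_I2)
      fix v :: real
      have C: "1 \<le> C" "exp (k * ln k - k) \<le> C" by (auto simp: C_def)
      have "exp (Re z * v - exp v) \<le> C * exp (- Re z * \<bar>v\<bar>)"
      proof (cases "v \<ge> 0")
        case True
        have "Re z * v - exp v \<le> (k * ln k - k) + - Re z * \<bar>v\<bar>"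
        proof -
          have "k * v = Re z * v + Re z * v" by (simp add: k_def)
          hence "Re z * v - exp v \<le> (k * ln k - k) - Re z * v"
            using exp_lower_tangent[of k v] z by (simp only: k_def) linarith
          thus ?thesis using True by simp
        qed
        hence "exp (Re z * v - exp v) \<le> exp (k * ln k - k) * exp (- Re z * \<bar>v\<bar>)"
          by (simp flip: exp_add)
        also have "\<dots> \<le> C * exp (- Re z * \<bar>v\<bar>)" using C by (intro mult_right_mono) auto
        finally show ?thesis .
      next
        case False
        have "exp (Re z * v - exp v) \<le> 1 * exp (- Re z * \<bar>v\<bar>)" using False by simp
        also have "\<dots> \<le> C * exp (- Re z * \<bar>v\<bar>)" using C by (intro mult_right_mono) auto
        finally show ?thesis .
      qed
      thus "norm (exp (z * of_real v - of_real (exp v))) \<le> norm (C * exp (- Re z * \<bar>v\<bar>))"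
        using C by (simp add: norm_exp abs_mult)
    qed
  qed measurable
  show "integrable lborel (\<lambda>v. exp (z * of_real v - of_real (exp v)))" by (rule a)
  have range: "range (exp :: real \<Rightarrow> real) = {0<..}" by (auto simp: image_iff) (metis exp_ln)
  have "((\<lambda>v. \<bar>exp v\<bar> *\<^sub>R f (exp v)) absolutely_integrable_on UNIV \<and>
      integral UNIV (\<lambda>v. \<bar>exp v\<bar> *\<^sub>R f (exp v)) = Gamma z) \<longleftrightarrow>
      (f absolutely_integrable_on range exp \<and> integral (range exp) f = Gamma z)"
    by (rule has_absolute_integral_change_of_variables_real) (auto intro!: derivative_eq_intros inj_onI)
  moreover have "f absolutely_integrable_on range exp" "integral (range exp) f = Gamma z"
    unfolding range f_def using absolutely_integrable_Gamma_integral'[OF z] integral_unique[OF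
      Gamma_integral_complex'[OF z]] by auto
  ultimately have "integral UNIV (\<lambda>v. \<bar>exp v\<bar> *\<^sub>R f (exp v)) = Gamma z" by blast
  moreover have "(LBINT v. exp (z * of_real v - of_real (exp v))) =
    integral UNIV (\<lambda>v. exp (z * of_real v - of_real (exp v)))"
    using integral_lborel[OF a] by simp
  ultimately show "(LBINT v. exp (z * of_real v - of_real (exp v))) = Gamma z" by (simp only: eq)
qed

text \<open>The Beta integral in exponential coordinates. The translation of u by -ln(1 + exp v)
  merges exp(u + v) + exp u into exp u, and the u-integral becomes \<Gamma>(\<nu>).\<close>

lemma Gamma_times_Gamma_integral:
  fixes \<nu> :: real
  assumes z: "Re z > 0" and w: "Re w > 0" and sum: "z + w = of_real \<nu>"
  shows "Gamma z * Gamma w = Gamma (of_real \<nu>) * (LBINT v. exp (z * of_real v) * of_real ((1 +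
    exp v) powr (- \<nu>)))"
proof -
  define e :: "complex \<Rightarrow> real \<Rightarrow> complex" where "e = (\<lambda>z v. exp (z * of_real v - of_real (exp v)))"
  define F where "F u v = e z (u + v) * e w u" for u v
  have [measurable]: "e z \<in> borel_measurable borel" for z unfolding e_def by measurable
  have e: "integrable lborel (e z)" "(LBINT v. e z v) = Gamma z" if "Re z > 0" for z
    using Gamma_exp_integral[OF that] by (simp_all add: e_def)
  have nu: "\<nu> > 0" using arg_cong[OF sum, of Re] z w by simp
  have sh: "integrable lborel (\<lambda>v. e z (u + v))" "(LBINT v. e z (u + v)) = (LBINT v. e z v)"
    "(LBINT v. norm (e z (u + v))) = (LBINT v. norm (e z v))" if "Re z > 0" for z u
    using lborel_integrable_real_affine[OF e(1)[OF that], of 1 u] lborel_integral_real_affine[of 1 "e z" u]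
      lborel_integral_real_affine[of 1 "\<lambda>v. norm (e z v)" u] by simp_all
  have int: "integrable (lborel \<Otimes>\<^sub>M lborel) (\<lambda>(u, v). F u v)"
  proof (rule lborel_pair.Fubini_integrable)
    show "(\<lambda>(u, v). F u v) \<in> borel_measurable (lborel \<Otimes>\<^sub>M lborel)" unfolding F_def by measurable
    have "(\<lambda>u. LBINT v. norm (case (u, v) of (u, v) \<Rightarrow> F u v)) = (\<lambda>u. (LBINT v. norm (e z v)) * norm (e w u))"
      unfolding F_def by (simp add: norm_mult sh(3)[OF z])
    thus "integrable lborel (\<lambda>u. LBINT v. norm (case (u, v) of (u, v) \<Rightarrow> F u v))"
      using e(1)[OF w] by simp
    show "AE u in lborel. integrable lborel (\<lambda>v. case (u, v) of (u, v) \<Rightarrow> F u v)"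
      unfolding F_def using sh(1)[OF z] by simp
  qed
  have "Gamma z * Gamma w = (LBINT u. LBINT v. F u v)"
    unfolding F_def by (simp add: sh(2)[OF z] e(2) z w)
  also have "\<dots> = (LBINT v. LBINT u. F u v)"
    by (rule lborel_pair.Fubini_integral[OF int, symmetric])
  also have "\<dots> = (LBINT v. Gamma (of_real \<nu>) * (exp (z * of_real v) * of_real ((1 + exp v) powr (- \<nu>))))"
  proof (rule lebesgue_integral_cong)
    fix v :: real
    define l where "l = ln (1 + exp v)"
    have el: "exp l = 1 + exp v" unfolding l_def using exp_gt_zero[of v] by (intro exp_ln) linarith
    have "(LBINT u. F u v) = (LBINT u. F (- l + u) v)"
      using lborel_integral_real_affine[of 1 "\<lambda>u. F u v" "- l"] by simp
    also have "\<dots> = (LBINT u. (exp (z * of_real v) * exp (- of_real (\<nu> * l))) * e (of_real \<nu>) u)"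
    proof (rule lebesgue_integral_cong)
      fix u :: real
      have "exp (- l + u + v) + exp (- l + u) = exp u * (exp (-l) * exp l)"
        unfolding el by (simp add: exp_add exp_diff exp_minus field_simps)
      hence 1: "exp (- l + u + v) + exp (- l + u) = exp u" by (simp flip: exp_add)
      have "F (- l + u) v = exp ((z * of_real (- l + u + v) + w * of_real (- l +
        u)) - of_real (exp (- l + u + v) + exp (- l + u)))"
        unfolding F_def e_def by (simp flip: exp_add add: algebra_simps)
      also have "z * of_real (- l + u + v) + w * of_real (- l + u) =
        z * of_real v - of_real (\<nu> * l) + of_real \<nu> * of_real u"
        unfolding of_real_mult sum[symmetric] by (simp add: algebra_simps)
      finally show "F (- l + u) v = (exp (z * of_real v) * exp (- of_real (\<nu> * l))) * e (of_real \<nu>) u"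
        unfolding 1 e_def by (simp flip: exp_add add: algebra_simps)
    qed
    also have "\<dots> = (exp (z * of_real v) * exp (- of_real (\<nu> * l))) * Gamma (of_real \<nu>)"
      using e(2)[of "of_real \<nu>"] nu by simp
    also have "exp (- of_real (\<nu> * l)) = (of_real ((1 + exp v) powr (- \<nu>)) :: complex)"
    proof -
      have "1 + exp v \<noteq> 0" using exp_gt_zero[of v] by linarith
      thus ?thesis unfolding powr_def l_def by (simp flip: exp_of_real)
    qed
    finally show "(LBINT u. F u v) = Gamma (of_real \<nu>) * (exp (z * of_real v) * of_real ((1 +
      exp v) powr (- \<nu>)))"
      by simp
  qed
  finally show ?thesis by simp
qed

text \<open>The principal power is holomorphic on |Re s| < \<pi>, because cos(s/2) has positive real
  part there.\<close>

definition cos_kernel :: "real \<Rightarrow> complex \<Rightarrow> complex" where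
  "cos_kernel \<nu> s = cos (s / 2) powr (- of_real \<nu>)"

text \<open>Re cos(s/2) = cos(Re s/2) cosh(Im s/2). This yields both the branch condition and the
  exponential decay of \<open>cos_kernel\<close>.\<close>

lemma Re_cos_ge:
  assumes "\<bar>Re s\<bar> \<le> c" "c < pi"
  shows "cos (c / 2) * exp (\<bar>Im s\<bar> / 2) / 2 \<le> Re (cos (s / 2))"
proof -
  have "cos (c / 2) \<le> cos \<bar>Re s / 2\<bar>"
    using assms by (intro cos_monotone_0_pi_le) auto
  hence 1: "cos (c / 2) \<le> cos (Re s / 2)" by (simp only: cos_abs_real)
  have "0 < cos (c / 2)" using assms by (intro cos_gt_zero_pi) auto
  have "exp (\<bar>Im s\<bar> / 2) \<le> exp (Im s / 2) + exp (- (Im s / 2))"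
    by (cases "Im s \<ge> 0") auto
  hence "cos (c / 2) * exp (\<bar>Im s\<bar> / 2) \<le> cos (Re s / 2) * (exp (Im s / 2) + exp (- (Im s / 2)))"
    using 1 \<open>0 < cos (c / 2)\<close> by (intro mult_mono) auto
  thus ?thesis by (simp add: Re_cos)
qed

lemma Re_cos_pos:
  assumes "\<bar>Re s\<bar> < pi" shows "Re (cos (s / 2)) > 0"
proof -
  have "0 < cos (\<bar>Re s\<bar> / 2)" using assms by (intro cos_gt_zero_pi) auto
  thus ?thesis using Re_cos_ge[of s "\<bar>Re s\<bar>"] assms
    by (intro less_le_trans[OF _ Re_cos_ge[of s "\<bar>Re s\<bar>"]]) auto
qed

lemma strip_decay_cos_kernel:
  assumes nu: "\<nu> > 0" and c: "0 < c" "c < pi"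
  shows "strip_decay (cos_kernel \<nu>) c (\<nu> / 2) ((cos (c / 2) / 2) powr (- \<nu>))"
proof
  show "cos_kernel \<nu> holomorphic_on {s. \<bar>Re s\<bar> < c}"
    unfolding cos_kernel_def
  proof (intro holomorphic_intros)
    fix s assume "s \<in> {s. \<bar>Re s\<bar> < c}"
    thus "cos (s / 2) \<notin> \<real>\<^sub>\<le>\<^sub>0"
      using Re_cos_pos[of s] c by (auto simp: complex_nonpos_Reals_iff)
  qed auto
  show "\<nu> / 2 > 0" using nu by simp
  fix s assume s: "\<bar>Re s\<bar> < c"
  have "0 < cos (c / 2)" using c by (intro cos_gt_zero_pi) auto
  have "cos (c / 2) / 2 * exp (\<bar>Im s\<bar> / 2) \<le> norm (cos (s / 2))"
    using Re_cos_ge[of s c] s c complex_Re_le_cmod[of "cos (s / 2)"] by simp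
  hence "norm (cos (s / 2)) powr (- \<nu>) \<le> (cos (c / 2) / 2 * exp (\<bar>Im s\<bar> / 2)) powr (- \<nu>)"
    using nu \<open>0 < cos (c / 2)\<close> by (intro powr_mono2') auto
  also have "\<dots> = (cos (c / 2) / 2) powr (- \<nu>) * exp (- (\<nu> / 2) * \<bar>Im s\<bar>)"
    using \<open>0 < cos (c / 2)\<close> by (subst powr_mult) (auto simp: exp_powr_real)
  finally show "norm (cos_kernel \<nu> s) \<le> (cos (c / 2) / 2) powr (- \<nu>) * exp (- (\<nu> / 2) * \<bar>Im s\<bar>)"
    unfolding cos_kernel_def by (simp add: norm_powr_real_powr')
qed

definition mp_density :: "real \<Rightarrow> real \<Rightarrow> real" where
  "mp_density \<nu> t = 1 / (2 * pi) * (2 powr \<nu> / Gamma \<nu>) * (norm (Gamma (\<i> * of_real t + of_real (\<nu> / 2))))\<^sup>2"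

text \<open>|\<Gamma>(z)|^2 is \<Gamma>(z) times \<Gamma> of the conjugate, and these arguments add
  up to \<nu>, so the Beta integral applies; 1 + exp v = 2 cosh(v/2) exp(v/2) turns its integrand
  into the kernel on the imaginary axis. Measurability, decay and Laplace transform of the density
  are then all results about strips.\<close>

lemma mp_density_eq_strip_transform:
  assumes nu: "\<nu> > 0"
  shows "of_real (mp_density \<nu> t) = strip_transform (cos_kernel \<nu>) t"
proof -
  define z where "z = \<i> * of_real t + complex_of_real (\<nu> / 2)"
  have sum: "z + cnj z = of_real \<nu>" by (simp add: z_def complex_eq_iff)
  have "of_real ((norm (Gamma z))\<^sup>2) = Gamma z * Gamma (cnj z)"
    by (simp only: complex_norm_square flip: cnj_Gamma)
  also have "\<dots> = Gamma (of_real \<nu>) * (LBINT v. exp (z * of_real v) * of_real ((1 + exp v) powr (- \<nu>)))"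
    by (rule Gamma_times_Gamma_integral[OF _ _ sum]) (use nu in \<open>simp_all add: z_def\<close>)
  also have "(LBINT v. exp (z * of_real v) * of_real ((1 + exp v) powr (- \<nu>))) =
      (LBINT v. of_real (2 powr (- \<nu>)) * (cos_kernel \<nu> (Complex 0 v) * exp (of_real t * Complex 0 v)))"
  proof (rule lebesgue_integral_cong)
    fix v :: real
    have c: "cos (Complex 0 v / 2) = of_real (cosh (v / 2))"
      by (simp add: complex_eq_iff Re_cos Im_cos cosh_field_def)
    have "1 + exp v = 2 * cosh (v / 2) * exp (v / 2)"
    proof -
      have "2 * cosh (v / 2) * exp (v / 2) = (exp (v / 2) + exp (- (v / 2))) * exp (v / 2)"
        by (simp add: cosh_field_def)
      also have "\<dots> = exp (v / 2) * exp (v / 2) + exp (- (v / 2)) * exp (v / 2)" by (rule distrib_right)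
      also have "\<dots> = exp v + 1" by (simp flip: exp_add)
      finally show ?thesis by simp
    qed
    hence "(1 + exp v) powr (- \<nu>) = 2 powr (- \<nu>) * (cosh (v / 2) powr (- \<nu>)) * exp (- (\<nu> / 2) * v)"
      using cosh_real_pos[of "v/2"] by (simp add: powr_mult exp_powr_real)
    moreover have "cos_kernel \<nu> (Complex 0 v) = of_real (cosh (v / 2) powr (- \<nu>))"
      unfolding cos_kernel_def c using cosh_real_pos[of "v/2"] by (simp flip: powr_of_real of_real_minus)
    moreover have "exp (z * of_real v) = of_real (exp (\<nu> / 2 * v)) * exp (of_real t * Complex 0 v)"
    proof -
      have "z * of_real v = of_real (\<nu> / 2 * v) + of_real t * Complex 0 v" by (simp add: z_def complex_eq_iff)
      thus ?thesis by (simp only: exp_add exp_of_real)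
    qed
    moreover have "exp (\<nu> / 2 * v) * exp (- (\<nu> / 2) * v) = 1" by (simp flip: exp_add)
    hence "complex_of_real (exp (\<nu> / 2 * v)) * of_real (exp (- (\<nu> / 2) * v)) = 1"
      by (metis of_real_1 of_real_mult)
    ultimately show "exp (z * of_real v) * of_real ((1 + exp v) powr (- \<nu>)) =
        of_real (2 powr (- \<nu>)) * (cos_kernel \<nu> (Complex 0 v) * exp (of_real t * Complex 0 v))"
      by (simp add: mult_ac)
  qed
  also have "\<dots> = of_real (2 powr (- \<nu>)) * (2 * of_real pi * strip_transform (cos_kernel \<nu>) t)"
    unfolding strip_transform_def by simp
  finally have *: "of_real ((norm (Gamma z))\<^sup>2) =
    Gamma (of_real \<nu>) * (of_real (2 powr (- \<nu>)) * (2 * of_real pi * strip_transform (cos_kernel \<nu>) t))" .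
  have g: "Gamma (of_real \<nu> :: complex) = of_real (Gamma \<nu>)" "Gamma \<nu> > 0"
    using nu by (simp_all add: Gamma_complex_of_real Gamma_real_pos)
  have p: "(2::real) powr \<nu> * 2 powr (- \<nu>) = 1" by (simp flip: powr_add)
  have "of_real (mp_density \<nu> t) = of_real (1 / (2 * pi) * (2 powr \<nu> / Gamma \<nu>)) *
    (of_real ((norm (Gamma z))\<^sup>2) :: complex)"
    unfolding mp_density_def z_def by (simp only: of_real_mult)
  also have "\<dots> = of_real (1 / (2 * pi) * (2 powr \<nu> / Gamma \<nu>) * Gamma \<nu> * 2 powr (- \<nu>) * (2 * pi)) *
    strip_transform (cos_kernel \<nu>) t"
    unfolding * g by simp
  also have "1 / (2 * pi) * (2 powr \<nu> / Gamma \<nu>) * Gamma \<nu> * 2 powr (- \<nu>) * (2 * pi) = 1"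
    using g p by (simp add: field_simps)
  finally show ?thesis by simp
qed

section \<open>Measurability, decay and Laplace transform of the density\<close>

lemma mp_density_nonneg: "\<nu> > 0 \<Longrightarrow> 0 \<le> mp_density \<nu> t"
  unfolding mp_density_def using Gamma_real_pos[of \<nu>] by (intro mult_nonneg_nonneg divide_nonneg_nonneg) auto

lemma mp_density_measurable:
  assumes "\<nu> > 0" shows "mp_density \<nu> \<in> borel_measurable borel"
proof -
  interpret strip_decay "cos_kernel \<nu>" 1 "\<nu> / 2" "(cos (1 / 2) / 2) powr (- \<nu>)"
    by (rule strip_decay_cos_kernel) (use assms pi_gt3 in auto)
  have "(\<lambda>t. Re (strip_transform (cos_kernel \<nu>) t)) \<in> borel_measurable borel"
    using measurable_strip_transform by measurable
  thus ?thesis by (simp flip: mp_density_eq_strip_transform[OF assms])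
qed

lemma mp_density_le:
  assumes nu: "\<nu> > 0" and c: "0 \<le> c" "c < pi"
  obtains C where "C \<ge> 0" "\<And>t. mp_density \<nu> t \<le> C * exp (- c * \<bar>t\<bar>)"
proof -
  obtain c' where c': "c < c'" "c' < pi" using dense[OF c(2)] by blast
  interpret strip_decay "cos_kernel \<nu>" c' "\<nu> / 2" "(cos (c' / 2) / 2) powr (- \<nu>)"
    by (rule strip_decay_cos_kernel) (use assms c' in auto)
  have le: "mp_density \<nu> t \<le> decay_const * exp (- c * \<bar>t\<bar>)" for t
    using norm_strip_transform'[of c t] c c' unfolding mp_density_eq_strip_transform[OF nu, symmetric] by simp
  moreover have "decay_const \<ge> 0" using order_trans[OF mp_density_nonneg[OF nu] le[of 0]] by simp
  ultimately show ?thesis using that by blast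
qed

text \<open>The density is the inverse transform of \<open>cos_kernel\<close>, so inversion returns
  the kernel.\<close>

lemma mp_density_laplace:
  assumes nu: "\<nu> > 0" and s: "\<bar>Re s\<bar> < pi"
  shows "integrable lborel (\<lambda>t. of_real (mp_density \<nu> t) * exp (- of_real t * s))"
    and "(LBINT t. of_real (mp_density \<nu> t) * exp (- of_real t * s)) = cos_kernel \<nu> s"
proof -
  obtain c' where c': "\<bar>Re s\<bar> < c'" "c' < pi" using dense[OF s] by blast
  interpret strip_decay "cos_kernel \<nu>" c' "\<nu> / 2" "(cos (c' / 2) / 2) powr (- \<nu>)"
    by (rule strip_decay_cos_kernel) (use assms c' in auto)
  show "integrable lborel (\<lambda>t. of_real (mp_density \<nu> t) * exp (- of_real t * s))"
    "(LBINT t. of_real (mp_density \<nu> t) * exp (- of_real t * s)) = cos_kernel \<nu> s"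
    unfolding mp_density_eq_strip_transform[OF nu]
    using integrable_strip_transform[of s] strip_inversion[of s] c' by simp_all
qed

subsection \<open>Integrals of the polynomials against exponentials\<close>

text \<open>A single majorant for the sum of norms bounds all partial sums. The second conclusion is
  what later gives summability of the weighted coefficients.\<close>

lemma sums_integral_dominated:
  fixes F :: "nat \<Rightarrow> 'a \<Rightarrow> complex"
  assumes meas: "\<And>n. F n \<in> borel_measurable M" and w: "integrable M w"
    and sm: "\<And>x. summable (\<lambda>n. norm (F n x))"
    and le: "\<And>x. (\<Sum>n. norm (F n x)) \<le> w x"
  shows "integrable M (F n)"
    and "summable (\<lambda>n. LINT x|M. norm (F n x))"
    and "(\<lambda>n. LINT x|M. F n x) sums (LINT x|M. (\<Sum>n. F n x))"
proof -
  have part: "(\<Sum>i<N. norm (F i x)) \<le> w x" for N x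
    by (rule order_trans[OF sum_le_suminf[OF sm] le]) auto
  show int: "integrable M (F n)" for n
  proof (rule Bochner_Integration.integrable_bound[OF w meas])
    show "AE x in M. norm (F n x) \<le> norm (w x)"
    proof (rule AE_I2)
      fix x
      have "norm (F n x) \<le> (\<Sum>i<Suc n. norm (F i x))" by (simp add: sum_nonneg)
      also have "\<dots> \<le> w x" by (rule part)
      finally show "norm (F n x) \<le> norm (w x)" by simp
    qed
  qed
  show sum: "summable (\<lambda>n. LINT x|M. norm (F n x))"
  proof (rule summableI_nonneg_bounded)
    fix N
    have "(\<Sum>n<N. LINT x|M. norm (F n x)) = (LINT x|M. (\<Sum>n<N. norm (F n x)))"
      using int by (intro Bochner_Integration.integral_sum[symmetric]) auto
    also have "\<dots> \<le> (LINT x|M. w x)"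
      using int w part by (intro integral_mono) auto
    finally show "(\<Sum>n<N. LINT x|M. norm (F n x)) \<le> (LINT x|M. w x)" .
  qed auto
  show "(\<lambda>n. LINT x|M. F n x) sums (LINT x|M. (\<Sum>n. F n x))"
    using int sm sum by (intro sums_integral) auto
qed

text \<open>Zeros of a nonzero power series are isolated; applied to real and imaginary parts. The
  variable is real because the series are compared at y = tanh(x/2) with real x.\<close>

lemma power_series_unique_real:
  fixes d :: "nat \<Rightarrow> complex" and r :: real
  assumes r: "r > 0" and S: "\<And>x::real. \<bar>x\<bar> < r \<Longrightarrow> (\<lambda>n. d n * of_real x ^ n) sums 0"
  shows "d m = 0"
proof -
  have zero: "a m = 0" if a: "\<And>x. \<bar>x\<bar> < r \<Longrightarrow> (\<lambda>n. a n * x ^ n) sums 0" for a :: "nat \<Rightarrow> real" and m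
  proof (rule ccontr)
    assume am: "a m \<noteq> 0"
    have "(\<lambda>n. a n * 0 ^ n) sums 0" using a[of 0] r by simp
    hence "a 0 = 0" using sums_unique[OF powser_sums_zero[of a]] sums_unique by metis
    with am have m: "m > 0" by (cases m) auto
    show False
    proof (rule powser_0_nonzero[OF r, where \<xi> = 0 and a = a and f = "\<lambda>_. 0" and m = m])
      fix e :: real assume e: "0 < e" "\<And>z. z \<in> cball (0::real) e - {0} \<Longrightarrow> (0::real) \<noteq> 0"
      from e(2)[of e] e(1) show False by auto
    qed (use a am m in auto)
  qed
  have "(\<lambda>n. Re (d n) * x ^ n) sums 0" "(\<lambda>n. Im (d n) * x ^ n) sums 0" if "\<bar>x\<bar> < r" for x
    using sums_Re[OF S[OF that]] sums_Im[OF S[OF that]] by (simp_all flip: of_real_power)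
  from zero[of "\<lambda>n. Re (d n)" m, OF this(1)] zero[of "\<lambda>n. Im (d n)" m, OF this(2)]
  show ?thesis by (simp add: complex_eq_iff)
qed

lemma cnj_mp_poly:
  assumes "\<nu> > 0" shows "cnj (mp_poly \<nu> n s) = mp_poly \<nu> n (cnj s)"
proof (rule mp_poly_unique[OF assms])
  show "of_nat (n + 2) * cnj (mp_poly \<nu> (n + 2) s) =
    - 2 * cnj s * cnj (mp_poly \<nu> (n + 1) s) + (of_nat n + of_real \<nu>) * cnj (mp_poly \<nu> n s)" for n
    using arg_cong[OF mp_poly_rec[OF assms, of n s], of cnj] by simp
qed (use assms in \<open>simp_all add: mp_poly_0 mp_poly_1\<close>)

lemma mp_poly_holomorphic:
  assumes "\<nu> > 0" shows "mp_poly \<nu> n holomorphic_on A"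
  unfolding mp_poly_expand[OF assms, abs_def] by (intro holomorphic_intros)

lemma cnj_mp_poly_measurable:
  assumes "\<nu> > 0" shows "(\<lambda>t::real. cnj (mp_poly \<nu> n (\<i> * of_real t))) \<in> borel_measurable borel"
proof (rule borel_measurable_continuous_onI)
  have "continuous_on UNIV (mp_poly \<nu> n)"
    by (rule holomorphic_on_imp_continuous_on[OF mp_poly_holomorphic[OF assms]])
  thus "continuous_on UNIV (\<lambda>t::real. cnj (mp_poly \<nu> n (\<i> * of_real t)))"
    by (intro continuous_on_cnj, elim continuous_on_compose2) (auto intro!: continuous_intros)
qed

text \<open>One term of the sum in \<open>mp_poly_abs_sum_tanh\<close> is at most the whole sum. The
  rate x may be as small as desired; the constant depends on n, which is harmless for integrability
  at fixed n.\<close>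

lemma mp_poly_exp_bound:
  assumes nu: "\<nu> > 0" and x: "x > 0"
  obtains C where "C \<ge> 0" "\<And>t::real. norm (mp_poly \<nu> n (\<i> * of_real t)) \<le> C * exp (x * \<bar>t\<bar>)"
proof -
  define T where "T = \<bar>tanh (x / 2)\<bar> ^ n"
  have T: "T > 0" using x by (simp add: T_def)
  have "norm (mp_poly \<nu> n (\<i> * of_real t)) \<le> (cosh (x / 2) powr \<nu> / T) * exp (x * \<bar>t\<bar>)" for t :: real
  proof -
    have "norm (mp_poly \<nu> n (\<i> * of_real t)) * T \<le>
      (\<Sum>n. norm (mp_poly \<nu> n (\<i> * of_real t)) * \<bar>tanh (x / 2)\<bar> ^ n)"
      unfolding T_def using sum_le_suminf[OF mp_poly_abs_sum_tanh(1)[OF nu, of "\<i> *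
        of_real t" x], of "{n}"] by simp
    also have "\<dots> \<le> exp (x * \<bar>t\<bar>) * cosh (x / 2) powr \<nu>"
      using mp_poly_abs_sum_tanh(2)[OF nu, of "\<i> * of_real t" x] x by (simp add: norm_mult)
    finally show ?thesis using T by (simp add: field_simps)
  qed
  moreover have "cosh (x / 2) powr \<nu> / T \<ge> 0" using T by simp
  ultimately show ?thesis using that by blast
qed

lemma norm_exp_i: "norm (exp (- \<tau> * (\<i> * of_real t))) = exp (Im \<tau> * t)"
  by (simp add: norm_exp)

lemma integrable_mp_density_exp:
  assumes nu: "\<nu> > 0" and c: "0 \<le> c" "c < pi"
  shows "integrable lborel (\<lambda>t. mp_density \<nu> t * exp (c * \<bar>t\<bar>))"
proof -
  obtain c' where c': "c < c'" "c' < pi" using dense[OF c(2)] by blast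
  obtain C where C: "C \<ge> 0" "\<And>t. mp_density \<nu> t \<le> C * exp (- c' * \<bar>t\<bar>)"
    using mp_density_le[OF nu, of c'] c c' by auto
  show ?thesis
  proof (rule Bochner_Integration.integrable_bound)
    show "integrable lborel (\<lambda>t. C * exp (- (c' - c) * \<bar>t\<bar>))"
      using integrable_exp_minus_abs[of "c' - c"] c' by simp
    show "(\<lambda>t. mp_density \<nu> t * exp (c * \<bar>t\<bar>)) \<in> borel_measurable lborel"
      using mp_density_measurable[OF nu] by measurable
    have "norm (mp_density \<nu> t * exp (c * \<bar>t\<bar>)) \<le> norm (C * exp (- (c' - c) * \<bar>t\<bar>))" for t
    proof -
      have "mp_density \<nu> t * exp (c * \<bar>t\<bar>) \<le> (C * exp (- c' * \<bar>t\<bar>)) * exp (c * \<bar>t\<bar>)"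
        by (intro mult_right_mono C) auto
      also have "\<dots> = C * exp (- (c' - c) * \<bar>t\<bar>)" by (simp add: algebra_simps flip: exp_add)
      finally show ?thesis using mp_density_nonneg[OF nu, of t] C(1) by (simp add: abs_mult)
    qed
    thus "AE t in lborel. norm (mp_density \<nu> t * exp (c * \<bar>t\<bar>)) \<le> norm (C * exp (- (c' - c) * \<bar>t\<bar>))" by simp
  qed
qed

text \<open>The addition theorem, factored. The powers may be separated because cosh(x/2) is
  positive and the other two factors have positive real part, so their arguments add up to less than
  \<pi> in modulus.\<close>

lemma cosh_half_diff_powr:
  fixes x :: real
  assumes tau: "\<bar>Im \<tau>\<bar> < pi / 2"
  shows "cosh ((\<tau> - of_real x) / 2) powr (- of_real \<nu>) =
    cosh (\<tau> / 2) powr (- of_real \<nu>) * of_real (cosh (x / 2) powr (- \<nu>)) * (1 - tanh (\<tau> / 2) *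
      of_real (tanh (x / 2))) powr (- of_real \<nu>)"
proof -
  define z y where "z = tanh (\<tau> / 2)" and "y = tanh (x / 2)"
  have tau': "\<bar>Im \<tau>\<bar> < pi" using tau pi_gt_zero by linarith
  have X: "Re (cosh (\<tau> / 2)) > 0" by (rule Re_cosh_half_pos[OF tau'])
  have tr: "cosh (of_real x / 2 :: complex) = of_real (cosh (x / 2))" "sinh (of_real x / 2 :: complex) =
    of_real (sinh (x / 2))"
    by (simp_all add: sinh_field_def cosh_field_def flip: exp_of_real)
  have eq: "cosh ((\<tau> - of_real x) / 2) = of_real (cosh (x / 2)) * (cosh (\<tau> / 2) * (1 - z * of_real y))"
    using X cosh_real_pos[of "x / 2"] unfolding diff_divide_distrib cosh_diff tr z_def y_def tanh_def
    by (auto simp: field_simps)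
  have "norm (z * of_real y) \<le> norm z * 1"
    unfolding norm_mult using tanh_real_bounds[of "x / 2"] by (intro mult_left_mono) (auto simp: y_def)
  also have "\<dots> < 1" using norm_tanh_half_less[OF tau] by (simp add: z_def)
  finally have "\<bar>Re (z * of_real y)\<bar> < 1" using abs_Re_le_cmod[of "z * of_real y"] by linarith
  hence W: "Re (1 - z * of_real y) > 0" by simp
  have nz: "cosh (\<tau> / 2) \<noteq> 0" "1 - z * of_real y \<noteq> 0"
    using X W by (metis less_irrefl zero_complex.sel(1))+
  have Ln: "Ln (cosh (\<tau> / 2) * (1 - z * of_real y)) = Ln (cosh (\<tau> / 2)) + Ln (1 - z * of_real y)"
    using Re_Ln_pos_lt_imp[OF X] Re_Ln_pos_lt_imp[OF W] nz by (intro Ln_times_simple) (simp_all add: nz)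
  have "of_real (cosh (x / 2)) powr (- of_real \<nu>) = (of_real (cosh (x / 2) powr (- \<nu>)) :: complex)"
    using powr_of_real[of "cosh (x / 2)" "- \<nu>"] cosh_real_nonneg[of "x/2"] by simp
  moreover have "(of_real (cosh (x / 2)) * (cosh (\<tau> / 2) * (1 - z * of_real y))) powr (- of_real \<nu>) =
     of_real (cosh (x / 2)) powr (- of_real \<nu>) * (cosh (\<tau> / 2) * (1 - z * of_real y)) powr (- of_real \<nu>)"
    by (rule powr_times_real_left) (auto simp: cosh_real_nonneg)
  moreover have "(cosh (\<tau> / 2) * (1 - z * of_real y)) powr (- of_real \<nu>) =
    cosh (\<tau> / 2) powr (- of_real \<nu>) * (1 - z * of_real y) powr (- of_real \<nu>)"
    using nz unfolding powr_def Ln by (auto simp: ring_distribs simp flip: exp_add)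
  ultimately show ?thesis unfolding eq z_def y_def by (simp add: mult_ac)
qed

text \<open>
  Both sides are coefficients of power series in \<open>y = tanh(x/2)\<close> with the same sum: summing the
  generating function under the integral sign leaves the Laplace transform of the density.
\<close>

lemma mp_density_exp_poly_integral:
  assumes nu: "\<nu> > 0" and tau: "\<bar>Im \<tau>\<bar> < pi / 2"
  shows "(LBINT t. of_real (mp_density \<nu> t) * (exp (- \<tau> * (\<i> * of_real t)) * cnj (mp_poly \<nu> m (\<i> *
    of_real t)))) =
    cosh (\<tau> / 2) powr (- of_real \<nu>) * (of_real (pochhammer \<nu> m / fact m) * tanh (\<tau> / 2) ^ m)"
    (is "?I m = ?X * (?p m * ?z ^ m)")
proof -
  have "?I m - ?X * (?p m * ?z ^ m) = 0"
  \<comment> \<open>This radius means |x| < 1 < \<pi>/2. Then |Im \<tau>| + |x| < \<pi>, and the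
    density absorbs both exponentials.\<close>
  proof (rule power_series_unique_real[where d = "\<lambda>m. ?I m - ?X * (?p m * ?z ^ m)" and r =
    "tanh (1 / 2 :: real)"])
    have "tanh 0 < tanh (1 / 2 :: real)" by (simp only: tanh_real_less_iff)
    thus "0 < tanh (1 / 2 :: real)" by (simp only: tanh_0)
    fix y :: real assume y: "\<bar>y\<bar> < tanh (1 / 2 :: real)"
    \<comment> \<open>This is 2 artanh y.\<close>
    define x where "x = ln ((1 + y) / (1 - y))"
    have y1: "\<bar>y\<bar> < 1" using y tanh_real_lt_1[of "1 / 2"] by linarith
    have xy: "tanh (x / 2) = y"
    proof -
      have e: "exp x = (1 + y) / (1 - y)" unfolding x_def using y1 by (intro exp_ln) auto
      have "tanh (x / 2) = (1 - 1 / exp x) / (1 + 1 / exp x)"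
      proof -
        have "tanh (x / 2) = (1 - exp (- x)) / (1 + exp (- x))" using tanh_real_altdef[of "x / 2"] by simp
        thus ?thesis by (simp only: exp_minus inverse_eq_divide)
      qed
      also have "1 - 1 / exp x = 2 * y / (1 + y)" unfolding e using y1 by (simp add: field_simps)
      also have "1 + 1 / exp x = 2 / (1 + y)" unfolding e using y1 by (simp add: field_simps)
      also have "2 * y / (1 + y) / (2 / (1 + y)) = y" using y1 by simp
      finally show ?thesis .
    qed
    have "tanh (\<bar>x\<bar> / 2) = \<bar>y\<bar>" using xy by (auto simp: abs_if)
    hence "tanh (\<bar>x\<bar> / 2) < tanh (1 / 2 :: real)" using y by (simp only:)
    hence "\<bar>x\<bar> / 2 < 1 / 2" by (simp only: tanh_real_less_iff)
    hence x: "\<bar>x\<bar> < pi / 2" using pi_gt3 by simp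
    define F where "F m t = of_real (mp_density \<nu> t) * (exp (- \<tau> * (\<i> * of_real t)) *
      cnj (mp_poly \<nu> m (\<i> * of_real t))) * of_real y ^ m" for m and t :: real
    have nF: "norm (F m t) = mp_density \<nu> t * exp (Im \<tau> * t) * (norm (mp_poly \<nu> m (\<i> * of_real t)) *
      \<bar>y\<bar> ^ m)" for m t
      unfolding F_def norm_mult norm_exp_i using mp_density_nonneg[OF nu] by (simp add: norm_power)
    have S: "summable (\<lambda>m. norm (mp_poly \<nu> m (\<i> * of_real t)) * \<bar>y\<bar> ^ m)"
       "(\<Sum>m. norm (mp_poly \<nu> m (\<i> * of_real t)) * \<bar>y\<bar> ^ m) \<le>
         exp (\<bar>x\<bar> * \<bar>t\<bar>) * cosh (x / 2) powr \<nu>" for t :: real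
      using mp_poly_abs_sum_tanh[OF nu, of "\<i> * of_real t" x] unfolding xy by (simp_all add: norm_mult)
    have sF: "summable (\<lambda>m. norm (F m t))" for t unfolding nF by (intro summable_mult S)
    have w: "integrable lborel (\<lambda>t. cosh (x / 2) powr \<nu> * (mp_density \<nu> t * exp ((\<bar>Im \<tau>\<bar> + \<bar>x\<bar>) * \<bar>t\<bar>)))"
      by (intro integrable_mult_right integrable_mp_density_exp[OF nu]) (use tau x in auto)
    have le: "(\<Sum>m. norm (F m t)) \<le> cosh (x / 2) powr \<nu> * (mp_density \<nu> t * exp ((\<bar>Im \<tau>\<bar> + \<bar>x\<bar>) * \<bar>t\<bar>))" for t
    proof -
      have "Im \<tau> * t \<le> \<bar>Im \<tau>\<bar> * \<bar>t\<bar>" using abs_ge_self[of "Im \<tau> * t"] by (simp add: abs_mult)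
      hence 1: "mp_density \<nu> t * exp (Im \<tau> * t) \<le> mp_density \<nu> t * exp (\<bar>Im \<tau>\<bar> * \<bar>t\<bar>)"
        using mp_density_nonneg[OF nu] by (intro mult_left_mono) auto
      have "(\<Sum>m. norm (F m t)) = mp_density \<nu> t * exp (Im \<tau> * t) * (\<Sum>m. norm (mp_poly \<nu> m (\<i> *
        of_real t)) * \<bar>y\<bar> ^ m)"
        unfolding nF by (rule suminf_mult[OF S(1)])
      also have "\<dots> \<le> (mp_density \<nu> t * exp (\<bar>Im \<tau>\<bar> * \<bar>t\<bar>)) * (exp (\<bar>x\<bar> * \<bar>t\<bar>) * cosh (x / 2) powr \<nu>)"
        using mp_density_nonneg[OF nu, of t] by (intro mult_mono 1 S(2) suminf_nonneg[OF S(1)]) auto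
      also have "\<dots> = cosh (x / 2) powr \<nu> * (mp_density \<nu> t * exp ((\<bar>Im \<tau>\<bar> + \<bar>x\<bar>) * \<bar>t\<bar>))"
        by (simp add: distrib_right exp_add)
      finally show ?thesis .
    qed
    have mF: "F m \<in> borel_measurable lborel" for m

    proof -
      have [measurable]: "mp_density \<nu> \<in> borel_measurable borel"
        "(\<lambda>t::real. cnj (mp_poly \<nu> m (\<i> * of_real t))) \<in> borel_measurable borel"
        by (rule mp_density_measurable[OF nu], rule cnj_mp_poly_measurable[OF nu])
      show ?thesis unfolding F_def by measurable
    qed
    have "(\<lambda>m. LBINT t. F m t) sums (LBINT t. (\<Sum>m. F m t))"
      by (rule sums_integral_dominated(3)[OF mF w sF le])
    moreover have "(LBINT t. F m t) = ?I m * of_real y ^ m" for m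
      unfolding F_def by (rule integral_mult_left_zero)
    moreover have "(LBINT t. (\<Sum>m. F m t)) = ?X * (1 - ?z * of_real y) powr (- of_real \<nu>)"
    proof -
      have "(\<Sum>m. F m t) = of_real (cosh (x / 2) powr \<nu>) * (of_real (mp_density \<nu> t) * exp (- of_real t *
        (\<i> * (\<tau> - of_real x))))" for t :: real
      proof -
        have tr: "tanh (complex_of_real x / 2) = of_real y" "cosh (complex_of_real x / 2) =
          of_real (cosh (x / 2))"
          unfolding xy[symmetric] by (simp_all add: tanh_def sinh_field_def cosh_field_def flip: exp_of_real)
        \<comment> \<open>Conjugation moves the argument from \<i> t to -\<i> t, where the
          generating function produces exp(\<i> x t).\<close>
        have "(\<lambda>m. mp_poly \<nu> m (- (\<i> * of_real t)) * tanh (of_real x / 2) ^ m) sums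
           (exp (- of_real x * (- (\<i> * of_real t))) * cosh (of_real x / 2) powr of_real \<nu>)"
          by (rule mp_poly_sums_tanh[OF nu]) simp
        hence "(\<lambda>m. mp_poly \<nu> m (- (\<i> * of_real t)) * of_real y ^ m) sums
          (exp (of_real x * (\<i> * of_real t)) * of_real (cosh (x / 2) powr \<nu>))"
          unfolding tr using cosh_real_nonneg[of "x / 2"] by (simp add: powr_of_real)
        hence "(\<lambda>m. (of_real (mp_density \<nu> t) * exp (- \<tau> * (\<i> * of_real t))) * (mp_poly \<nu> m (- (\<i> *
          of_real t)) * of_real y ^ m)) sums
            ((of_real (mp_density \<nu> t) * exp (- \<tau> * (\<i> * of_real t))) * (exp (of_real x * (\<i> *
              of_real t)) * of_real (cosh (x / 2) powr \<nu>)))"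
          by (rule sums_mult)
        moreover have "F m t = (of_real (mp_density \<nu> t) * exp (- \<tau> * (\<i> * of_real t))) *
          (mp_poly \<nu> m (- (\<i> * of_real t)) * of_real y ^ m)" for m
          unfolding F_def cnj_mp_poly[OF nu] by simp
        moreover have "exp (- \<tau> * (\<i> * of_real t)) * exp (of_real x * (\<i> * of_real t)) =
          exp (- of_real t * (\<i> * (\<tau> - of_real x)))"
          by (simp add: algebra_simps flip: exp_add)
        ultimately show ?thesis by (simp add: sums_iff mult_ac)
      qed
      \<comment> \<open>The exponentials combine to exp(-t s) with s = \<i> (\<tau> - x), and Re s =
        -Im \<tau> lies in the strip of the Laplace transform.\<close>
      hence "(LBINT t. (\<Sum>m. F m t)) = of_real (cosh (x / 2) powr \<nu>) * cos_kernel \<nu> (\<i> * (\<tau> - of_real x))"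
        using mp_density_laplace(2)[OF nu, of "\<i> * (\<tau> - of_real x)"] tau by simp
      also have "cos_kernel \<nu> (\<i> * (\<tau> - of_real x)) = cosh ((\<tau> - of_real x) / 2) powr (- of_real \<nu>)"
        unfolding cos_kernel_def cosh_conv_cos by simp
      also have "\<dots> = ?X * of_real (cosh (x / 2) powr (- \<nu>)) * (1 - ?z * of_real y) powr (- of_real \<nu>)"
        unfolding cosh_half_diff_powr[OF tau] xy ..
      finally have "(LBINT t. (\<Sum>m. F m t)) = (of_real (cosh (x / 2) powr \<nu>) *
        of_real (cosh (x / 2) powr (- \<nu>))) * (?X * (1 - ?z * of_real y) powr (- of_real \<nu>))"
        by (simp only: mult_ac)
      also have "of_real (cosh (x / 2) powr \<nu>) * of_real (cosh (x / 2) powr (- \<nu>)) = (1::complex)"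
        using cosh_real_pos[of "x / 2"] by (simp flip: of_real_mult powr_add)
      finally show ?thesis by simp
    qed
    ultimately have 1: "(\<lambda>m. ?I m * of_real y ^ m) sums (?X * (1 - ?z * of_real y) powr (- of_real \<nu>))"
      by simp
    have "norm (?z * of_real y) \<le> norm ?z * 1" unfolding norm_mult using y1 by (intro mult_left_mono) auto
    also have "\<dots> < 1" using norm_tanh_half_less[OF tau] by simp
    finally have "(\<lambda>m. pochhammer (of_real \<nu>) m / fact m * (?z * of_real y) ^ m) sums
      ((1 - ?z * of_real y) powr (- of_real \<nu>))"
      by (rule pochhammer_sums_powr)
    hence "(\<lambda>m. ?X * (pochhammer (of_real \<nu>) m / fact m * (?z * of_real y) ^ m)) sums
      (?X * (1 - ?z * of_real y) powr (- of_real \<nu>))"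
      by (rule sums_mult)
    from sums_diff[OF 1 this] show "(\<lambda>m. (?I m - ?X * (?p m * ?z ^ m)) * of_real y ^ m) sums 0"
      by (simp add: algebra_simps power_mult_distrib pochhammer_of_real)
  qed
  thus ?thesis by simp
qed

subsection \<open>Expansion of holomorphic functions in a strip\<close>

lemma mp_coeff_lborel:
  assumes nu: "\<nu> > 0" and meas: "(\<lambda>t::real. f (\<i> * of_real t)) \<in> borel_measurable borel"
  shows "mp_coeff \<nu> f n = of_real (fact n / pochhammer \<nu> n) *
     (LBINT t. of_real (mp_density \<nu> t) * (f (\<i> * of_real t) * cnj (mp_poly \<nu> n (\<i> * of_real t))))"
proof -
  have M: "mp_measure \<nu> = density lborel (\<lambda>t. ennreal (mp_density \<nu> t))"
    unfolding mp_measure_def mp_density_def ..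
  have "(LINT t|mp_measure \<nu>. f (\<i> * of_real t) * cnj (mp_poly \<nu> n (\<i> * of_real t))) =
     (LBINT t. mp_density \<nu> t *\<^sub>R (f (\<i> * of_real t) * cnj (mp_poly \<nu> n (\<i> * of_real t))))"
    unfolding M
    by (rule integral_density) (use meas cnj_mp_poly_measurable[OF nu] mp_density_measurable[OF nu]
      mp_density_nonneg[OF nu] in auto)
  thus ?thesis by (simp add: mp_coeff_def scaleR_conv_of_real)
qed

text \<open>Designed to be stable under addition: measurability and integrability make the
  coefficients additive. The weighted summability is what upgrades the pointwise expansion to local
  uniform convergence.\<close>

definition mp_expandable :: "real \<Rightarrow> real \<Rightarrow> (complex \<Rightarrow> complex) \<Rightarrow> bool" where
  "mp_expandable \<nu> c f \<longleftrightarrow>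
     (\<lambda>t::real. f (\<i> * of_real t)) \<in> borel_measurable borel \<and>
     (\<forall>n. integrable lborel (\<lambda>t. of_real (mp_density \<nu> t) * (f (\<i> * of_real t) * cnj (mp_poly \<nu> n (\<i> *
       of_real t))))) \<and>
     (\<forall>c0. 0 \<le> c0 \<longrightarrow> c0 < c \<longrightarrow> summable (\<lambda>n. norm (mp_coeff \<nu> f n) * (pochhammer (\<nu> / 2 + c0) n / fact n))) \<and>
     (\<forall>s. \<bar>Re s\<bar> < c \<longrightarrow> (\<lambda>n. mp_coeff \<nu> f n * mp_poly \<nu> n s) sums f s)"

lemma mp_expandable_add:
  assumes nu: "\<nu> > 0" and f: "mp_expandable \<nu> c f" and g: "mp_expandable \<nu> c g"
  shows "mp_expandable \<nu> c (\<lambda>s. f s + g s)"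
proof -
  have meas: "(\<lambda>t::real. f (\<i> * of_real t)) \<in> borel_measurable borel"
    "(\<lambda>t::real. g (\<i> * of_real t)) \<in> borel_measurable borel"
    and int: "integrable lborel (\<lambda>t. of_real (mp_density \<nu> t) * (f (\<i> * of_real t) *
      cnj (mp_poly \<nu> n (\<i> * of_real t))))"
     "integrable lborel (\<lambda>t. of_real (mp_density \<nu> t) * (g (\<i> * of_real t) * cnj (mp_poly \<nu> n (\<i> *
       of_real t))))" for n
    using f g by (auto simp: mp_expandable_def)
  have meas': "(\<lambda>t::real. f (\<i> * of_real t) + g (\<i> * of_real t)) \<in> borel_measurable borel" using meas
    by measurable
  have coeff: "mp_coeff \<nu> (\<lambda>s. f s + g s) n = mp_coeff \<nu> f n + mp_coeff \<nu> g n" for n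
    unfolding mp_coeff_lborel[OF nu meas(1)] mp_coeff_lborel[OF nu meas(2)] mp_coeff_lborel[OF nu meas']
      distrib_right distrib_left Bochner_Integration.integral_add[OF int] ..
  show ?thesis unfolding mp_expandable_def
  proof (intro conjI allI impI)
    fix n
    show "integrable lborel (\<lambda>t. of_real (mp_density \<nu> t) * ((f (\<i> * of_real t) +
      g (\<i> * of_real t)) * cnj (mp_poly \<nu> n (\<i> * of_real t))))"
      unfolding distrib_right distrib_left by (rule Bochner_Integration.integrable_add[OF int])
  next
    fix c0 :: real assume c0: "0 \<le> c0" "c0 < c"
    have p: "pochhammer (\<nu> / 2 + c0) n / fact n \<ge> 0" for n
      using nu c0 by (intro divide_nonneg_nonneg pochhammer_nonneg) auto
    have "summable (\<lambda>n. norm (mp_coeff \<nu> f n) * (pochhammer (\<nu> / 2 + c0) n / fact n) +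
      norm (mp_coeff \<nu> g n) * (pochhammer (\<nu> / 2 + c0) n / fact n))"
      using f g c0 by (intro summable_add) (auto simp: mp_expandable_def)
    thus "summable (\<lambda>n. norm (mp_coeff \<nu> (\<lambda>s. f s + g s) n) * (pochhammer (\<nu> / 2 + c0) n / fact n))"
    proof (rule summable_comparison_test'[where N = 0])
      fix n
      show "norm (norm (mp_coeff \<nu> (\<lambda>s. f s + g s) n) * (pochhammer (\<nu> / 2 + c0) n / fact n)) \<le>
        norm (mp_coeff \<nu> f n) * (pochhammer (\<nu> / 2 + c0) n / fact n) +
          norm (mp_coeff \<nu> g n) * (pochhammer (\<nu> / 2 + c0) n / fact n)"
        unfolding coeff real_norm_def abs_mult abs_norm_cancel abs_of_nonneg[OF p] distrib_right[symmetric]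
        by (intro mult_right_mono norm_triangle_ineq p)
    qed
  next
    fix s assume "\<bar>Re s\<bar> < c"
    thus "(\<lambda>n. mp_coeff \<nu> (\<lambda>s. f s + g s) n * mp_poly \<nu> n s) sums (f s + g s)"
      unfolding coeff distrib_right using f g by (intro sums_add) (auto simp: mp_expandable_def)
  qed (rule meas')
qed

text \<open>The bound on f says that f(s) exp(-\<i> \<theta> s) decays at both ends. Expanding the
  exponentials in its Laplace representation gives numbers \<open>B n\<close> whose series sums to
  f; a separate interchange of integrals identifies them with the MP-coefficients.\<close>

lemma mp_expansion_base:
  assumes nu: "\<nu> > 0" and c: "c > 0" and hf: "f holomorphic_on {s. \<bar>Re s\<bar> < c}"
    and th: "\<bar>\<theta>\<bar> < pi / 2" and eps: "\<epsilon> > 0"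
    and bound: "\<And>s. \<bar>Re s\<bar> < c \<Longrightarrow> norm (f s) \<le> K * exp (- \<theta> * Im s - \<epsilon> * \<bar>Im s\<bar>)"
  shows "mp_expandable \<nu> c f"
proof -
  define h where "h s = f s * exp (- (\<i> * of_real \<theta> * s))" for s
  interpret strip_decay h c \<epsilon> K
  proof
    show "h holomorphic_on {s. \<bar>Re s\<bar> < c}" unfolding h_def by (intro holomorphic_intros hf)
    fix s assume s: "\<bar>Re s\<bar> < c"
    have "norm (h s) = norm (f s) * exp (\<theta> * Im s)" by (simp add: h_def norm_mult norm_exp)
    also have "\<dots> \<le> (K * exp (- \<theta> * Im s - \<epsilon> * \<bar>Im s\<bar>)) * exp (\<theta> * Im s)"
      by (intro mult_right_mono bound s) auto
    also have "\<dots> = K * exp (- \<epsilon> * \<bar>Im s\<bar>)" by (simp flip: exp_add)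
    finally show "norm (h s) \<le> K * exp (- \<epsilon> * \<bar>Im s\<bar>)" .
  qed (rule eps)
  define \<phi> where "\<phi> = strip_transform h"
  define \<tau> where "\<tau> t = of_real t - \<i> * of_real \<theta>" for t :: real
  define X where "X t = cosh (\<tau> t / 2) powr (- of_real \<nu>)" for t
  define z where "z t = tanh (\<tau> t / 2)" for t
  \<comment> \<open>The n-th coefficient of exp(-\<tau> s), integrated against the Laplace density
    \<open>\<phi>\<close>.\<close>
  define B where "B n = (LBINT t. \<phi> t * (X t * z t ^ n))" for n
  have Im_tau: "\<bar>Im (\<tau> t)\<bar> < pi / 2" and Re_tau: "Re (\<tau> t) = t" and Im_tau': "Im (\<tau> t) = - \<theta>" for t
    using th by (simp_all add: \<tau>_def)
  have Im_pi: "\<bar>Im (\<tau> t)\<bar> < pi" for t using Im_tau[of t] pi_gt_zero by linarith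
  have m\<phi>: "\<phi> \<in> borel_measurable borel" unfolding \<phi>_def by (rule measurable_strip_transform[OF c])
  have ch: "Re (cosh (\<tau> t / 2)) > 0" for t by (rule Re_cosh_half_pos[OF Im_pi])
  have ch0: "cosh (\<tau> t / 2) \<noteq> 0" for t using ch[of t] by (metis less_irrefl zero_complex.sel(1))
  have nr: "cosh (\<tau> t / 2) \<notin> \<real>\<^sub>\<le>\<^sub>0" for t using ch[of t] by (auto simp: complex_nonpos_Reals_iff)
  have c\<tau>: "continuous_on UNIV \<tau>" unfolding \<tau>_def by (intro continuous_intros)
  have mX: "X \<in> borel_measurable borel"
    unfolding X_def using ch ch0
    by (intro borel_measurable_continuous_onI continuous_intros c\<tau>) (use nr less_imp_le[OF ch] in auto)
  have mz: "z \<in> borel_measurable borel"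
    unfolding z_def using ch0 by (intro borel_measurable_continuous_onI continuous_intros c\<tau>) auto
  have f_eq: "f s = (LBINT t. \<phi> t * exp (- \<tau> t * s))" if s: "\<bar>Re s\<bar> < c" for s
  proof -
    have "(LBINT t. \<phi> t * exp (- \<tau> t * s)) = (LBINT t. \<phi> t * exp (- of_real t * s) * exp (\<i> * of_real \<theta> * s))"
      by (rule lebesgue_integral_cong) (simp add: \<tau>_def algebra_simps flip: exp_add)
    also have "\<dots> = h s * exp (\<i> * of_real \<theta> * s)"
      using strip_inversion[OF s] unfolding \<phi>_def by simp
    also have "\<dots> = f s" by (simp add: h_def flip: exp_add)
    finally show ?thesis ..
  qed
  have weight: "summable (\<lambda>n. pochhammer (\<nu> / 2 + c0) n / fact n * norm (z t) ^ n)"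
      "(\<Sum>n. pochhammer (\<nu> / 2 + c0) n / fact n * norm (z t) ^ n) * norm (X t) \<le>
        (2 / cos \<theta>) powr (\<nu> / 2 + c0) * exp (c0 * \<bar>t\<bar>)"
    if "c0 \<ge> 0" for c0 t
    using tanh_weight_sum[OF nu that Im_tau[of t]] unfolding z_def X_def Re_tau Im_tau' cos_minus by auto
  have Bq: "summable (\<lambda>n. norm (B n) * (pochhammer (\<nu> / 2 + c0) n / fact n))"
       "\<And>s. \<bar>Re s\<bar> \<le> c0 \<Longrightarrow> (\<lambda>n. B n * mp_poly \<nu> n s) sums f s"
    if c0: "0 \<le> c0" "c0 < c" for c0
  proof -
    obtain c' where c': "c0 < c'" "c' < c" using dense[OF c0(2)] by blast
    define p where "p n = pochhammer (\<nu> / 2 + c0) n / fact n" for n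
    have p: "p n \<ge> 0" for n unfolding p_def using nu c0 by (intro divide_nonneg_nonneg pochhammer_nonneg) auto
    define W where "W = (2 / cos \<theta>) powr (\<nu> / 2 + c0)"
    define w where "w t = decay_const * W * exp (- (c' - c0) * \<bar>t\<bar>)" for t
    have w: "integrable lborel w" unfolding w_def using integrable_exp_minus_abs[of "c' - c0"] c' by simp
    \<comment> \<open>With \<open>p n\<close> in place of the polynomial one majorant serves the
      coefficient sum and every s with |Re s| \<le> c0. The gap between c0 and c' makes it
      integrable.\<close>
    have G: "summable (\<lambda>n. norm (\<phi> t * (X t * z t ^ n) * of_real (p n)))"
        "(\<Sum>n. norm (\<phi> t * (X t * z t ^ n) * of_real (p n))) \<le> w t" for t
    proof -
      have eq: "norm (\<phi> t * (X t * z t ^ n) * of_real (p n)) =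
        norm (\<phi> t) * norm (X t) * (p n * norm (z t) ^ n)" for n
        using p by (simp add: norm_mult norm_power mult_ac)
      show "summable (\<lambda>n. norm (\<phi> t * (X t * z t ^ n) * of_real (p n)))"
        unfolding eq unfolding p_def by (intro summable_mult weight(1) c0)
      have "(\<Sum>n. norm (\<phi> t * (X t * z t ^ n) * of_real (p n))) =
        norm (\<phi> t) * norm (X t) * (\<Sum>n. p n * norm (z t) ^ n)"
        unfolding eq unfolding p_def by (rule suminf_mult[OF weight(1)[OF c0(1)]])
      also have "\<dots> = norm (\<phi> t) * ((\<Sum>n. p n * norm (z t) ^ n) * norm (X t))" by (simp only: mult_ac)
      also have "\<dots> \<le> (decay_const * exp (- c' * \<bar>t\<bar>)) * (W * exp (c0 * \<bar>t\<bar>))"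
      proof (rule mult_mono)
        show n1: "norm (\<phi> t) \<le> decay_const * exp (- c' * \<bar>t\<bar>)" unfolding \<phi>_def
          by (rule norm_strip_transform') (use c0 c' in auto)
        show "(\<Sum>n. p n * norm (z t) ^ n) * norm (X t) \<le> W * exp (c0 * \<bar>t\<bar>)"
          using weight(2)[OF c0(1), of t] by (simp add: p_def W_def)
        show "0 \<le> decay_const * exp (- c' * \<bar>t\<bar>)" using n1 norm_ge_zero order_trans by blast
        show "0 \<le> (\<Sum>n. p n * norm (z t) ^ n) * norm (X t)"
          using weight(1)[OF c0(1), of t] p by (intro mult_nonneg_nonneg suminf_nonneg) (auto simp: p_def)
      qed
      also have "\<dots> = w t" unfolding w_def by (simp add: algebra_simps flip: exp_add)
      finally show "(\<Sum>n. norm (\<phi> t * (X t * z t ^ n) * of_real (p n))) \<le> w t" .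
    qed
    have "summable (\<lambda>n. LBINT t. norm (\<phi> t * (X t * z t ^ n) * of_real (p n)))"
      by (rule sums_integral_dominated(2)[OF _ w G]) (use m\<phi> mX mz in measurable)
    hence sm: "summable (\<lambda>n. (LBINT t. norm (\<phi> t * (X t * z t ^ n))) * p n)"
      using p by (simp add: norm_mult flip: abs_mult)
    show "summable (\<lambda>n. norm (B n) * (pochhammer (\<nu> / 2 + c0) n / fact n))"
      unfolding p_def[symmetric]
    proof (rule summable_comparison_test'[OF sm, of 0])
      fix n
      show "norm (norm (B n) * p n) \<le> (LBINT t. norm (\<phi> t * (X t * z t ^ n))) * p n"
        unfolding B_def using p[of n] by (simp add: abs_mult mult_right_mono integral_norm_bound del:
          norm_mult)
    qed
    fix s assume s: "\<bar>Re s\<bar> \<le> c0"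
    obtain C where C: "C \<ge> 0" "\<And>n. norm (mp_poly \<nu> n s) \<le> C * p n"
      using mp_poly_bound[OF nu c0(1), of "\<bar>Im s\<bar>"] s unfolding p_def by (metis order_refl)
    have le: "norm (\<phi> t * (X t * z t ^ n) * mp_poly \<nu> n s) \<le>
      C * norm (\<phi> t * (X t * z t ^ n) * of_real (p n))" for n t
      unfolding norm_mult[of "_ * _" "mp_poly \<nu> n s"] norm_mult[of "_ * _" "of_real (p n)"]
      using mult_left_mono[OF C(2)[of n] norm_ge_zero[of "\<phi> t * (X t * z t ^ n)"]] p[of n]
        by (simp add: mult_ac)
    have "(\<lambda>n. LBINT t. \<phi> t * (X t * z t ^ n) * mp_poly \<nu> n s) sums
      (LBINT t. (\<Sum>n. \<phi> t * (X t * z t ^ n) * mp_poly \<nu> n s))"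
    proof (rule sums_integral_dominated(3)[where w = "\<lambda>t. C * w t"])
      show "(\<lambda>t. \<phi> t * (X t * z t ^ n) * mp_poly \<nu> n s) \<in> borel_measurable lborel" for n
        using m\<phi> mX mz by measurable
      show "integrable lborel (\<lambda>t. C * w t)" using w by simp
      fix t
      show sF: "summable (\<lambda>n. norm (\<phi> t * (X t * z t ^ n) * mp_poly \<nu> n s))"
        by (rule summable_comparison_test'[OF summable_mult[OF G(1)[of t], of C], of 0]) (use le in simp)
      have "(\<Sum>n. norm (\<phi> t * (X t * z t ^ n) * mp_poly \<nu> n s)) \<le>
        (\<Sum>n. C * norm (\<phi> t * (X t * z t ^ n) * of_real (p n)))"
        by (rule suminf_le[OF le sF summable_mult[OF G(1)]])
      also have "\<dots> = C * (\<Sum>n. norm (\<phi> t * (X t * z t ^ n) * of_real (p n)))" by (rule suminf_mult[OF G(1)])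
      also have "\<dots> \<le> C * w t" by (intro mult_left_mono G(2) C(1))
      finally show "(\<Sum>n. norm (\<phi> t * (X t * z t ^ n) * mp_poly \<nu> n s)) \<le> C * w t" .
    qed
    moreover have "(LBINT t. \<phi> t * (X t * z t ^ n) * mp_poly \<nu> n s) = B n * mp_poly \<nu> n s" for n
      unfolding B_def by (rule integral_mult_left_zero)
    moreover have "(LBINT t. (\<Sum>n. \<phi> t * (X t * z t ^ n) * mp_poly \<nu> n s)) = f s"
    proof -
      have "(\<Sum>n. \<phi> t * (X t * z t ^ n) * mp_poly \<nu> n s) = \<phi> t * exp (- \<tau> t * s)" for t
      proof -
        have "(\<lambda>n. (\<phi> t * X t) * (mp_poly \<nu> n s * z t ^ n)) sums
          ((\<phi> t * X t) * (exp (- \<tau> t * s) * cosh (\<tau> t / 2) powr of_real \<nu>))"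
          unfolding z_def by (intro sums_mult mp_poly_sums_tanh[OF nu Im_tau])
        moreover have "X t * cosh (\<tau> t / 2) powr of_real \<nu> = 1"
          unfolding X_def using ch0[of t] by (simp flip: powr_add)
        hence "(\<phi> t * X t) * (exp (- \<tau> t * s) * cosh (\<tau> t / 2) powr of_real \<nu>) = \<phi> t * exp (- \<tau> t * s)"
          by (metis (no_types, lifting) mult.assoc mult.commute mult.right_neutral)
        ultimately show ?thesis by (simp add: sums_iff mult_ac)
      qed
      thus ?thesis using f_eq[of s] s c0 by simp
    qed
    ultimately show "(\<lambda>n. B n * mp_poly \<nu> n s) sums f s" by (simp only:)
  qed
  define F where "F n u t = (of_real (mp_density \<nu> u) * cnj (mp_poly \<nu> n (\<i> * of_real u))) * (\<phi> t *
    exp (- \<tau> t * (\<i> * of_real u)))" for n and u t :: real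
  have Fint: "integrable (lborel \<Otimes>\<^sub>M lborel) (\<lambda>(u, t). F n u t)" for n
  proof -
    \<comment> \<open>The rate 1 is admissible because 1 + |\<theta>| < 1 + \<pi>/2 < \<pi>.\<close>
    obtain C where C: "C \<ge> 0" "\<And>u::real. norm (mp_poly \<nu> n (\<i> * of_real u)) \<le> C * exp (1 * \<bar>u\<bar>)"
      using mp_poly_exp_bound[OF nu, of 1 n] by auto
    obtain x where x: "0 < x" "x < c" using dense[OF c] by blast
    show ?thesis
    proof (rule integrable_lborel_pair_bound)
      show "(\<lambda>(u, t). F n u t) \<in> borel_measurable (lborel \<Otimes>\<^sub>M lborel)"

      proof -
        have [measurable]: "mp_density \<nu> \<in> borel_measurable borel"
          "(\<lambda>t::real. cnj (mp_poly \<nu> n (\<i> * of_real t))) \<in> borel_measurable borel"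
          by (rule mp_density_measurable[OF nu], rule cnj_mp_poly_measurable[OF nu])
        show ?thesis unfolding F_def \<tau>_def using m\<phi> by measurable
      qed
      show "integrable lborel (\<lambda>u. C * (mp_density \<nu> u * exp ((1 + \<bar>\<theta>\<bar>) * \<bar>u\<bar>)))"
        by (intro integrable_mult_right integrable_mp_density_exp[OF nu]) (use th pi_gt3 in auto)
      show "integrable lborel (\<lambda>t. decay_const * exp (- x * \<bar>t\<bar>))"
        using integrable_exp_minus_abs[OF x(1)] by simp
      fix u t
      have "Im (\<tau> t) * u \<le> \<bar>\<theta>\<bar> * \<bar>u\<bar>" using abs_ge_self[of "Im (\<tau> t) * u"] unfolding Im_tau'
        by (simp add: abs_mult)
      hence *: "norm (F n u t) \<le> (mp_density \<nu> u * (C * exp (1 * \<bar>u\<bar>))) * ((decay_const * exp (- x *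
        \<bar>t\<bar>)) * exp (\<bar>\<theta>\<bar> * \<bar>u\<bar>))"
        unfolding F_def norm_mult norm_exp_i complex_mod_cnj norm_of_real abs_of_nonneg[OF
          mp_density_nonneg[OF nu]]
        using norm_strip_transform'[of x t] x C mp_density_nonneg[OF nu] order_trans[OF norm_ge_zero
          norm_strip_transform'[of x t]]
        by (intro mult_mono) (auto simp: \<phi>_def)
      show "norm (F n u t) \<le> (C * (mp_density \<nu> u * exp ((1 + \<bar>\<theta>\<bar>) * \<bar>u\<bar>))) * (decay_const * exp (- x * \<bar>t\<bar>))"
      proof -
        have "exp ((1 + \<bar>\<theta>\<bar>) * \<bar>u\<bar>) = exp (1 * \<bar>u\<bar>) * exp (\<bar>\<theta>\<bar> * \<bar>u\<bar>)"
          by (simp add: distrib_right exp_add)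
        thus ?thesis using * by (simp only: mult_ac)
      qed
    qed
  qed
  have inner: "(LBINT t. F n u t) = of_real (mp_density \<nu> u) * (f (\<i> * of_real u) * cnj (mp_poly \<nu> n (\<i> *
    of_real u)))" for n and u :: real
  proof -
    have "(LBINT t. F n u t) = (of_real (mp_density \<nu> u) * cnj (mp_poly \<nu> n (\<i> * of_real u))) *
      (LBINT t. \<phi> t * exp (- \<tau> t * (\<i> * of_real u)))"
      unfolding F_def by (rule integral_mult_right_zero)
    thus ?thesis using f_eq[of "\<i> * of_real u"] c by simp
  qed
  \<comment> \<open>This integrand is the inner integral of \<open>F\<close>, so its integrability
    is part of Fubini's theorem.\<close>
  have fint: "integrable lborel (\<lambda>u. of_real (mp_density \<nu> u) * (f (\<i> * of_real u) *
    cnj (mp_poly \<nu> n (\<i> * of_real u))))" for n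
    using lborel_pair.integrable_fst[OF Fint[of n]] unfolding inner .
  have fm: "(\<lambda>t::real. f (\<i> * of_real t)) \<in> borel_measurable borel"
  proof (rule borel_measurable_continuous_onI)
    have "continuous_on UNIV (\<lambda>t::real. \<i> * of_real t)" by (intro continuous_intros)
    hence "continuous_on UNIV (f \<circ> (\<lambda>t::real. \<i> * of_real t))"
      using c by (intro continuous_on_compose continuous_on_subset[OF holomorphic_on_imp_continuous_on[OF
        hf]]) auto
    thus "continuous_on UNIV (\<lambda>t::real. f (\<i> * of_real t))" by (simp add: o_def)
  qed
  have coeff: "mp_coeff \<nu> f n = B n" for n
  proof -
    have "(LBINT u. of_real (mp_density \<nu> u) * (f (\<i> * of_real u) * cnj (mp_poly \<nu> n (\<i> * of_real u)))) =
      (LBINT u. LBINT t. F n u t)"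
      unfolding inner ..
    also have "\<dots> = (LBINT t. LBINT u. F n u t)" by (rule lborel_pair.Fubini_integral[OF Fint, symmetric])
    also have "\<dots> = (LBINT t. of_real (pochhammer \<nu> n / fact n) * (\<phi> t * (X t * z t ^ n)))"
    proof (rule lebesgue_integral_cong)
      fix t
      have "(LBINT u. F n u t) = (LBINT u. \<phi> t * (of_real (mp_density \<nu> u) * (exp (- \<tau> t * (\<i> *
        of_real u)) * cnj (mp_poly \<nu> n (\<i> * of_real u)))))"
        unfolding F_def by (simp only: mult_ac)
      also have "\<dots> = \<phi> t * (X t * (of_real (pochhammer \<nu> n / fact n) * z t ^ n))"
        unfolding X_def z_def mp_density_exp_poly_integral[OF nu Im_tau, symmetric]
          by (rule integral_mult_right_zero)
      finally show "(LBINT u. F n u t) = of_real (pochhammer \<nu> n / fact n) * (\<phi> t * (X t * z t ^ n))"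
        by (simp only: mult_ac)
    qed
    also have "\<dots> = of_real (pochhammer \<nu> n / fact n) * B n" unfolding B_def by (rule integral_mult_right_zero)
    finally have "mp_coeff \<nu> f n = of_real (fact n / pochhammer \<nu> n * (pochhammer \<nu> n / fact n)) * B n"
      unfolding mp_coeff_lborel[OF nu fm] by simp
    thus ?thesis using pochhammer_pos[OF nu, of n] by simp
  qed
  show ?thesis unfolding mp_expandable_def coeff
  proof (intro conjI allI impI fm fint Bq(1))
    fix s assume "\<bar>Re s\<bar> < c"
    thus "(\<lambda>n. B n * mp_poly \<nu> n s) sums f s" by (intro Bq(2)[of "\<bar>Re s\<bar>"]) auto
  qed
qed

text \<open>
  If \<open>a\<close> and \<open>b\<close> are the exponential growth rates in the upper and lower half of the strip, then
  \<open>a + b < 0\<close> allows a choice of \<open>\<theta>\<close> with \<open>b < \<theta> < - a\<close>. Otherwise \<open>f = f p + f q\<close> with logistic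
  functions \<open>p + q = 1\<close>, each of which lowers one of the two rates by \<open>\<kappa>\<close>; the poles of \<open>p\<close> and \<open>q\<close>
  stay outside the strip because \<open>\<kappa> c = \<pi>/2\<close>.
\<close>

lemma mp_expansion_split:
  assumes nu: "\<nu> > 0" and c: "c > 0" and r: "r < pi / 2"
    and "f holomorphic_on {s. \<bar>Re s\<bar> < c}" and "a \<le> r" and "b \<le> r"
    and "a + b < real k * (pi / (2 * c))"
    and "\<And>s. \<bar>Re s\<bar> < c \<Longrightarrow> Im s \<ge> 0 \<Longrightarrow> norm (f s) \<le> K * exp (a * Im s)"
    and "\<And>s. \<bar>Re s\<bar> < c \<Longrightarrow> Im s \<le> 0 \<Longrightarrow> norm (f s) \<le> K * exp (- b * Im s)"
  shows "mp_expandable \<nu> c f"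
  using assms(4-)
proof (induction k arbitrary: f a b)
  case 0
  have ab: "a + b < 0" using "0.prems"(4) by simp
  have "max b (- (pi / 2)) < min (- a) (pi / 2)"
    unfolding max_less_iff_conj min_less_iff_conj
    using ab "0.prems"(2,3) r pi_gt_zero by (intro conjI) linarith+
  then obtain \<theta> where "max b (- (pi / 2)) < \<theta>" "\<theta> < min (- a) (pi / 2)" using dense by blast
  hence th: "b < \<theta>" "\<theta> < - a" "\<bar>\<theta>\<bar> < pi / 2" by auto
  define \<epsilon> where "\<epsilon> = min (- a - \<theta>) (\<theta> - b)"
  have K: "K \<ge> 0" using order_trans[OF norm_ge_zero "0.prems"(5)[of 0]] c by simp
  show ?case
  proof (rule mp_expansion_base[OF nu c "0.prems"(1) th(3)])
    show "\<epsilon> > 0" using th by (simp add: \<epsilon>_def)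
    fix s assume s: "\<bar>Re s\<bar> < c"
    show "norm (f s) \<le> K * exp (- \<theta> * Im s - \<epsilon> * \<bar>Im s\<bar>)"
    proof (cases "Im s \<ge> 0")
      case True
      have "a * Im s \<le> (- \<theta> - \<epsilon>) * Im s" using True by (intro mult_right_mono) (auto simp: \<epsilon>_def)
      hence "a * Im s \<le> - \<theta> * Im s - \<epsilon> * \<bar>Im s\<bar>" using True by (simp add: left_diff_distrib)
      hence "K * exp (a * Im s) \<le> K * exp (- \<theta> * Im s - \<epsilon> * \<bar>Im s\<bar>)" using K by (intro mult_left_mono) auto
      thus ?thesis using "0.prems"(5)[OF s True] by linarith
    next
      case False
      have "b * (- Im s) \<le> (\<theta> - \<epsilon>) * (- Im s)" using False by (intro mult_right_mono) (auto simp: \<epsilon>_def)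
      hence "- b * Im s \<le> - \<theta> * Im s - \<epsilon> * \<bar>Im s\<bar>" using False by (simp add: algebra_simps)
      hence "K * exp (- b * Im s) \<le> K * exp (- \<theta> * Im s - \<epsilon> * \<bar>Im s\<bar>)" using K by (intro mult_left_mono) auto
      thus ?thesis using "0.prems"(6)[OF s] False by force
    qed
  qed
next
  case (Suc k)
  define \<kappa> where "\<kappa> = pi / (2 * c)"
  have \<kappa>: "\<kappa> > 0" using c by (simp add: \<kappa>_def)
  define e where "e s = exp (\<i> * of_real \<kappa> * s)" for s
  define p where "p s = 1 / (1 + 1 / e s)" for s
  define q where "q s = 1 / (1 + e s)" for s
  have ne: "norm (e s) = exp (- \<kappa> * Im s)" for s by (simp add: e_def norm_exp)
  have e0: "e s \<noteq> 0" for s by (simp add: e_def)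
  \<comment> \<open>Applied to w = e(s) and w = 1/e(s): 1/(1 + w) is bounded by 1 and by 1/|w|,
    which gives both estimates for each of \<open>p\<close> and \<open>q\<close>.\<close>
  have min1: "1 \<le> norm (1 + w)" "norm w \<le> norm (1 + w)" if "Re w \<ge> 0" for w :: complex
  proof -
    show "1 \<le> norm (1 + w)" using complex_Re_le_cmod[of "1 + w"] that by simp
    have "(norm w)\<^sup>2 \<le> (norm (1 + w))\<^sup>2" unfolding cmod_power2 using that
      by (simp add: power2_eq_square algebra_simps)
    thus "norm w \<le> norm (1 + w)" by (rule power2_le_imp_le) simp
  qed
  have Re_e: "Re (e s) \<ge> 0" "Re (1 / e s) \<ge> 0" if "\<bar>Re s\<bar> < c" for s
  proof -
    have "\<bar>\<kappa> * Re s\<bar> \<le> \<kappa> * c" using that \<kappa> by (simp add: abs_mult)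
    also have "\<dots> = pi / 2" using c by (simp add: \<kappa>_def)
    finally have "cos (\<kappa> * Re s) \<ge> 0" by (intro cos_ge_zero) auto
    thus 1: "Re (e s) \<ge> 0" by (simp add: e_def Re_exp)
    thus "Re (1 / e s) \<ge> 0" by (simp add: Re_divide)
  qed
  have p: "norm (p s) \<le> 1" "norm (p s) \<le> exp (- \<kappa> * Im s)" "1 + 1 / e s \<noteq> 0"
    and q: "norm (q s) \<le> 1" "norm (q s) \<le> exp (\<kappa> * Im s)" "1 + e s \<noteq> 0"
    if "\<bar>Re s\<bar> < c" for s
  proof -
    note A = min1[OF Re_e(1)[OF that]] and B = min1[OF Re_e(2)[OF that]]
    show "1 + 1 / e s \<noteq> 0" "1 + e s \<noteq> 0" using A(1) B(1) by auto
    show "norm (p s) \<le> 1" unfolding p_def norm_divide norm_one using B by (simp add: divide_le_eq_1)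
    show "norm (q s) \<le> 1" unfolding q_def norm_divide norm_one using A by (simp add: divide_le_eq_1)
    have "norm (p s) \<le> 1 / norm (1 / e s)" unfolding p_def norm_divide[of 1 "1 + _"] norm_one
      using B e0 by (intro divide_left_mono) (auto intro!: mult_pos_pos)
    thus "norm (p s) \<le> exp (- \<kappa> * Im s)" by (simp add: norm_divide ne)
    have "norm (q s) \<le> 1 / norm (e s)" unfolding q_def norm_divide[of 1 "1 + _"] norm_one
      using A e0 by (intro divide_left_mono) (auto intro!: mult_pos_pos)
    thus "norm (q s) \<le> exp (\<kappa> * Im s)" by (simp add: ne exp_minus divide_inverse)
  qed
  have holo_pq: "p holomorphic_on {s. \<bar>Re s\<bar> < c}" "q holomorphic_on {s. \<bar>Re s\<bar> < c}"
    unfolding p_def q_def using p(3) q(3) e0 unfolding e_def by (auto intro!: holomorphic_intros)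
  have prod: "norm (f s * w) \<le> K * exp (x + y)"
    if "norm (f s) \<le> K * exp x" "norm w \<le> exp y" for s w x y
  proof -
    have "norm (f s * w) \<le> (K * exp x) * exp y"
      unfolding norm_mult using that by (intro mult_mono) (auto intro: order_trans[OF norm_ge_zero])
    thus ?thesis by (simp add: exp_add mult.assoc)
  qed
  \<comment> \<open>Each factor lowers a + b by \<kappa> = \<pi>/(2c), the unit in which the
    induction counts.\<close>
  have IH: "a - \<kappa> + b < real k * (pi / (2 * c))" "a + (b - \<kappa>) < real k * (pi / (2 * c))"
    using Suc.prems(4) unfolding \<kappa>_def of_nat_Suc distrib_right mult_1_left by linarith+
  have 1: "mp_expandable \<nu> c (\<lambda>s. f s * p s)"
  proof (rule Suc.IH[OF _ _ _ IH(1)])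
    show "(\<lambda>s. f s * p s) holomorphic_on {s. \<bar>Re s\<bar> < c}" by (intro holomorphic_intros Suc.prems holo_pq)
    fix s assume s: "\<bar>Re s\<bar> < c"
    show "norm (f s * p s) \<le> K * exp ((a - \<kappa>) * Im s)" if "Im s \<ge> 0"
      using prod[OF Suc.prems(5)[OF s that] p(2)[OF s]] by (simp add: algebra_simps)
    show "norm (f s * p s) \<le> K * exp (- b * Im s)" if "Im s \<le> 0"
      using prod[OF Suc.prems(6)[OF s that], of "p s" 0] p(1)[OF s] by simp
  qed (use Suc.prems \<kappa> in auto)
  have 2: "mp_expandable \<nu> c (\<lambda>s. f s * q s)"
  proof (rule Suc.IH[OF _ _ _ IH(2)])
    show "(\<lambda>s. f s * q s) holomorphic_on {s. \<bar>Re s\<bar> < c}" by (intro holomorphic_intros Suc.prems holo_pq)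
    fix s assume s: "\<bar>Re s\<bar> < c"
    show "norm (f s * q s) \<le> K * exp (a * Im s)" if "Im s \<ge> 0"
      using prod[OF Suc.prems(5)[OF s that], of "q s" 0] q(1)[OF s] by simp
    show "norm (f s * q s) \<le> K * exp (- (b - \<kappa>) * Im s)" if "Im s \<le> 0"
      using prod[OF Suc.prems(6)[OF s that] q(2)[OF s]] by (simp add: algebra_simps)
  qed (use Suc.prems \<kappa> in auto)
  have 3: "mp_expandable \<nu> c (\<lambda>s. f s * p s + f s * q s)" by (rule mp_expandable_add[OF nu 1 2])
  have eq: "f s * p s + f s * q s = f s" if s: "\<bar>Re s\<bar> < c" for s
  proof -
    have "1 + 1 / e s = (1 + e s) / e s" using e0 by (simp add: field_simps)
    hence "p s + q s = 1" unfolding p_def q_def using q(3)[OF s] e0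
      by (simp add: add_divide_distrib [symmetric] add.commute)
    thus ?thesis by (simp flip: distrib_left)
  qed
  \<comment> \<open>Off the strip the denominators may vanish and the decomposition may fail. The
    coefficients see only the imaginary axis, where it holds.\<close>
  have it: "f (\<i> * of_real t) * p (\<i> * of_real t) + f (\<i> * of_real t) * q (\<i> * of_real t) =
    f (\<i> * of_real t)" for t :: real
    using c by (intro eq) simp
  have "mp_coeff \<nu> (\<lambda>s. f s * p s + f s * q s) n = mp_coeff \<nu> f n" for n
    unfolding mp_coeff_def it ..
  with 3 show ?case unfolding mp_expandable_def it by (simp add: eq)
qed

lemma mp_expansion:
  assumes nu: "\<nu> > 0" and c: "c > 0" and holo: "f holomorphic_on {s. \<bar>Re s\<bar> < c}" and r: "r < pi / 2"
    and bound: "\<And>s. \<bar>Re s\<bar> < c \<Longrightarrow> norm (f s) \<le> K * exp (r * \<bar>Im s\<bar>)"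
  shows "mp_expandable \<nu> c f"
proof -
  have "pi / (2 * c) > 0" using c by simp
  then obtain k where k: "r + r < real k * (pi / (2 * c))" using reals_Archimedean3 by blast
  show ?thesis
  proof (rule mp_expansion_split[OF nu c r holo order_refl order_refl k])
    show "norm (f s) \<le> K * exp (r * Im s)" if "\<bar>Re s\<bar> < c" "Im s \<ge> 0" for s
      using bound[OF that(1)] that(2) by simp
    show "norm (f s) \<le> K * exp (- r * Im s)" if "\<bar>Re s\<bar> < c" "Im s \<le> 0" for s
      using bound[OF that(1)] that(2) by simp
  qed
qed

text \<open>The weight (\<nu>/2 + c0)_n/n! is at once the growth of the polynomials on the rectangle
  and the weight for which the coefficients are summable, so the M-test applies.\<close>

lemma mp_expandable_uniform_limit:
  assumes nu: "\<nu> > 0" and f: "mp_expandable \<nu> c f" and c0: "0 \<le> c0" "c0 < c"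
  shows "uniform_limit {s. \<bar>Re s\<bar> \<le> c0 \<and> \<bar>Im s\<bar> \<le>
    T} (\<lambda>n s. \<Sum>k\<le>n. mp_coeff \<nu> f k * mp_poly \<nu> k s) f sequentially"
proof -
  define p where "p n = pochhammer (\<nu> / 2 + c0) n / fact n" for n
  obtain C where C: "C \<ge> 0" "\<And>n s. \<bar>Re s\<bar> \<le> c0 \<Longrightarrow> \<bar>Im s\<bar> \<le> T \<Longrightarrow> norm (mp_poly \<nu> n s) \<le> C * p n"
    using mp_poly_bound[OF nu c0(1), of T] unfolding p_def by metis
  have sm: "summable (\<lambda>n. C * (norm (mp_coeff \<nu> f n) * p n))"
    using f c0 unfolding mp_expandable_def p_def by (intro summable_mult) auto
  have "uniform_limit {s. \<bar>Re s\<bar> \<le> c0 \<and> \<bar>Im s\<bar> \<le> T} (\<lambda>n s. \<Sum>k<n. mp_coeff \<nu> f k * mp_poly \<nu> k s)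
     (\<lambda>s. \<Sum>k. mp_coeff \<nu> f k * mp_poly \<nu> k s) sequentially"
  proof (rule Weierstrass_m_test[OF _ sm])
    fix n s assume "s \<in> {s. \<bar>Re s\<bar> \<le> c0 \<and> \<bar>Im s\<bar> \<le> T}"
    hence "norm (mp_poly \<nu> n s) \<le> C * p n" using C(2) by auto
    from mult_left_mono[OF this norm_ge_zero[of "mp_coeff \<nu> f n"]]
    show "norm (mp_coeff \<nu> f n * mp_poly \<nu> n s) \<le> C * (norm (mp_coeff \<nu> f n) * p n)"
      by (simp add: norm_mult mult_ac)
  qed
  also have "?this \<longleftrightarrow> uniform_limit {s. \<bar>Re s\<bar> \<le> c0 \<and> \<bar>Im s\<bar> \<le>
    T} (\<lambda>n s. \<Sum>k<n. mp_coeff \<nu> f k * mp_poly \<nu> k s) f sequentially"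
    by (intro uniform_limit_cong') (use f c0 in \<open>auto simp: mp_expandable_def sums_iff\<close>)
  \<comment> \<open>The M-test gives sums over k < n, while partial sums include k = n.\<close>
  finally have "uniform_limit {s. \<bar>Re s\<bar> \<le> c0 \<and> \<bar>Im s\<bar> \<le>
    T} (\<lambda>n s. \<Sum>k<Suc n. mp_coeff \<nu> f k * mp_poly \<nu> k s) f sequentially"
    by (rule filterlim_compose[OF _ filterlim_Suc])
  thus ?thesis by (simp only: lessThan_Suc_atMost)
qed

subsection \<open>Zeros of the partial sums\<close>

text \<open>Without a zero in the disc the maximum principle would apply to 1/S_n. But |S_n| \<ge>
  \<eta> on the circle and |S_n| < \<eta> at the centre, where \<eta> is half the minimum of |g| on
  the circle.\<close>

lemma Hurwitz_existence:
  fixes g :: "complex \<Rightarrow> complex" and S :: "nat \<Rightarrow> complex \<Rightarrow> complex"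
  assumes e: "e > 0" and holo: "\<And>n. S n holomorphic_on cball \<rho> e" and cont: "continuous_on (cball \<rho> e) g"
    and lim: "uniform_limit (cball \<rho> e) S g sequentially"
    and g0: "g \<rho> = 0" and gnz: "\<And>z. z \<in> sphere \<rho> e \<Longrightarrow> g z \<noteq> 0"
  shows "\<forall>\<^sub>F n in sequentially. \<exists>z\<in>cball \<rho> e. S n z = 0"
proof -
  have "compact (sphere \<rho> e)" "sphere \<rho> e \<noteq> {}" using e by auto
  moreover have "continuous_on (sphere \<rho> e) (\<lambda>z. norm (g z))"
    using continuous_on_subset[OF cont] e by (intro continuous_on_norm) auto
  ultimately obtain z0 where z0: "z0 \<in> sphere \<rho> e" "\<And>z. z \<in> sphere \<rho> e \<Longrightarrow> norm (g z0) \<le> norm (g z)"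
    using continuous_attains_inf by metis
  define \<eta> where "\<eta> = norm (g z0) / 2"
  have \<eta>: "\<eta> > 0" using gnz[OF z0(1)] by (simp add: \<eta>_def)
  from uniform_limitD[OF lim \<eta>] show ?thesis
  proof eventually_elim
    case (elim n)
    hence close: "norm (S n z - g z) < \<eta>" if "z \<in> cball \<rho> e" for z using that by (simp add: dist_norm)
    show ?case
    proof (rule ccontr)
      assume "\<not> ?case"
      hence nz: "S n z \<noteq> 0" if "z \<in> cball \<rho> e" for z using that by auto
      have h: "(\<lambda>z. 1 / S n z) holomorphic_on cball \<rho> e" by (intro holomorphic_intros holo) (use nz in auto)
      have "norm (1 / S n \<rho>) \<le> 1 / \<eta>"
      proof (rule maximum_modulus_frontier[where S = "ball \<rho> e" and f = "\<lambda>z. 1 / S n z" and \<xi> = \<rho>])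
        show "(\<lambda>z. 1 / S n z) holomorphic_on interior (ball \<rho> e)"
          by (rule holomorphic_on_subset[OF h]) auto
        show "continuous_on (closure (ball \<rho> e)) (\<lambda>z. 1 / S n z)"
          using holomorphic_on_imp_continuous_on[OF h] e by simp
        fix z assume "z \<in> frontier (ball \<rho> e)"
        hence z: "z \<in> sphere \<rho> e" using e by simp
        have "2 * \<eta> \<le> norm (g z)" using z0(2)[OF z] by (simp add: \<eta>_def)
        moreover have "norm (S n z - g z) < \<eta>" using z by (intro close) auto
        ultimately have "\<eta> \<le> norm (S n z)" using norm_triangle_ineq3[of "S n z" "g z"] by linarith
        thus "norm (1 / S n z) \<le> 1 / \<eta>" using \<eta> by (simp add: norm_divide frac_le)
      qed (use e in auto)
      moreover have "norm (S n \<rho>) < \<eta>" using close[of \<rho>] e g0 by simp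
      moreover have "S n \<rho> \<noteq> 0" using nz e by simp
      ultimately show False using \<eta> by (simp add: norm_divide field_simps)
    qed
  qed
qed

text \<open>Put L = |g'(\<rho>)|. Near \<rho> the derivative of S_n(z) - g'(\<rho>) z is at most
  3L/4: L/2 from the continuity of g' and L/4 from S_n - g. A perturbation with Lipschitz constant
  below L keeps z \<mapsto> g'(\<rho>) z injective, on a disc that does not depend on n.\<close>

lemma Hurwitz_uniqueness:
  fixes g :: "complex \<Rightarrow> complex" and S :: "nat \<Rightarrow> complex \<Rightarrow> complex"
  assumes e: "e > 0" and holo: "\<And>n. S n holomorphic_on ball \<rho> e" and hg: "g holomorphic_on ball \<rho> e"
    and lim: "uniform_limit (ball \<rho> e) S g sequentially" and d: "deriv g \<rho> \<noteq> 0"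
  obtains e' where "e' > 0" "\<forall>\<^sub>F n in sequentially. inj_on (S n) (ball \<rho> e')"
proof -
  define L where "L = norm (deriv g \<rho>)"
  have L: "L > 0" using d by (simp add: L_def)
  have "isCont (deriv g) \<rho>"
  proof -
    have "continuous_on (ball \<rho> e) (deriv g)"
      by (intro holomorphic_on_imp_continuous_on holomorphic_deriv hg open_ball)
    thus ?thesis using e by (simp add: continuous_on_eq_continuous_at)
  qed
  then obtain e1 where e1: "e1 > 0" "\<And>z. dist z \<rho> < e1 \<Longrightarrow> dist (deriv g z) (deriv g \<rho>) < L / 2"
    using half_gt_zero[OF L] unfolding continuous_at_eps_delta by blast
  define e' where "e' = min e1 (e / 2)"
  have e': "e' > 0" using e e1 by (simp add: e'_def)
  have "\<forall>\<^sub>F n in sequentially. \<forall>x\<in>ball \<rho> e. dist (S n x) (g x) < L * e / 16"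
    by (rule uniform_limitD[OF lim]) (use L e in simp)
  hence "\<forall>\<^sub>F n in sequentially. inj_on (S n) (ball \<rho> e')"
  proof eventually_elim
    case (elim n)
    have der: "norm (deriv (S n) z - deriv g \<rho>) \<le> 3 / 4 * L" if z: "z \<in> ball \<rho> e'" for z
    proof -
      have ze: "dist \<rho> z < e / 2" "z \<in> ball \<rho> e" using z e by (auto simp: e'_def)
      have sub: "cball z (e / 4) \<subseteq> ball \<rho> e"
      proof
        fix w assume "w \<in> cball z (e / 4)"
        thus "w \<in> ball \<rho> e" using ze e dist_triangle[of \<rho> w z] by (simp add: dist_commute)
      qed
      have h: "(\<lambda>w. S n w - g w) holomorphic_on ball \<rho> e" by (intro holomorphic_intros holo hg)
      \<comment> \<open>The tolerance L e/16 was chosen so that Cauchy's inequality on a circle of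
        radius e/4 gives L/4.\<close>
      have "norm ((deriv ^^ 1) (\<lambda>w. S n w - g w) z) \<le> fact 1 * (L * e / 16) / (e / 4) ^ 1"
      proof (rule Cauchy_inequality)
        show "(\<lambda>w. S n w - g w) holomorphic_on ball z (e / 4)"
          using sub by (intro holomorphic_on_subset[OF h]) auto
        show "continuous_on (cball z (e / 4)) (\<lambda>w. S n w - g w)"
          by (rule holomorphic_on_imp_continuous_on[OF holomorphic_on_subset[OF h sub]])
        fix x assume "norm (z - x) = e / 4"
        hence "x \<in> ball \<rho> e" using sub by (auto simp: dist_norm)
        thus "norm (S n x - g x) \<le> L * e / 16" using elim by (simp add: dist_norm less_imp_le)
      qed (use e in auto)
      also have "\<dots> = L / 4" using e by simp
      finally have "norm (deriv (\<lambda>w. S n w - g w) z) \<le> L / 4" by simp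
      moreover have "deriv (\<lambda>w. S n w - g w) z = deriv (S n) z - deriv g z"
        by (intro deriv_diff holomorphic_on_imp_differentiable_at[OF holo open_ball ze(2)]
            holomorphic_on_imp_differentiable_at[OF hg open_ball ze(2)])
      moreover have "norm (deriv g z - deriv g \<rho>) < L / 2" using e1(2)[of z] z
        by (simp add: e'_def dist_norm norm_minus_commute)
      ultimately show ?thesis using norm_triangle_ineq[of "deriv (S n) z - deriv g z"
        "deriv g z - deriv g \<rho>"] by simp
    qed
    show ?case
    proof (rule inj_onI)
      fix x y assume xy: "x \<in> ball \<rho> e'" "y \<in> ball \<rho> e'" "S n x = S n y"
      have "norm ((S n x - deriv g \<rho> * x) - (S n y - deriv g \<rho> * y)) \<le> 3 / 4 * L * norm (x - y)"
      proof (rule field_differentiable_bound[where S = "ball \<rho> e'" and f' = "\<lambda>z. deriv (S n) z - deriv g \<rho>"])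
        fix z assume z: "z \<in> ball \<rho> e'"
        have "(S n has_field_derivative deriv (S n) z) (at z)"
          by (rule holomorphic_derivI[OF holo]) (use z e in \<open>auto simp: e'_def\<close>)
        hence "((\<lambda>z. S n z - deriv g \<rho> * z) has_field_derivative deriv (S n) z - deriv g \<rho>) (at z)"
          by (auto intro!: derivative_eq_intros)
        thus "((\<lambda>z. S n z - deriv g \<rho> * z) has_field_derivative deriv (S n) z - deriv g \<rho>) (at z within
          ball \<rho> e')"
          by (rule has_field_derivative_at_within)
      qed (use xy der in auto)
      moreover have "(S n x - deriv g \<rho> * x) - (S n y - deriv g \<rho> * y) = - deriv g \<rho> * (x - y)"
        using xy(3) by (simp add: algebra_simps)
      ultimately have "L * norm (x - y) \<le> 3 / 4 * L * norm (x - y)" by (simp add: norm_mult L_def)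
      hence "L * norm (x - y) \<le> 0" by linarith
      thus "x = y" using L by (simp add: mult_le_0_iff)
    qed
  qed
  thus ?thesis using that e' by blast
qed

text \<open>The bound \<open>\<epsilon>0\<close> is the least of three radii: of a disc inside the
  strip of uniform convergence, of a disc in which \<rho> is the only zero, and, for a simple zero,
  of a disc on which the late partial sums are injective.\<close>

theorem proposition4p1:
  fixes \<nu> \<alpha> \<beta> \<delta> r :: real and s_minus s_plus :: complex
    and f :: "complex \<Rightarrow> complex" and D E :: "complex set"
  defines "D \<equiv> {s. Re s \<in> {\<alpha> - \<delta><..<\<beta> + \<delta>}}"
  defines "E \<equiv> {t. \<bar>Im t\<bar> < min \<bar>Re s_plus\<bar> \<bar>Re s_minus\<bar>}"
  assumes "\<nu> > 0" and "\<delta> > 0"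
    and "\<alpha> + 2 < Re s_minus" and "Re s_minus < 0" and "0 < Re s_plus" and "Re s_plus < \<beta> - 2"
    and "f nicely_meromorphic_on D"
    and "r < pi / 2"
    and "f \<in> O[inf at_infinity (principal D)](\<lambda>s. of_real (exp (r * norm s)))"
    and "card {s \<in> D. is_pole f s} \<in> {1, 2}"
    and "{s \<in> D. is_pole f s} \<subseteq> {s_minus, s_plus}"
    and "\<forall>s\<in>D. is_pole f s \<longrightarrow> zorder f s = -1"
  shows "\<forall>\<rho>\<in>E. f (\<i> * \<rho>) = 0 \<longrightarrow>
    (\<exists>\<epsilon>0>0. \<forall>\<epsilon>::real. 0 < \<epsilon> \<and> \<epsilon> < \<epsilon>0 \<longrightarrow>
      (\<exists>N::nat. \<forall>n\<ge>N.
         (\<exists>\<rho>n. \<rho>n \<in> mp_zeros \<nu> f n \<and> norm (\<rho>n - \<rho>) < \<epsilon>) \<and>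
         (zorder f (\<i> * \<rho>) = 1 \<longrightarrow>
            (\<exists>!\<rho>n. \<rho>n \<in> mp_zeros \<nu> f n \<and> norm (\<rho>n - \<rho>) < \<epsilon>))))"
proof (intro ballI impI)
  fix \<rho> assume rho: "\<rho> \<in> E" and f0: "f (\<i> * \<rho>) = 0"
  have nu: "\<nu> > 0" by fact
  define m where "m = min \<bar>Re s_plus\<bar> \<bar>Re s_minus\<bar>"
  have "\<bar>Im \<rho>\<bar> < m" using rho by (simp add: E_def m_def)
  \<comment> \<open>With s = \<i> t, |Im t| becomes |Re s|. Staying below m keeps f holomorphic on
    the closed strip |Re s| \<le> c, as the compactness argument for the growth bound
    requires.\<close>
  then obtain c where c: "\<bar>Im \<rho>\<bar> < c" "c < m" using dense by blast
  hence c0: "c > 0" by linarith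
  define P where "P = {s \<in> D. is_pole f s}"
  have "card P > 0" using \<open>card {s \<in> D. is_pole f s} \<in> {1, 2}\<close> by (auto simp: P_def)
  hence P: "finite P" "P \<noteq> {}" by (simp_all add: card_gt_0_iff)
  have Pm: "m \<le> \<bar>Re s\<bar>" if "s \<in> P" for s
  proof -
    have "s \<in> {s_minus, s_plus}" using that \<open>{s \<in> D. is_pole f s} \<subseteq> {s_minus, s_plus}\<close> unfolding P_def
      by blast
    thus ?thesis by (auto simp: m_def)
  qed
  have strip: "s \<in> D - P" if "\<bar>Re s\<bar> < m" for s
  proof -
    have "m \<le> - Re s_minus" "m \<le> Re s_plus"
      using \<open>Re s_minus < 0\<close> \<open>0 < Re s_plus\<close> by (auto simp: m_def)
    hence "s \<in> D" using that \<open>\<alpha> + 2 < Re s_minus\<close> \<open>Re s_plus < \<beta> - 2\<close> \<open>\<delta> > 0\<close> by (auto simp: D_def)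
    thus ?thesis using Pm[of s] that by auto
  qed
  have "f analytic_on {s}" if "s \<in> D - P" for s
    using nicely_meromorphic_on_imp_analytic_at[OF \<open>f nicely_meromorphic_on D\<close>, of s] that
      by (auto simp: P_def)
  hence "f analytic_on (D - P)" by (subst analytic_on_analytic_at) blast
  hence holoDP: "f holomorphic_on (D - P)" by (rule analytic_imp_holomorphic)
  have D: "open D" "connected D"
  proof -
    have eq: "D = {s. Re s > \<alpha> - \<delta>} \<inter> {s. Re s < \<beta> + \<delta>}" by (auto simp: D_def)
    show "open D" unfolding eq by (intro open_Int open_halfspace_Re_gt open_halfspace_Re_lt)
    show "connected D" unfolding eq
      by (intro convex_connected convex_Int convex_halfspace_Re_gt convex_halfspace_Re_lt)
  qed
  have DP: "open (D - P)" "connected (D - P)"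
    using D P by (auto intro!: open_Diff finite_imp_closed connected_open_delete_finite)
  have "\<bar>Re (\<i> * \<rho>)\<bar> < c" using c by simp
  hence irhoDP: "\<i> * \<rho> \<in> D - P" using c by (intro strip) simp

  \<comment> \<open>Otherwise f would vanish in a punctured neighbourhood of a pole. This is what
    makes the zero of f isolated, D - P being connected.\<close>
  have nonzero: "\<exists>w\<in>D - P. f w \<noteq> 0"
  proof (rule ccontr)
    assume "\<not> ?thesis"
    hence z: "f w = 0" if "w \<in> D - P" for w using that by blast
    obtain p where p: "p \<in> P" using P by blast
    hence pD: "p \<in> D" "is_pole f p" by (auto simp: P_def)
    have "\<forall>\<^sub>F w in at p. w \<in> D - (P - {p}) - {p}"
      by (rule eventually_at_in_open) (use D P pD in \<open>auto intro!: open_Diff finite_imp_closed\<close>)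
    hence "\<forall>\<^sub>F w in at p. f w = 0" by eventually_elim (use z in auto)
    hence "is_pole f p \<longleftrightarrow> is_pole (\<lambda>_. 0 :: complex) p" by (intro is_pole_cong) auto
    thus False using pD by simp
  qed

  \<comment> \<open>A rate that is not negative allows |s| to be replaced by the larger c + |Im s|.
    The middle of the strip, where the asymptotic bound says nothing, is compact.\<close>
  have "\<exists>K. \<forall>s. \<bar>Re s\<bar> < c \<longrightarrow> norm (f s) \<le> K * exp (max r 0 * \<bar>Im s\<bar>)"
  proof -
    obtain C where C: "C > 0" "\<forall>\<^sub>F s in inf at_infinity (principal D). norm (f s) \<le>
      C * norm (of_real (exp (r * norm s)) :: complex)"
      using landau_o.bigE[OF \<open>f \<in> O[inf at_infinity (principal D)](\<lambda>s. of_real (exp (r * norm s)))\<close>] by blast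
    then obtain B where B: "\<And>s. s \<in> D \<Longrightarrow> B \<le> norm s \<Longrightarrow> norm (f s) \<le> C * exp (r * norm s)"
      by (auto simp: eventually_inf_principal eventually_at_infinity)
    define r' where "r' = max r 0"
    define Q where "Q = cbox (Complex (-c) (-B)) (Complex c B)"
    have "Q \<subseteq> D - P" using c by (auto simp: Q_def in_cbox_complex_iff intro!: strip)
    hence "compact (f ` Q)"
      unfolding Q_def by (intro compact_continuous_image compact_cbox holomorphic_on_imp_continuous_on
        holomorphic_on_subset[OF holoDP])
    then obtain A where A: "\<And>s. s \<in> Q \<Longrightarrow> norm (f s) \<le> A"
      using compact_imp_bounded bounded_iff by (metis imageI)
    define K where "K = max A (C * exp (r' * c))"
    have "norm (f s) \<le> K * exp (r' * \<bar>Im s\<bar>)" if s: "\<bar>Re s\<bar> < c" for s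
    proof (cases "\<bar>Im s\<bar> \<le> B")
      case True
      hence "norm (f s) \<le> A" using s by (intro A) (auto simp: Q_def in_cbox_complex_iff)
      hence 1: "norm (f s) \<le> K" by (simp add: K_def)
      hence "K * 1 \<le> K * exp (r' * \<bar>Im s\<bar>)" using order_trans[OF norm_ge_zero 1]
        by (intro mult_left_mono) (auto simp: r'_def)
      with 1 show ?thesis by simp
    next
      case False
      have "B \<le> norm s" using False abs_Im_le_cmod[of s] by linarith
      moreover have "s \<in> D" using strip[of s] s c by auto
      ultimately have "norm (f s) \<le> C * exp (r * norm s)" by (intro B)
      also have "r * norm s \<le> r' * norm s" by (intro mult_right_mono) (auto simp: r'_def)
      also have "r' * norm s \<le> r' * (c + \<bar>Im s\<bar>)" using cmod_le[of s] s
        by (intro mult_left_mono) (auto simp: r'_def)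
      also have "C * exp (r' * (c + \<bar>Im s\<bar>)) = C * exp (r' * c) * exp (r' * \<bar>Im s\<bar>)"
        by (simp add: distrib_left exp_add)
      also have "\<dots> \<le> K * exp (r' * \<bar>Im s\<bar>)" by (intro mult_right_mono) (auto simp: K_def)
      finally show ?thesis using C(1) by simp
    qed
    thus ?thesis unfolding r'_def by blast
  qed
  then obtain K where K: "\<And>s. \<bar>Re s\<bar> < c \<Longrightarrow> norm (f s) \<le> K * exp (max r 0 * \<bar>Im s\<bar>)" by blast
  have hf: "f holomorphic_on {s. \<bar>Re s\<bar> < c}"
    by (rule holomorphic_on_subset[OF holoDP]) (use strip c in force)
  have expandable: "mp_expandable \<nu> c f"
  proof (rule mp_expansion[OF nu c0 hf _ K])
    show "max r 0 < pi / 2" unfolding max_less_iff_conj using \<open>r < pi / 2\<close> pi_gt_zero by simp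
  qed

  define g where "g t = f (\<i> * t)" for t
  define S where "S n = mp_partial_sum \<nu> f n" for n
  obtain c1 where c1: "\<bar>Im \<rho>\<bar> < c1" "c1 < c" using dense[OF c(1)] by blast
  define e1 where "e1 = c1 - \<bar>Im \<rho>\<bar>"
  have e1: "e1 > 0" using c1 by (simp add: e1_def)
  have strip_ball: "\<bar>Im t\<bar> \<le> c1 \<and> \<bar>Re t\<bar> \<le> \<bar>Re \<rho>\<bar> + e1" if "t \<in> cball \<rho> e1" for t
  proof -
    have "norm (t - \<rho>) \<le> e1" using that by (simp add: dist_norm norm_minus_commute)
    hence "\<bar>Im t - Im \<rho>\<bar> \<le> e1" "\<bar>Re t - Re \<rho>\<bar> \<le> e1"
      using abs_Im_le_cmod[of "t - \<rho>"] abs_Re_le_cmod[of "t - \<rho>"] by simp_all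
    thus ?thesis unfolding e1_def by linarith
  qed
  have unif: "uniform_limit (cball \<rho> e1) S g sequentially"
  proof -
    have "uniform_limit {s. \<bar>Re s\<bar> \<le> c1 \<and> \<bar>Im s\<bar> \<le>
      \<bar>Re \<rho>\<bar> + e1} (\<lambda>n s. \<Sum>k\<le>n. mp_coeff \<nu> f k * mp_poly \<nu> k s) f sequentially"
      by (rule mp_expandable_uniform_limit[OF nu expandable]) (use c1 in auto)
    from uniform_limit_compose'[OF this, of "\<lambda>t. \<i> * t" "cball \<rho> e1"]
    show ?thesis unfolding S_def g_def mp_partial_sum_def[abs_def] using strip_ball by auto
  qed
  have holoS: "S n holomorphic_on A" for n A
  proof -
    have "(mp_poly \<nu> k \<circ> (\<lambda>t. \<i> * t)) holomorphic_on A" for k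
      by (rule holomorphic_on_compose_gen[OF _ mp_poly_holomorphic[OF nu,
        of _ UNIV]]) (auto intro!: holomorphic_intros)
    thus ?thesis unfolding S_def mp_partial_sum_def[abs_def] o_def by (intro holomorphic_intros)
  qed
  have holog: "g holomorphic_on cball \<rho> e1"
  proof -
    have "(f \<circ> (\<lambda>t. \<i> * t)) holomorphic_on cball \<rho> e1"
      by (rule holomorphic_on_compose_gen[OF _ hf]) (use strip_ball c1 in \<open>force intro!: holomorphic_intros\<close>)+
    thus ?thesis by (simp add: g_def[abs_def] o_def)
  qed
  \<comment> \<open>The local factorisation f(w) = h(w) (w - \<i> \<rho>)^n with h nonzero isolates
    the zero and, for n = 1, gives g'(\<rho>) = \<i> h(\<i> \<rho>), which is not 0.\<close>
  define h where "h = zor_poly f (\<i> * \<rho>)"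
  define n where "n = zorder f (\<i> * \<rho>)"
  have "(if f (\<i> * \<rho>) = 0 then n > 0 else n =
    0) \<and> (\<exists>e>0. cball (\<i> * \<rho>) e \<subseteq> D - P \<and> h holomorphic_on cball (\<i> * \<rho>) e
     \<and> (\<forall>w\<in>cball (\<i> * \<rho>) e. f w = h w * (w - \<i> * \<rho>) ^ nat n \<and> h w \<noteq> 0))"
    unfolding h_def n_def by (rule zorder_exist_zero[OF holoDP DP irhoDP nonzero])
  then obtain e2 where e2: "e2 > 0" "h holomorphic_on cball (\<i> * \<rho>) e2"
      "\<And>w. w \<in> cball (\<i> * \<rho>) e2 \<Longrightarrow> f w = h w * (w - \<i> * \<rho>) ^ nat n \<and> h w \<noteq> 0"
    by blast
  have gnz: "g t \<noteq> 0" if "dist \<rho> t \<le> e2" "t \<noteq> \<rho>" for t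
  proof -
    have "dist (\<i> * \<rho>) (\<i> * t) = dist \<rho> t" by (simp add: dist_norm norm_mult flip: right_diff_distrib)
    thus ?thesis using e2(3)[of "\<i> * t"] that by (simp add: g_def)
  qed
  have exist: "\<exists>N. \<forall>n\<ge>N. \<exists>\<rho>n. \<rho>n \<in> mp_zeros \<nu> f n \<and> norm (\<rho>n - \<rho>) < \<epsilon>"
    if \<epsilon>: "0 < \<epsilon>" "\<epsilon> < min e1 e2" for \<epsilon>
  proof -
    \<comment> \<open>Half the radius turns a zero in the closed disc into one at distance strictly
      less than \<epsilon>.\<close>
    have sub: "cball \<rho> (\<epsilon> / 2) \<subseteq> cball \<rho> e1" using \<epsilon> by (intro subset_cball) auto
    have "\<forall>\<^sub>F n in sequentially. \<exists>z\<in>cball \<rho> (\<epsilon> / 2). S n z = 0"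
    proof (rule Hurwitz_existence[OF _ holoS])
      show "continuous_on (cball \<rho> (\<epsilon> / 2)) g"
        using holomorphic_on_imp_continuous_on[OF holog] sub by (rule continuous_on_subset)
      show "uniform_limit (cball \<rho> (\<epsilon> / 2)) S g sequentially" using sub unif
        by (rule uniform_limit_on_subset[rotated])
      show "g z \<noteq> 0" if "z \<in> sphere \<rho> (\<epsilon> / 2)" for z using that \<epsilon> by (intro gnz) auto
    qed (use \<epsilon> f0 in \<open>auto simp: g_def\<close>)
    then obtain N where N: "\<And>n. n \<ge> N \<Longrightarrow> \<exists>z\<in>cball \<rho> (\<epsilon> / 2). S n z = 0"
      by (auto simp: eventually_at_top_linorder)
    have "\<exists>\<rho>n. \<rho>n \<in> mp_zeros \<nu> f n \<and> norm (\<rho>n - \<rho>) < \<epsilon>" if nN: "n \<ge> N" for n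
    proof -
      obtain z where "z \<in> cball \<rho> (\<epsilon> / 2)" "S n z = 0" using N[OF nN] by blast
      thus ?thesis using \<epsilon> by (intro exI[of _ z]) (auto simp: mp_zeros_def S_def dist_norm norm_minus_commute)
    qed
    thus ?thesis by blast
  qed
  have simple: "\<exists>e>0. \<exists>N. \<forall>k\<ge>N. inj_on (S k) (ball \<rho> e)" if "n = 1"
  proof -
    have "(f has_field_derivative h (\<i> * \<rho>)) (at (\<i> * \<rho>))"
    proof -
      have "h field_differentiable at (\<i> * \<rho>)"
        using e2 by (intro holomorphic_on_imp_differentiable_at[OF holomorphic_on_subset[OF e2(2)
          ball_subset_cball]]) auto
      then obtain h' where h': "(h has_field_derivative h') (at (\<i> * \<rho>))"
        by (auto simp: field_differentiable_def)
      have "((\<lambda>w. h w * (w - \<i> * \<rho>)) has_field_derivative h (\<i> * \<rho>)) (at (\<i> * \<rho>))"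
        by (rule derivative_eq_intros h' refl | simp)+
      moreover have ev: "\<forall>\<^sub>F w in nhds (\<i> * \<rho>). h w * (w - \<i> * \<rho>) = f w"
        by (rule eventually_mono[OF eventually_nhds_in_open[of "ball (\<i> * \<rho>) e2"]]) (use e2 that in auto)
      ultimately show ?thesis using DERIV_cong_ev[OF refl ev refl] by blast
    qed
    hence "(g has_field_derivative h (\<i> * \<rho>) * \<i>) (at \<rho>)"
      unfolding g_def by (rule DERIV_chain2) (auto intro!: derivative_eq_intros)
    hence dg: "deriv g \<rho> \<noteq> 0" using e2(1) e2(3)[of "\<i> * \<rho>"] by (simp add: DERIV_imp_deriv)
    obtain e where "e > 0" "\<forall>\<^sub>F k in sequentially. inj_on (S k) (ball \<rho> e)"
      by (rule Hurwitz_uniqueness[OF e1 holoS holomorphic_on_subset[OF holog ball_subset_cball]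
            uniform_limit_on_subset[OF unif ball_subset_cball] dg])
    thus ?thesis by (auto simp: eventually_at_top_linorder)
  qed
  \<comment> \<open>For a multiple zero \<open>e3\<close> = 1 is a mere placeholder.\<close>
  obtain e3 N0 where e3: "e3 > 0" "n = 1 \<Longrightarrow> \<forall>k\<ge>N0. inj_on (S k) (ball \<rho> e3)"
    using simple by (cases "n = 1") (auto intro: that[of 1])
  define \<epsilon>0 where "\<epsilon>0 = min (min e1 e2) e3"
  have "\<epsilon>0 > 0" using e1 e2 e3 by (simp add: \<epsilon>0_def)
  moreover have "\<exists>N. \<forall>k\<ge>N. (\<exists>\<rho>n. \<rho>n \<in> mp_zeros \<nu> f k \<and> norm (\<rho>n - \<rho>) < \<epsilon>) \<and>
         (zorder f (\<i> * \<rho>) = 1 \<longrightarrow> (\<exists>!\<rho>n. \<rho>n \<in> mp_zeros \<nu> f k \<and> norm (\<rho>n - \<rho>) < \<epsilon>))"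
    if \<epsilon>: "0 < \<epsilon> \<and> \<epsilon> < \<epsilon>0" for \<epsilon>
  proof -
    obtain N where N: "\<And>k. k \<ge> N \<Longrightarrow> \<exists>\<rho>n. \<rho>n \<in> mp_zeros \<nu> f k \<and> norm (\<rho>n - \<rho>) < \<epsilon>"
      using exist[of \<epsilon>] \<epsilon> by (auto simp: \<epsilon>0_def)
    have "\<exists>!\<rho>n. \<rho>n \<in> mp_zeros \<nu> f k \<and> norm (\<rho>n - \<rho>) < \<epsilon>" if k: "k \<ge> max N N0" and n1: "n = 1" for k
    proof (rule ex_ex1I)
      show "\<exists>\<rho>n. \<rho>n \<in> mp_zeros \<nu> f k \<and> norm (\<rho>n - \<rho>) < \<epsilon>" using N k by simp
      fix x y assume xy: "x \<in> mp_zeros \<nu> f k \<and> norm (x - \<rho>) < \<epsilon>" "y \<in> mp_zeros \<nu> f k \<and> norm (y - \<rho>) < \<epsilon>"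
      have "inj_on (S k) (ball \<rho> e3)" using e3(2)[OF n1] k by simp
      moreover have "S k x = S k y" using xy by (simp add: mp_zeros_def S_def)
      moreover have "x \<in> ball \<rho> e3" "y \<in> ball \<rho> e3" using xy \<epsilon>
        by (simp_all add: \<epsilon>0_def dist_norm norm_minus_commute)
      ultimately show "x = y" by (rule inj_onD)
    qed
    thus ?thesis using N unfolding n_def by (intro exI[of _ "max N N0"]) auto
  qed
  ultimately show "\<exists>\<epsilon>0>0. \<forall>\<epsilon>::real. 0 < \<epsilon> \<and> \<epsilon> < \<epsilon>0 \<longrightarrow>
      (\<exists>N::nat. \<forall>n\<ge>N.
         (\<exists>\<rho>n. \<rho>n \<in> mp_zeros \<nu> f n \<and> norm (\<rho>n - \<rho>) < \<epsilon>) \<and>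
         (zorder f (\<i> * \<rho>) = 1 \<longrightarrow>
            (\<exists>!\<rho>n. \<rho>n \<in> mp_zeros \<nu> f n \<and> norm (\<rho>n - \<rho>) < \<epsilon>)))"
    by blast
qed

end
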